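(* Let $E: y^2 = 4x^3 - g_2 x - g_3$ be an elliptic curve over $\mathbb{C}$ with discriminant $\Delta(E) = g_2^3 - 27 g_3^2$ and period lattice $\Lambda(E) = \mathbb{Z}\omega_1 + \mathbb{Z}\omega_2$, and let $\tau = \omega_2/\omega_1$ lie in the upper half-plane. Let $\lambda = \lambda(\tau)$. Then for $\tau$ around $1$, $$\omega_1 = 2^{1/3}\, \frac{\pi i}{(\tau+1)\sqrt{1-\lambda}}\, (\lambda(1-\lambda))^{1/6}\, \Delta(E)^{-1/12}\, {}_{2}F_{1}\Big(\tfrac12, \tfrac12; 1; \tfrac{1}{1-\lambda}\Big).$$
   Context: $\lambda(\tau)$ is the modular lambda function on the upper half-plane, with $q$-expansion $\lambda(\tau) = 16q^{1/2} - 128 q + 704 q^{3/2} - \cdots$, $q = e^{2\pi i\tau}$; it satisfies $\lambda(\tau\pm1)=\lambda(\tau)/(\lambda(\tau)-1)$ and $\lambda(-1/\tau)=1-\lambda(\tau)$. "$\tau$ around $1$" means $\tau$ lies in the fundamental domain of $\Gamma(2)$ near the cusp $1$, where $\lambda(\tau)\to\infty$ (so $|1/(1-\lambda(\tau))|<1$). ${}_{2}F_{1}$ is the Gauss hypergeometric function. The fractional powers and square root are taken with compatible branches (consistent with $\Delta(\tau)=\omega_1^{12}\Delta(E)$, where $\Delta(\tau)=(2\pi)^{12}\eta(\tau)^{24}$ and $\eta$ is the Dedekind eta function).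
   Formalization: "τ around 1" is read at the Γ(2)-equivalent cusp −1: τ+1 lies in the standard fundamental domain of Γ(2) and |1/(1−λ)|<1; near the literal point 1 the printed formula fails, being off in modulus by |τ−1|/|τ+1|, since the factor there should be τ−1. *)

theory Defs
  imports "HOL-Analysis.Analysis"
begin

abbreviation upper_half_plane :: "complex set" where
  "upper_half_plane \<equiv> {\<tau>. Im \<tau> > 0}"

definition eisenstein_sum :: "nat \<Rightarrow> complex set \<Rightarrow> complex" where
  "eisenstein_sum k L = (\<Sum>\<^sub>\<infinity>w\<in>L - {0}. 1 / w ^ k)"

definition lattice_of :: "complex \<Rightarrow> complex \<Rightarrow> complex set" where
  "lattice_of \<omega>1 \<omega>2 = {of_int m * \<omega>1 + of_int n * \<omega>2 | m n. True}"

(* L is the period lattice of y^2 = 4 x^3 - g2 x - g3, i.e. the lattice whose Weierstrass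
   functions parametrise the curve by z \<mapsto> (\<wp>(z), \<wp>'(z)). *)
definition is_period_lattice :: "complex \<Rightarrow> complex \<Rightarrow> complex set \<Rightarrow> bool" where
  "is_period_lattice g2 g3 L \<longleftrightarrow> g2 = 60 * eisenstein_sum 4 L \<and> g3 = 140 * eisenstein_sum 6 L"

definition curve_discr :: "complex \<Rightarrow> complex \<Rightarrow> complex" where
  "curve_discr g2 g3 = g2 ^ 3 - 27 * g3 ^ 2"

definition theta2 :: "complex \<Rightarrow> complex" where
  "theta2 \<tau> = (\<Sum>\<^sub>\<infinity>n\<in>(UNIV :: int set). exp (pi * \<i> * (of_int n + 1 / 2) ^ 2 * \<tau>))"

definition theta3 :: "complex \<Rightarrow> complex" where
  "theta3 \<tau> = (\<Sum>\<^sub>\<infinity>n\<in>(UNIV :: int set). exp (pi * \<i> * (of_int n) ^ 2 * \<tau>))"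

definition modular_lambda :: "complex \<Rightarrow> complex" where
  "modular_lambda \<tau> = theta2 \<tau> ^ 4 / theta3 \<tau> ^ 4"

definition dedekind_eta :: "complex \<Rightarrow> complex" where
  "dedekind_eta \<tau> = exp (pi * \<i> * \<tau> / 12) * (\<Prod>n. 1 - exp (2 * pi * \<i> * of_nat (Suc n) * \<tau>))"

definition hyp_2F1 :: "complex \<Rightarrow> complex \<Rightarrow> complex \<Rightarrow> complex \<Rightarrow> complex" where
  "hyp_2F1 a b c z = eval_fps (fps_hypergeo [a, b] [c] 1) z"

definition Gamma2_fundamental_domain :: "complex set" where
  "Gamma2_fundamental_domain =
     {\<tau>. Im \<tau> > 0 \<and> \<bar>Re \<tau>\<bar> \<le> 1 \<and> cmod (\<tau> - 1 / 2) \<ge> 1 / 2 \<and> cmod (\<tau> + 1 / 2) \<ge> 1 / 2}"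

(* Gamma(2) is normal in SL(2,Z), so the translate of its fundamental domain by -1 is again a
   fundamental domain. There the cusp 1 is represented by the equivalent point -1 = 1 - 2, which
   is where -1/(\<tau>+1) tends to i\<infinity>, and the corner at this cusp is not cut in two. *)
definition Gamma2_domain_cusp1 :: "complex set" where
  "Gamma2_domain_cusp1 = {\<tau>. \<tau> + 1 \<in> Gamma2_fundamental_domain}"

(* g is the holomorphic branch on the upper half-plane of the n-th root of f whose expansion
   at i\<infinity> has a positive leading coefficient: g \<sim> c q^r with c > 0, where q = exp(2 pi i \<tau>).
   It is unique, as two branches differ by a constant root of unity. *)
definition root_branch ::
  "nat \<Rightarrow> (complex \<Rightarrow> complex) \<Rightarrow> real \<Rightarrow> (complex \<Rightarrow> complex) \<Rightarrow> bool" where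
  "root_branch n f r g \<longleftrightarrow>
     g holomorphic_on upper_half_plane \<and>
     (\<forall>\<tau>\<in>upper_half_plane. g \<tau> ^ n = f \<tau>) \<and>
     (\<exists>c::real. c > 0 \<and>
        ((\<lambda>\<tau>. g \<tau> / exp (2 * pi * \<i> * r * \<tau>)) \<longlongrightarrow> of_real c) (filtercomap Im at_top))"

end

theory Submission
  imports Defs "HOL-Complex_Analysis.Complex_Analysis" "HOL-Real_Asymp.Real_Asymp"
    "HOL-Probability.Characteristic_Functions"
begin

text \<open>
  Write \<open>\<theta>\<^sub>4(\<tau>) = \<theta>\<^sub>3(\<tau> + 1)\<close>. Since \<open>\<theta>\<^sub>2 \<theta>\<^sub>3 \<theta>\<^sub>4 = 2 \<eta>\<^sup>3\<close> and \<open>1 - \<lambda> = (\<theta>\<^sub>4 / \<theta>\<^sub>3)\<^sup>4\<close>, the two branches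
  are \<open>\<theta>\<^sub>4\<^sup>2 / \<theta>\<^sub>3\<^sup>2\<close> and \<open>2 powr (2/3) * \<eta>\<^sup>2 / \<theta>\<^sub>3\<^sup>2\<close>. With \<open>t = - 1 / (\<tau> + 1)\<close> one has
  \<open>\<lambda>(t) = 1 / (1 - \<lambda>(\<tau>))\<close> and \<open>\<theta>\<^sub>3(t)\<^sup>2 = - i (\<tau> + 1) \<theta>\<^sub>4(\<tau>)\<^sup>2\<close>, so the formula says that
  \<open>F(\<lambda>(t)) = \<theta>\<^sub>3(t)\<^sup>2\<close>, together with the product formula for the discriminant.

  For the former, Landen's transformation makes \<open>F(\<lambda>(t)) / \<theta>\<^sub>3(t)\<^sup>2\<close> invariant under \<open>t \<mapsto> 2 t\<close>, and the
  quotient tends to 1. The transformation involves the principal square root of \<open>1 - \<lambda>(t)\<close>, which is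
  \<open>(\<theta>\<^sub>4 / \<theta>\<^sub>3)\<^sup>2\<close> as soon as \<open>\<bar>\<theta>\<^sub>2(2 t)\<bar> \<le> \<bar>\<theta>\<^sub>3(2 t)\<bar>\<close>; this is where the fundamental domain enters.

  For the latter, the Eisenstein series of weights 4 and 6 are polynomials in the fourth powers of the
  theta constants, because there are no cusp forms of weight less than 12.
\<close>

section \<open>Sums over the integers and theta constants\<close>

text \<open>Since \<lambda> is invariant under \<Gamma>(2) and the square of theta3 is not, the
  identity F(\<lambda>(t)) = theta3(t)^2 cannot follow from |\<lambda>(t)| < 1 alone: at points
  equivalent to t the left side is the same. So the domain has to enter through an inequality, and
  this inequality is sharp, because |theta2| and |theta3| agree on the boundary of the region where
  it is needed. Moreover doubling leaves the fundamental domain. The iteration therefore runs in the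
  set of points outside the unit discs about the odd integers, which is stable under doubling and
  contains the double of the domain.

  The exact values of the zeta function at 4 and 6 are there to match constant terms: the difference
  of an Eisenstein series and a polynomial in theta constants must vanish at the cusp before the
  absence of cusp forms applies. The inversion laws of the theta constants all come from one real
  identity on the imaginary axis, Poisson summation for the Gaussian, which is derived from the
  uniqueness of cosine coefficients.\<close>

lemma tendsto_infsum_dominated:
  fixes f :: "'t \<Rightarrow> 'a \<Rightarrow> 'b::banach" and M :: "'a \<Rightarrow> real"
  assumes M: "M summable_on A"
    and lim: "\<And>x. x \<in> A \<Longrightarrow> ((\<lambda>t. f t x) \<longlongrightarrow> g x) F"
    and bound: "\<forall>\<^sub>F t in F. \<forall>x\<in>A. norm (f t x) \<le> M x"
    and F: "F \<noteq> bot"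
  shows "((\<lambda>t. infsum (f t) A) \<longlongrightarrow> infsum g A) F"
proof -
  \<comment> \<open>The bound is known only eventually in \<open>t\<close>; on \<open>Y\<close> the
    M-test makes the finite sums converge uniformly, which permits exchanging the two
    limits.\<close>
  define Y where "Y = {t. \<forall>x\<in>A. norm (f t x) \<le> M x}"
  have gM: "norm (g x) \<le> M x" if "x \<in> A" for x
  proof (rule tendsto_upperbound)
    show "((\<lambda>t. norm (f t x)) \<longlongrightarrow> norm (g x)) F" by (intro tendsto_norm lim that)
    show "\<forall>\<^sub>F t in F. norm (f t x) \<le> M x" using bound by eventually_elim (use that in auto)
  qed (use F in auto)
  have g: "g summable_on A"
    by (rule abs_summable_summable, rule Infinite_Sum.abs_summable_on_comparison_test'[OF M]) (use gM in auto)
  show ?thesis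
  proof (rule swap_uniform_limit')
    show "uniform_limit Y (\<lambda>X t. \<Sum>x\<in>X. f t x) (\<lambda>t. infsum (f t) A) (finite_subsets_at_top A)"
      by (rule Weierstrass_m_test_general[OF _ M]) (auto simp: Y_def)
    show "\<forall>\<^sub>F X in finite_subsets_at_top A. ((\<lambda>t. \<Sum>x\<in>X. f t x) \<longlongrightarrow> (\<Sum>x\<in>X. g x)) F"
      by (rule eventually_finite_subsets_at_top_weakI) (auto intro!: tendsto_sum lim)
    show "((\<lambda>X. \<Sum>x\<in>X. g x) \<longlongrightarrow> infsum g A) (finite_subsets_at_top A)"
      using has_sum_infsum[OF g] by (simp add: has_sum_def)
    show "\<forall>\<^sub>F t in F. t \<in> Y" using bound by (simp add: Y_def)
  qed auto
qed

text \<open>A locally uniform limit of holomorphic finite sums is holomorphic. The majorant may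
  change with the disc, as it must for theta and Eisenstein series, whose bounds degenerate near the
  real axis.\<close>

lemma holomorphic_on_infsum:
  fixes f :: "complex \<Rightarrow> 'a \<Rightarrow> complex"
  assumes S: "open S"
    and hol: "\<And>x. x \<in> A \<Longrightarrow> (\<lambda>t. f t x) holomorphic_on S"
    and bound: "\<And>z. z \<in> S \<Longrightarrow> \<exists>r>0. \<exists>M. (M::'a \<Rightarrow> real) summable_on A \<and>
                  (\<forall>t\<in>cball z r. \<forall>x\<in>A. norm (f t x) \<le> M x)"
  shows "(\<lambda>t. infsum (f t) A) holomorphic_on S"
proof -
  have "(\<lambda>t. infsum (f t) A) field_differentiable (at z)" if z: "z \<in> S" for z
  proof -
    obtain r M where r: "r > 0" and M: "M summable_on A"
      and le: "\<And>t x. t \<in> cball z r \<Longrightarrow> x \<in> A \<Longrightarrow> norm (f t x) \<le> M x"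
      using bound[OF z] by blast
    obtain r' where r': "r' > 0" "cball z r' \<subseteq> S" using S z open_contains_cball by blast
    define s where "s = min r r'"
    have s: "s > 0" "cball z s \<subseteq> S" "cball z s \<subseteq> cball z r" using r r' by (auto simp: s_def)
    have ul: "uniform_limit (cball z s) (\<lambda>X t. \<Sum>x\<in>X. f t x) (\<lambda>t. infsum (f t) A) (finite_subsets_at_top A)"
      by (rule Weierstrass_m_test_general[OF _ M]) (use le s in auto)
    have ev: "\<forall>\<^sub>F X in finite_subsets_at_top A. continuous_on (cball z s) (\<lambda>t. \<Sum>x\<in>X. f t x) \<and>
               (\<lambda>t. \<Sum>x\<in>X. f t x) holomorphic_on ball z s"
    proof (rule eventually_finite_subsets_at_top_weakI)
      fix X assume X: "finite X" "X \<subseteq> A"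
      have "(\<lambda>t. \<Sum>x\<in>X. f t x) holomorphic_on S"
        using X by (intro holomorphic_on_sum hol) auto
      then show "continuous_on (cball z s) (\<lambda>t. \<Sum>x\<in>X. f t x) \<and> (\<lambda>t. \<Sum>x\<in>X. f t x) holomorphic_on ball z s"
        using s by (meson ball_subset_cball continuous_on_subset holomorphic_on_imp_continuous_on holomorphic_on_subset)
    qed
    have "(\<lambda>t. infsum (f t) A) holomorphic_on ball z s"
      by (rule holomorphic_uniform_limit[OF ev ul]) auto
    then show ?thesis using s(1) holomorphic_on_imp_differentiable_at by auto
  qed
  then show ?thesis
    using S by (simp add: holomorphic_on_open field_differentiable_def)
qed

text \<open>The negative integers are listed as \<open>- int n - 1\<close>, so that both halves run
  over all naturals and 0 is counted once.\<close>

lemma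
  fixes f :: "int \<Rightarrow> 'a::banach"
  assumes "(\<lambda>n::nat. f (int n)) summable_on UNIV" "(\<lambda>n::nat. f (- int n - 1)) summable_on UNIV"
  shows summable_on_int: "f summable_on UNIV"
    and infsum_int: "infsum f UNIV = (\<Sum>\<^sub>\<infinity>n. f (int n)) + (\<Sum>\<^sub>\<infinity>n. f (- int n - 1))"
proof -
  have inj: "inj int" "inj (\<lambda>n. - int n - 1)" by (auto simp: inj_on_def)
  have un: "range int \<union> range (\<lambda>n. - int n - 1) = UNIV"
  proof (intro equalityI subsetI)
    fix z :: int
    show "z \<in> range int \<union> range (\<lambda>n. - int n - 1)"
    proof (cases "z \<ge> 0")
      case True
      then have "z = int (nat z)" by simp
      then show ?thesis by blast
    next
      case False
      then have "z = - int (nat (-z-1)) - 1" by simp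
      then show ?thesis by blast
    qed
  qed auto
  have dis: "range int \<inter> range (\<lambda>n. - int n - 1) = {}" by auto
  have 1: "f summable_on range int" using assms(1) summable_on_reindex[OF inj(1), of f] by (simp add: o_def)
  have 2: "f summable_on range (\<lambda>n. - int n - 1)"
    using assms(2) summable_on_reindex[OF inj(2), of f] by (simp add: o_def)
  show "f summable_on UNIV" using summable_on_Un_disjoint[OF 1 2 dis] un by simp
  show "infsum f UNIV = (\<Sum>\<^sub>\<infinity>n. f (int n)) + (\<Sum>\<^sub>\<infinity>n. f (- int n - 1))"
    using infsum_Un_disjoint[OF 1 2 dis] un infsum_reindex[OF inj(1), of f] infsum_reindex[OF inj(2), of f]
    by (simp add: o_def)
qed

text \<open>A linear lower bound for the square replaces Gaussian terms by geometric ones, uniformly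
  in the shift. The constant 1 is sharp: equality holds at \<open>n = -1\<close>,
  \<open>c = 1\<close>.\<close>

lemma square_int_add_ge:
  fixes n :: int and c :: real
  assumes "0 \<le> c" "c \<le> 1"
  shows "(of_int n + c)\<^sup>2 \<ge> real (nat \<bar>n\<bar>) - 1"
proof -
  define t where "t = of_int n + c"
  have a: "real (nat \<bar>n\<bar>) = \<bar>of_int n\<bar>" by simp
  have *: "t\<^sup>2 \<ge> 2 * t - 1" "t\<^sup>2 \<ge> - 2 * t - 1"
    using zero_le_power2[of "t - 1"] zero_le_power2[of "t + 1"] by (simp_all add: power2_eq_square algebra_simps)
  consider "n \<ge> 0" | "n = -1" | "n \<le> -2" by linarith
  then show ?thesis
  proof cases
    case 1
    then have "real_of_int n \<ge> 0" by simp
    then show ?thesis using * assms unfolding a t_def[symmetric] by (simp add: t_def)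
  next
    case 2 then show ?thesis by simp
  next
    case 3
    then have "real_of_int n \<le> -2" by linarith
    then show ?thesis using * assms unfolding a t_def[symmetric] by (simp add: t_def)
  qed
qed

lemma summable_on_exp_abs_int:
  fixes y :: real
  assumes "y > 0"
  shows "(\<lambda>n::int. exp (- (pi * y * (real (nat \<bar>n\<bar>) - 1)))) summable_on UNIV"
proof -
  define r where "r = exp (- pi * y)"
  have r: "0 < r" "r < 1" using assms by (auto simp: r_def)
  have geo: "(\<lambda>n::nat. r ^ n) summable_on UNIV"
    using r by (intro summable_nonneg_imp_summable_on summable_geometric) auto
  have s: "(\<lambda>n::int. (1/r) * r ^ nat \<bar>n\<bar>) summable_on UNIV"
  proof (rule summable_on_cmult_right, rule summable_on_int)
    show "(\<lambda>n. r ^ nat \<bar>int n\<bar>) summable_on UNIV" using geo by simp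
    have "nat \<bar>- int n - 1\<bar> = Suc n" for n by simp
    then show "(\<lambda>n. r ^ nat \<bar>- int n - 1\<bar>) summable_on UNIV"
      using summable_on_cmult_right[OF geo, of r] by simp
  qed
  have "(1/r) * r ^ nat \<bar>n\<bar> = exp (- (pi * y * (real (nat \<bar>n\<bar>) - 1)))" for n :: int
    by (simp add: r_def exp_diff exp_minus exp_of_nat_mult[symmetric] field_simps)
  then show ?thesis using s by simp
qed

lemma summable_on_gaussian_int:
  fixes c y :: real
  assumes "0 \<le> c" "c \<le> 1" "y > 0"
  shows "(\<lambda>n::int. exp (- (pi * (of_int n + c)\<^sup>2 * y))) summable_on UNIV"
proof (rule summable_on_comparison_test[OF summable_on_exp_abs_int[OF assms(3)]])
  fix n :: int
  show "exp (- (pi * (of_int n + c)\<^sup>2 * y)) \<le> exp (- (pi * y * (real (nat \<bar>n\<bar>) - 1)))"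
    using mult_left_mono[OF square_int_add_ge[OF assms(1,2), of n], of "pi * y"] assms(3)
    by (simp add: mult_ac)
qed auto

section \<open>Theta constants: holomorphy and translations\<close>

definition theta_shift :: "real \<Rightarrow> complex \<Rightarrow> complex" where
  "theta_shift c \<tau> = (\<Sum>\<^sub>\<infinity>n\<in>(UNIV :: int set). exp (pi * \<i> * (of_int n + of_real c) ^ 2 * \<tau>))"

definition theta4 :: "complex \<Rightarrow> complex" where
  "theta4 \<tau> = theta3 (\<tau> + 1)"

lemma theta3_eq_shift: "theta3 = theta_shift 0"
  and theta2_eq_shift: "theta2 = theta_shift (1/2)"
  by (auto simp: theta3_def theta2_def theta_shift_def fun_eq_iff)

lemma norm_theta_term:
  "norm (exp (pi * \<i> * (of_int n + of_real c) ^ 2 * \<tau>)) = exp (- (pi * (of_int n + c)\<^sup>2 * Im \<tau>))"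
proof -
  have "pi * \<i> * (of_int n + of_real c) ^ 2 * \<tau> = of_real (pi * (of_int n + c)\<^sup>2) * (\<i> * \<tau>)"
    by simp
  then show ?thesis by (simp add: norm_exp_eq_Re del: of_real_mult of_real_power)
qed

lemma
  assumes "0 \<le> c" "c \<le> 1" "Im \<tau> > 0"
  shows abs_summable_theta: "(\<lambda>n::int. norm (exp (pi * \<i> * (of_int n + of_real c) ^ 2 * \<tau>))) summable_on UNIV"
    and summable_theta: "(\<lambda>n::int. exp (pi * \<i> * (of_int n + of_real c) ^ 2 * \<tau>)) summable_on UNIV"
proof -
  show 1: "(\<lambda>n::int. norm (exp (pi * \<i> * (of_int n + of_real c) ^ 2 * \<tau>))) summable_on UNIV"
    unfolding norm_theta_term using summable_on_gaussian_int[OF assms] .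
  then show "(\<lambda>n::int. exp (pi * \<i> * (of_int n + of_real c) ^ 2 * \<tau>)) summable_on UNIV"
    by (rule abs_summable_summable)
qed

lemma open_upper_half_plane: "open upper_half_plane"
  by (simp add: open_halfspace_Im_gt)

lemma connected_upper_half_plane: "connected upper_half_plane"
  by (simp add: convex_connected convex_halfspace_Im_gt)

lemma Im_in_cball_half:
  assumes "t \<in> cball z (Im z / 2)"
  shows "Im t \<ge> Im z / 2"
  using assms abs_Im_le_cmod[of "z - t"] by (simp add: dist_norm)

lemma holomorphic_theta_shift:
  assumes "0 \<le> c" "c \<le> 1"
  shows "theta_shift c holomorphic_on upper_half_plane"
  unfolding theta_shift_def
proof (rule holomorphic_on_infsum[OF open_upper_half_plane])
  fix z :: complex assume z: "z \<in> upper_half_plane"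
  let ?M = "\<lambda>n::int. exp (- (pi * (of_int n + c)\<^sup>2 * (Im z / 2)))"
  have "norm (exp (pi * \<i> * (of_int n + of_real c) ^ 2 * t)) \<le> ?M n" if "t \<in> cball z (Im z / 2)" for t n
    unfolding norm_theta_term using Im_in_cball_half[OF that]
    by (simp add: mult_left_mono)
  then show "\<exists>r>0. \<exists>M. M summable_on UNIV \<and>
       (\<forall>t\<in>cball z r. \<forall>x\<in>UNIV. norm (exp (pi * \<i> * (of_int x + of_real c) ^ 2 * t)) \<le> M x)"
    using z summable_on_gaussian_int[OF assms, of "Im z / 2"]
    by (intro exI[of _ "Im z / 2"] conjI exI[of _ ?M]) auto
qed (auto intro!: holomorphic_intros)

lemma holomorphic_theta3: "theta3 holomorphic_on upper_half_plane"
  and holomorphic_theta2: "theta2 holomorphic_on upper_half_plane"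
  unfolding theta3_eq_shift theta2_eq_shift by (rule holomorphic_theta_shift; simp)+

lemma holomorphic_theta4: "theta4 holomorphic_on upper_half_plane"
proof -
  have "theta3 \<circ> (\<lambda>\<tau>. \<tau> + 1) holomorphic_on upper_half_plane"
    by (rule holomorphic_on_compose_gen[OF _ holomorphic_theta3]) (auto intro!: holomorphic_intros)
  then show ?thesis by (simp add: theta4_def[abs_def] o_def)
qed

lemma exp_pi_i_of_int:
  "exp (pi * \<i> * of_int k) = (if even k then 1 else -1)"
proof (cases "even k")
  case True
  then obtain j where "k = 2 * j" by blast
  then have "pi * \<i> * of_int k = of_int j * (2 * pi * \<i>)" by simp
  then show ?thesis using True by (auto simp: exp_eq_1)
next
  case False
  then obtain j where j: "k = 2 * j + 1" by (auto elim: oddE)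
  then have e: "pi * \<i> * of_int k = of_int j * (2 * pi * \<i>) + pi * \<i>" by (simp add: algebra_simps)
  have "exp (of_int j * (2 * pi * \<i>)) = 1" by (auto simp: exp_eq_1)
  then show ?thesis using False unfolding e exp_add by simp
qed

lemma theta4_eq: "theta4 \<tau> = (\<Sum>\<^sub>\<infinity>n\<in>(UNIV :: int set). (if even n then 1 else -1) * exp (pi * \<i> * (of_int n) ^ 2 * \<tau>))"
proof -
  have "exp (pi * \<i> * (of_int n) ^ 2 * (\<tau> + 1)) = (if even n then 1 else -1) * exp (pi * \<i> * (of_int n) ^ 2 * \<tau>)" for n :: int
    using exp_pi_i_of_int[of "n^2"] by (simp add: algebra_simps exp_add)
  then show ?thesis by (simp add: theta4_def theta3_def)
qed

lemma theta3_add_2 [simp]: "theta3 (\<tau> + 2) = theta3 \<tau>"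
proof -
  have "exp (pi * \<i> * (of_int n) ^ 2 * (\<tau> + 2)) = exp (pi * \<i> * (of_int n) ^ 2 * \<tau>)" for n :: int
    using exp_pi_i_of_int[of "n^2 * 2"] by (simp add: algebra_simps exp_add)
  then show ?thesis by (simp add: theta3_def)
qed

lemma theta4_add_1 [simp]: "theta4 (\<tau> + 1) = theta3 \<tau>"
  by (simp add: theta4_def add.assoc)

lemma theta3_add_1 [simp]: "theta3 (\<tau> + 1) = theta4 \<tau>"
  by (simp add: theta4_def)

lemma theta2_add_1: "theta2 (\<tau> + 1) = exp (pi * \<i> / 4) * theta2 \<tau>"
proof -
  have "exp (pi * \<i> * (of_int n + 1/2) ^ 2 * (\<tau> + 1)) = exp (pi * \<i> / 4) * exp (pi * \<i> * (of_int n + 1/2) ^ 2 * \<tau>)" for n :: int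
  proof -
    \<comment> \<open>Here (n + 1/2)^2 = n (n + 1) + 1/4 and n (n + 1) is even, so only the 1/4
      leaves a trace in the exponential.\<close>
    have "pi * \<i> * (of_int n + 1/2) ^ 2 * (\<tau> + 1) = pi * \<i> * of_int (n * (n + 1)) + (pi * \<i> / 4 + pi * \<i> * (of_int n + 1/2) ^ 2 * \<tau>)"
      by (simp add: power2_eq_square field_simps)
    then show ?thesis by (simp add: exp_add exp_pi_i_of_int del: of_int_mult of_int_add)
  qed
  then show ?thesis by (simp add: theta2_def infsum_cmult_right')
qed

lemma theta2_add_1_pow4: "theta2 (\<tau> + 1) ^ 4 = - (theta2 \<tau> ^ 4)"
proof -
  have "exp (pi * \<i> / 4) ^ 4 = (-1 :: complex)"
    by (simp flip: exp_of_nat_mult)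
  then show ?thesis by (simp add: theta2_add_1 power_mult_distrib)
qed

lemma theta2_add_1_sq: "theta2 (\<tau> + 1) ^ 2 = \<i> * theta2 \<tau> ^ 2"
proof -
  have "exp (pi * \<i> / 4) ^ 2 = exp (\<i> * of_real (pi / 2))"
    by (simp flip: exp_of_nat_mult add: mult_ac)
  also have "\<dots> = \<i>" unfolding cis_conv_exp[symmetric] by simp
  finally show ?thesis by (simp add: theta2_add_1 power_mult_distrib)
qed

section \<open>Limits at the cusp i\<infinity>\<close>

lemma filtercomap_Im_neq_bot [simp]: "filtercomap Im at_top \<noteq> (bot :: complex filter)"
proof
  assume "filtercomap Im at_top = (bot :: complex filter)"
  then have "eventually (\<lambda>_. False) (filtercomap Im at_top)" by simp
  then obtain y0 where "\<And>t. Im t \<ge> y0 \<Longrightarrow> False"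
    by (auto simp: eventually_filtercomap eventually_at_top_linorder)
  from this[of "Complex 0 y0"] show False by simp
qed

lemma eventually_Im_ge: "\<forall>\<^sub>F t in filtercomap Im at_top. Im t \<ge> y"
  using eventually_filtercomapI[OF eventually_ge_at_top[of y], where f = Im] .

lemma tendsto_exp_Im_at_top:
  assumes "a > 0"
  shows "((\<lambda>t. exp (\<i> * of_real a * t)) \<longlongrightarrow> 0) (filtercomap Im at_top)"
proof (rule tendsto_norm_zero_cancel)
  have "((\<lambda>y. exp (- a * y)) \<longlongrightarrow> 0) at_top" using assms by real_asymp
  then have "((\<lambda>t. exp (- a * Im t)) \<longlongrightarrow> 0) (filtercomap Im at_top)"
    by (rule filterlim_compose) (rule filterlim_filtercomap)
  then show "((\<lambda>t. norm (exp (\<i> * of_real a * t))) \<longlongrightarrow> 0) (filtercomap Im at_top)"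
    by (simp add: norm_exp_eq_Re)
qed

lemma tendsto_theta3: "(theta3 \<longlongrightarrow> 1) (filtercomap Im at_top)"
proof -
  have "((\<lambda>t. \<Sum>\<^sub>\<infinity>n\<in>(UNIV :: int set). exp (pi * \<i> * (of_int n + of_real 0) ^ 2 * t)) \<longlongrightarrow>
      (\<Sum>\<^sub>\<infinity>n\<in>(UNIV :: int set). if n = 0 then 1 else 0)) (filtercomap Im at_top)"
  proof (rule tendsto_infsum_dominated)
    show "(\<lambda>n::int. exp (- (pi * (of_int n + 0)\<^sup>2 * 1))) summable_on UNIV"
      by (rule summable_on_gaussian_int) auto
    show "\<forall>\<^sub>F t in filtercomap Im at_top. \<forall>n\<in>UNIV.
       norm (exp (pi * \<i> * (of_int n + of_real 0) ^ 2 * t)) \<le> exp (- (pi * (of_int n + 0)\<^sup>2 * 1))"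
      using eventually_Im_ge[of 1] unfolding norm_theta_term
      by eventually_elim (intro ballI, subst exp_le_cancel_iff, simp only: neg_le_iff_le, intro mult_left_mono, auto)
    fix n :: int
    show "((\<lambda>t. exp (pi * \<i> * (of_int n + of_real 0) ^ 2 * t)) \<longlongrightarrow> (if n = 0 then 1 else 0)) (filtercomap Im at_top)"
    proof (cases "n = 0")
      case False
      then show ?thesis using tendsto_exp_Im_at_top[of "pi * of_int n ^ 2"] by (simp add: mult_ac)
    qed simp
  qed simp
  also have "(\<Sum>\<^sub>\<infinity>n\<in>(UNIV :: int set). if n = 0 then 1 else (0::complex)) = (\<Sum>\<^sub>\<infinity>n\<in>{0::int}. 1)"
    by (rule infsum_cong_neutral) auto
  also have "\<dots> = 1" by simp
  finally show ?thesis by (simp add: theta3_def[abs_def])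
qed

lemma tendsto_theta4: "(theta4 \<longlongrightarrow> 1) (filtercomap Im at_top)"
proof -
  have "filterlim (\<lambda>t. t + 1) (filtercomap Im at_top) (filtercomap Im (at_top :: real filter))"
    by (auto simp: filterlim_filtercomap_iff o_def filterlim_filtercomap)
  then show ?thesis unfolding theta4_def[abs_def] by (rule filterlim_compose[OF tendsto_theta3])
qed

lemma tendsto_theta2_scaled: "((\<lambda>t. theta2 t / exp (pi * \<i> * t / 4)) \<longlongrightarrow> 2) (filtercomap Im at_top)"
proof -
  have "((\<lambda>t. \<Sum>\<^sub>\<infinity>n\<in>(UNIV :: int set). exp (pi * \<i> * (of_int n + of_real (1/2)) ^ 2 * t) / exp (pi * \<i> * t / 4)) \<longlongrightarrow>
      (\<Sum>\<^sub>\<infinity>n\<in>(UNIV :: int set). if n \<in> {0, -1} then 1 else 0)) (filtercomap Im at_top)"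
  proof (rule tendsto_infsum_dominated)
    \<comment> \<open>Division by \<open>exp (pi * \<i> * t / 4)\<close> leaves the exponent n (n +
      1), so the terms shrink as Im t grows and their size at Im t = 1 is a majorant. Only n = 0 and
      n = -1 have exponent 0, whence the limit 2.\<close>
    show "(\<lambda>n::int. exp (- (pi * (of_int n + 1/2)\<^sup>2 * 1)) * exp (pi / 4)) summable_on UNIV"
      by (intro summable_on_cmult_left summable_on_gaussian_int) auto
    have e: "exp (pi * \<i> * (of_int n + of_real (1/2)) ^ 2 * t) / exp (pi * \<i> * t / 4) = exp (\<i> * of_real (pi * of_int (n * (n + 1))) * t)" for t and n :: int
      unfolding exp_diff[symmetric] by (rule arg_cong[of _ _ exp]) (simp add: power2_eq_square field_simps)
    have nn: "n * (n + 1) \<ge> 0" for n :: int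
      by (cases "n \<ge> 0") (auto intro: mult_nonneg_nonneg mult_nonpos_nonpos)
    have "norm (exp (pi * \<i> * (of_int n + of_real (1/2)) ^ 2 * t) / exp (pi * \<i> * t / 4)) \<le> exp (- (pi * (of_int n + 1/2)\<^sup>2 * 1)) * exp (pi / 4)"
      if t: "Im t \<ge> 1" for t and n :: int
    proof -
      have "norm (exp (pi * \<i> * (of_int n + of_real (1/2)) ^ 2 * t) / exp (pi * \<i> * t / 4)) = exp (- (pi * of_int (n * (n + 1)) * Im t))"
        unfolding e by (simp add: norm_exp_eq_Re)
      also have "\<dots> \<le> exp (- (pi * of_int (n * (n + 1)) * 1))"
        using t nn[of n] by (subst exp_le_cancel_iff, simp only: neg_le_iff_le, intro mult_left_mono) (auto simp del: of_int_mult)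
      also have "\<dots> = exp (- (pi * (of_int n + 1/2)\<^sup>2 * 1)) * exp (pi / 4)"
        unfolding exp_add[symmetric] by (rule arg_cong[of _ _ exp]) (simp add: power2_eq_square field_simps)
      finally show ?thesis .
    qed
    then show "\<forall>\<^sub>F t in filtercomap Im at_top. \<forall>n\<in>UNIV.
       norm (exp (pi * \<i> * (of_int n + of_real (1/2)) ^ 2 * t) / exp (pi * \<i> * t / 4)) \<le> exp (- (pi * (of_int n + 1/2)\<^sup>2 * 1)) * exp (pi / 4)"
      using eventually_Im_ge[of 1] by (auto elim!: eventually_mono)
    fix n :: int
    show "((\<lambda>t. exp (pi * \<i> * (of_int n + of_real (1/2)) ^ 2 * t) / exp (pi * \<i> * t / 4)) \<longlongrightarrow> (if n \<in> {0,-1} then 1 else 0)) (filtercomap Im at_top)"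
      unfolding e
    proof (cases "n \<in> {0,-1}")
      case False
      then have "n * (n + 1) \<noteq> 0" by auto
      then have "n * (n + 1) > 0" using nn[of n] by linarith
      then have "pi * of_int (n * (n + 1)) > 0" by (simp del: of_int_mult)
      then show "((\<lambda>t. exp (\<i> * of_real (pi * of_int (n * (n + 1))) * t)) \<longlongrightarrow> (if n \<in> {0,-1} then 1 else 0)) (filtercomap Im at_top)"
        using tendsto_exp_Im_at_top[of "pi * of_int (n * (n + 1))"] False by (simp add: mult_ac)
    qed auto
  qed simp
  also have "(\<Sum>\<^sub>\<infinity>n\<in>(UNIV :: int set). if n \<in> {0,-1} then 1 else (0::complex)) = (\<Sum>\<^sub>\<infinity>n\<in>{0::int, -1}. 1)"
    by (rule infsum_cong_neutral) auto
  also have "\<dots> = 2" by simp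
  finally show ?thesis
    unfolding theta2_eq_shift theta_shift_def divide_inverse infsum_cmult_left' .
qed

lemma tendsto_theta2: "(theta2 \<longlongrightarrow> 0) (filtercomap Im at_top)"
proof -
  have "((\<lambda>t. (theta2 t / exp (pi * \<i> * t / 4)) * exp (\<i> * of_real (pi / 4) * t)) \<longlongrightarrow> 2 * 0) (filtercomap Im at_top)"
    by (intro tendsto_mult tendsto_theta2_scaled tendsto_exp_Im_at_top) simp
  then show ?thesis by (simp add: mult_ac)
qed

section \<open>Duplication formulas\<close>

lemma
  fixes x :: "'a \<Rightarrow> complex" and y :: "'b \<Rightarrow> complex"
  assumes x: "(\<lambda>a. norm (x a)) summable_on A" and y: "(\<lambda>b. norm (y b)) summable_on B"
  shows abs_summable_on_Times: "(\<lambda>p. norm (x (fst p) * y (snd p))) summable_on A \<times> B"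
    and infsum_Times: "infsum (\<lambda>p. x (fst p) * y (snd p)) (A \<times> B) = infsum x A * infsum y B"
proof -
  show *: "(\<lambda>p. norm (x (fst p) * y (snd p))) summable_on A \<times> B"
    using Infinite_Sum.abs_summable_on_Sigma_iff[of "\<lambda>p. x (fst p) * y (snd p)" A "\<lambda>_. B"]
    by (simp add: norm_mult infsum_cmult_right' x y summable_on_cmult_left summable_on_cmult_right abs_mult)
  have "infsum (\<lambda>p. x (fst p) * y (snd p)) (A \<times> B) = (\<Sum>\<^sub>\<infinity>a\<in>A. \<Sum>\<^sub>\<infinity>b\<in>B. x a * y b)"
    using infsum_Sigma_banach[of "\<lambda>p. x (fst p) * y (snd p)" A "\<lambda>_. B"] abs_summable_summable[OF *] by simp
  then show "infsum (\<lambda>p. x (fst p) * y (snd p)) (A \<times> B) = infsum x A * infsum y B"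
    by (simp add: infsum_cmult_right' infsum_cmult_left')
qed

text \<open>The map (m, n) to (m + n, m - n) doubles m^2 + n^2 and reaches exactly the pairs with
  even sum. The pairs with odd sum are reached in the same way from half-integers m + 1/2, n + 1/2,
  which produces theta2.\<close>

lemma theta3_sq:
  assumes "Im \<tau> > 0"
  shows "theta3 \<tau> ^ 2 = theta3 (2 * \<tau>) ^ 2 + theta2 (2 * \<tau>) ^ 2"
proof -
  define e where "e = (\<lambda>c t (n::int). exp (pi * \<i> * (of_int n + of_real c) ^ 2 * t))"
  have as: "(\<lambda>n. norm (e c t n)) summable_on UNIV" if "0 \<le> c" "c \<le> 1" "Im t > 0" for c t
    unfolding e_def using abs_summable_theta[OF that] .
  have th: "theta_shift c t ^ 2 = infsum (\<lambda>p. e c t (fst p) * e c t (snd p)) UNIV" if "0 \<le> c" "c \<le> 1" "Im t > 0" for c t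
    using infsum_Times[OF as[OF that] as[OF that]] by (simp add: theta_shift_def e_def power2_eq_square)
  have su: "(\<lambda>p. e 0 \<tau> (fst p) * e 0 \<tau> (snd p)) summable_on X" for X
    using abs_summable_summable[OF abs_summable_on_Times[OF as as, of 0 \<tau> 0 \<tau>]] assms summable_on_subset_banach
    by (metis UNIV_Times_UNIV order_refl subset_UNIV zero_le_one)
  define X where "X = {p::int\<times>int. even (fst p + snd p)}"
  define f0 where "f0 = (\<lambda>p::int\<times>int. (fst p + snd p, fst p - snd p))"
  define f1 where "f1 = (\<lambda>p::int\<times>int. (fst p + snd p + 1, fst p - snd p))"
  have b0: "bij_betw f0 UNIV X"
    by (rule bij_betwI[of _ _ _ "\<lambda>p. ((fst p + snd p) div 2, (fst p - snd p) div 2)"]) (auto simp: f0_def X_def elim!: evenE oddE)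
  have b1: "bij_betw f1 UNIV (-X)"
    by (rule bij_betwI[of _ _ _ "\<lambda>p. ((fst p + snd p - 1) div 2, (fst p - snd p - 1) div 2)"]) (auto simp: f1_def X_def, presburger+)
  have "theta3 \<tau> ^ 2 = infsum (\<lambda>p. e 0 \<tau> (fst p) * e 0 \<tau> (snd p)) (X \<union> -X)"
    using th[of 0 \<tau>] assms by (simp add: theta3_eq_shift)
  also have "\<dots> = infsum (\<lambda>p. e 0 \<tau> (fst p) * e 0 \<tau> (snd p)) X + infsum (\<lambda>p. e 0 \<tau> (fst p) * e 0 \<tau> (snd p)) (-X)"
    by (intro infsum_Un_disjoint su) auto
  also have "infsum (\<lambda>p. e 0 \<tau> (fst p) * e 0 \<tau> (snd p)) X = infsum (\<lambda>p. e 0 (2*\<tau>) (fst p) * e 0 (2*\<tau>) (snd p)) UNIV"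
    by (subst infsum_reindex_bij_betw[OF b0, symmetric], rule infsum_cong)
       (simp add: e_def f0_def exp_add[symmetric] power2_eq_square algebra_simps)
  also have "\<dots> = theta3 (2*\<tau>) ^ 2" using th[of 0 "2*\<tau>"] assms by (simp add: theta3_eq_shift)
  also have "infsum (\<lambda>p. e 0 \<tau> (fst p) * e 0 \<tau> (snd p)) (-X) = infsum (\<lambda>p. e (1/2) (2*\<tau>) (fst p) * e (1/2) (2*\<tau>) (snd p)) UNIV"
    by (subst infsum_reindex_bij_betw[OF b1, symmetric], rule infsum_cong)
       (simp add: e_def f1_def exp_add[symmetric] power2_eq_square algebra_simps add_divide_distrib)
  also have "\<dots> = theta2 (2*\<tau>) ^ 2" using th[of "1/2" "2*\<tau>"] assms by (simp add: theta2_eq_shift)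
  finally show ?thesis .
qed

text \<open>Even and odd n: (2 n)^2 = 4 n^2 and (2 n + 1)^2 = 4 (n + 1/2)^2.\<close>

lemma theta3_split:
  assumes "Im \<tau> > 0"
  shows "theta3 \<tau> = theta3 (4 * \<tau>) + theta2 (4 * \<tau>)"
proof -
  define e where "e = (\<lambda>n::int. exp (pi * \<i> * (of_int n) ^ 2 * \<tau>))"
  have su: "e summable_on X" for X
    using summable_on_subset_banach[OF summable_theta[of 0 \<tau>]] assms by (simp add: e_def)
  have b0: "bij_betw (\<lambda>n::int. 2 * n) UNIV {n. even n}"
    by (rule bij_betwI[of _ _ _ "\<lambda>n. n div 2"]) auto
  have b1: "bij_betw (\<lambda>n::int. 2 * n + 1) UNIV (- {n. even n})"
    by (rule bij_betwI[of _ _ _ "\<lambda>n. n div 2"]) auto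
  have "theta3 \<tau> = infsum e ({n. even n} \<union> - {n. even n})" by (simp add: theta3_def e_def)
  also have "\<dots> = infsum e {n. even n} + infsum e (- {n. even n})"
    by (intro infsum_Un_disjoint su) auto
  also have "infsum e {n. even n} = theta3 (4 * \<tau>)"
    unfolding theta3_def by (subst infsum_reindex_bij_betw[OF b0, symmetric], rule infsum_cong)
      (simp add: e_def power2_eq_square algebra_simps)
  also have "infsum e (- {n. even n}) = theta2 (4 * \<tau>)"
    unfolding theta2_def by (subst infsum_reindex_bij_betw[OF b1, symmetric], rule infsum_cong)
      (simp add: e_def power2_eq_square algebra_simps add_divide_distrib)
  finally show ?thesis .
qed

lemma theta4_split:
  assumes "Im \<tau> > 0"
  shows "theta4 \<tau> = theta3 (4 * \<tau>) - theta2 (4 * \<tau>)"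
proof -
  \<comment> \<open>Written as four unit shifts, the translation by 4 multiplies theta2 by
    \<open>exp (pi * \<i> / 4)\<close> to the fourth power, which is -1.\<close>
  have e: "4 * (\<tau> + 1) = 4 * \<tau> + 1 + 1 + 1 + 1" by simp
  have "(exp (pi * \<i> / 4)) ^ 4 = (-1 :: complex)" by (simp flip: exp_of_nat_mult)
  then have "theta2 (4 * (\<tau> + 1)) = - theta2 (4 * \<tau>)"
    unfolding e theta2_add_1 by (simp add: numeral_eq_Suc mult_ac)
  moreover have "theta3 (4 * (\<tau> + 1)) = theta3 (4 * \<tau>)"
    using theta3_add_2[of "4 * \<tau>"] theta3_add_2[of "4 * \<tau> + 2"] by (simp add: algebra_simps)
  ultimately show ?thesis using theta3_split[of "\<tau> + 1"] assms by (simp add: theta4_def del: theta3_add_1)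
qed

lemma theta4_sq:
  assumes "Im \<tau> > 0"
  shows "theta4 \<tau> ^ 2 = theta3 (2 * \<tau>) ^ 2 - theta2 (2 * \<tau>) ^ 2"
proof -
  have e: "2 * (\<tau> + 1) = 2 * \<tau> + 1 + 1" by simp
  have "theta2 (2 * (\<tau> + 1)) ^ 2 = - (theta2 (2 * \<tau>) ^ 2)"
    unfolding e theta2_add_1_sq by simp
  moreover have "theta3 (2 * (\<tau> + 1)) = theta3 (2 * \<tau>)"
    using theta3_add_2[of "2 * \<tau>"] by (simp add: algebra_simps)
  ultimately show ?thesis using theta3_sq[of "\<tau> + 1"] assms by (simp add: theta4_def del: theta3_add_1)
qed

lemma theta3_theta4:
  assumes "Im \<tau> > 0"
  shows "theta3 \<tau> * theta4 \<tau> = theta4 (2 * \<tau>) ^ 2"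
  unfolding theta3_split[OF assms] theta4_split[OF assms]
  using theta4_sq[of "2 * \<tau>"] assms by (simp add: algebra_simps power2_eq_square)

text \<open>A difference of squares at \<tau>/2: the square of theta3 theta4 there is
  theta4(\<tau>)^4 by one duplication formula, and by the other two it is a product of the sum and
  the difference of theta3(\<tau>)^2 and theta2(\<tau>)^2.\<close>

theorem jacobi_quartic:
  assumes "Im \<tau> > 0"
  shows "theta3 \<tau> ^ 4 = theta2 \<tau> ^ 4 + theta4 \<tau> ^ 4"
proof -
  have *: "Im (\<tau> / 2) > 0" using assms by simp
  have "theta4 \<tau> ^ 4 = (theta3 (\<tau>/2) * theta4 (\<tau>/2)) ^ 2"
    using theta3_theta4[OF *] by (simp flip: power_mult)
  also have "\<dots> = (theta3 \<tau> ^ 2 + theta2 \<tau> ^ 2) * (theta3 \<tau> ^ 2 - theta2 \<tau> ^ 2)"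
    using theta3_sq[OF *] theta4_sq[OF *] by (simp add: power_mult_distrib)
  finally show ?thesis by (simp add: algebra_simps numeral_eq_Suc)
qed

section \<open>Landen's transformation\<close>

abbreviation hyp_fps :: "complex fps" where
  "hyp_fps \<equiv> fps_hypergeo [1/2, 1/2] [1] 1"

lemma hyp_fps_Suc: "of_nat (Suc n) ^ 2 * fps_nth hyp_fps (Suc n) = (of_nat n + 1/2) ^ 2 * fps_nth hyp_fps n"
proof -
  define s where "s = (1 + of_nat n :: complex)"
  have s: "s \<noteq> 0" unfolding s_def by (metis of_nat_Suc of_nat_neq_0)
  have "fps_nth hyp_fps (Suc n) = (of_nat n + 1/2) ^ 2 / s ^ 2 * fps_nth hyp_fps n"
    by (simp add: fps_hypergeo_rec power2_eq_square s_def add.commute del: fps_hypergeo_nth)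
  moreover have "of_nat (Suc n) = s" by (simp add: s_def)
  ultimately show ?thesis using s by (simp del: fps_hypergeo_nth)
qed

text \<open>Each coefficient arises from the previous one through the factor ((n + 1/2) / (n + 1))^2
  \<le> 1, so all are bounded by 1.\<close>

lemma fps_conv_radius_hyp: "fps_conv_radius hyp_fps \<ge> 1"
proof -
  have nn: "norm (of_nat n + 1/2 :: complex) = real n + 1/2" for n
  proof -
    have "(of_nat n + 1/2 :: complex) = of_real (real n + 1/2)" by simp
    then show ?thesis by (simp only: norm_of_real)
  qed
  have le: "norm (fps_nth hyp_fps n) \<le> 1" for n
  proof (induction n)
    case (Suc n)
    have "norm (of_nat (Suc n) ^ 2 * fps_nth hyp_fps (Suc n)) = norm ((of_nat n + 1/2) ^ 2 * fps_nth hyp_fps n)"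
      by (simp only: hyp_fps_Suc)
    then have "real (Suc n) ^ 2 * norm (fps_nth hyp_fps (Suc n)) = (real n + 1/2) ^ 2 * norm (fps_nth hyp_fps n)"
      unfolding norm_mult norm_power using nn[of n] by (simp only: norm_of_nat)
    also have "\<dots> \<le> real (Suc n) ^ 2 * 1"
      using Suc by (intro mult_mono power_mono) auto
    finally show ?case by (simp del: fps_hypergeo_nth of_nat_Suc)
  qed (simp del: fps_hypergeo_nth)
  show ?thesis
    unfolding fps_conv_radius_def
  proof (rule conv_radius_geI_ex')
    fix r :: real assume r: "0 < r" "ereal r < 1"
    show "summable (\<lambda>n. fps_nth hyp_fps n * of_real r ^ n)"
    proof (rule summable_comparison_test')
      show "summable (\<lambda>n. r ^ n)" using r by (simp add: summable_geometric)
      show "norm (fps_nth hyp_fps n * of_real r ^ n) \<le> r ^ n" if "n \<ge> 0" for n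
        using le[of n] r by (simp add: norm_mult norm_power mult_left_le_one_le del: fps_hypergeo_nth)
    qed
  qed
qed

text \<open>The hypergeometric equation for a = b = 1/2, c = 1; comparing coefficients gives back
  \<open>hyp_fps_Suc\<close>.\<close>

lemma hyp_fps_ode:
  "fps_X * (1 - fps_X) * fps_deriv (fps_deriv hyp_fps) + (1 - 2 * fps_X) * fps_deriv hyp_fps
     - fps_const (1/4) * hyp_fps = 0" (is "?L = 0")
proof (rule fps_ext)
  fix n
  show "fps_nth ?L n = fps_nth 0 n"
  proof (cases n)
    case 0
    then show ?thesis using hyp_fps_Suc[of 0]
      by (simp add: algebra_simps fps_numeral_fps_const power2_eq_square del: fps_hypergeo_nth)
  next
    case (Suc m)
    show ?thesis using hyp_fps_Suc[of n] unfolding Suc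
      by (simp add: algebra_simps fps_numeral_fps_const power2_eq_square del: fps_hypergeo_nth)
  qed
qed

text \<open>The second-order equation satisfied by \<open>F(t\<^sup>2)\<close>; it has only one power series solution up to a scalar.\<close>
definition landen_op :: "complex fps \<Rightarrow> complex fps" where
  "landen_op h = fps_X * (1 - fps_X^2) * fps_deriv (fps_deriv h) + (1 - 3 * fps_X^2) * fps_deriv h - fps_X * h"

text \<open>The origin is a regular singular point with double exponent 0: comparing coefficients
  forces d_1 = 0 and makes d_(n+2) a multiple of d_n, so the constant term determines
  everything.\<close>

lemma landen_op_unique:
  assumes "landen_op g = 0" "landen_op h = 0" "fps_nth g 0 = fps_nth h 0"
  shows "g = h"
proof -
  define d where "d = g - h"
  have d: "landen_op d = 0"
  proof -
    have "landen_op d = landen_op g - landen_op h"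
      unfolding d_def landen_op_def by (simp add: algebra_simps)
    then show ?thesis using assms by simp
  qed
  have rec0: "fps_nth d 1 = 0"
    using arg_cong[OF d, of "\<lambda>f. fps_nth f 0"]
    by (simp add: landen_op_def algebra_simps fps_numeral_fps_const power2_eq_square)
  have rec: "of_nat (n + 2) ^ 2 * fps_nth d (n + 2) = of_nat (n + 1) ^ 2 * fps_nth d n" for n
    using arg_cong[OF d, of "\<lambda>f. fps_nth f (Suc n)"]
    by (cases n; cases "n - 1")
       (simp_all add: landen_op_def algebra_simps fps_numeral_fps_const power2_eq_square eval_nat_numeral)
  have "fps_nth d n = 0 \<and> fps_nth d (Suc n) = 0" for n
  proof (induction n)
    case 0
    then show ?case using rec0 assms by (simp add: d_def)
  next
    case (Suc n)
    have "of_nat (n + 2) ^ 2 \<noteq> (0::complex)" by (metis add_2_eq_Suc' of_nat_neq_0 power_not_zero)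
    then show ?case using rec[of n] Suc by simp
  qed
  then show ?thesis by (simp add: d_def fps_eq_iff)
qed

lemma landen_op_square: "landen_op (hyp_fps oo fps_X^2) = 0"
proof -
  define b0 b1 b2 where "b0 = hyp_fps oo fps_X^2" and "b1 = fps_deriv hyp_fps oo fps_X^2"
    and "b2 = fps_deriv (fps_deriv hyp_fps) oo fps_X^2"
  have z: "fps_nth (fps_X^2 :: complex fps) 0 = 0" by simp
  have d0: "fps_deriv b0 = b1 * (2 * fps_X)" and d1: "fps_deriv b1 = b2 * (2 * fps_X)"
    unfolding b0_def b1_def b2_def fps_compose_deriv[OF z] by (simp_all add: fps_deriv_power fps_numeral_fps_const)
  have "0 = (fps_X * (1 - fps_X) * fps_deriv (fps_deriv hyp_fps) + (1 - 2 * fps_X) * fps_deriv hyp_fps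
     - fps_const (1/4) * hyp_fps) oo fps_X^2"
    unfolding hyp_fps_ode by simp
  also have "\<dots> = fps_X^2 * (1 - fps_X^2) * b2 + (1 - 2 * fps_X^2) * b1 - fps_const (1/4) * b0"
    by (simp add: fps_compose_add_distrib fps_compose_sub_distrib fps_compose_mult_distrib[OF z] b0_def b1_def b2_def
        fps_numeral_fps_const del: fps_const_mult)
  finally have "fps_X^2 * (1 - fps_X^2) * b2 + (1 - 2 * fps_X^2) * b1 = fps_const (1/4) * b0" by simp
  then have "4 * (fps_X^2 * (1 - fps_X^2) * b2 + (1 - 2 * fps_X^2) * b1) = 4 * fps_const (1/4) * b0"
    by (simp only: mult.assoc)
  also have "4 * fps_const (1/4) = (1 :: complex fps)" by (simp add: fps_numeral_fps_const)
  finally have ode: "4 * (fps_X^2 * (1 - fps_X^2) * b2 + (1 - 2 * fps_X^2) * b1) = b0" by simp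
  have "landen_op b0 = fps_X * (1 - fps_X^2) * (b2 * (2 * fps_X) * (2 * fps_X) + b1 * 2) + (1 - 3 * fps_X^2) * (b1 * (2 * fps_X)) - fps_X * b0"
    unfolding landen_op_def by (simp add: d0 d1 fps_numeral_fps_const)
  also have "\<dots> = 0" unfolding ode[symmetric] by (simp add: algebra_simps power2_eq_square)
  finally show ?thesis by (simp add: b0_def)
qed

text \<open>The polynomial identity behind \<open>landen_op_quadratic\<close>: w is 1/(1 + x), and
  a0, a1, a2 stand for F and its first two derivatives at 4 x w^2. In an abstract integral domain
  the normalisation is not disturbed by rules for power series.\<close>

lemma landen_algebra:
  fixes x w a0 a1 a2 :: "'a::idom"
  assumes "(1 + x) * w = 1"
    and "4 * (4*x*w^2 * (1 - 4*x*w^2) * a2 + (1 - 2*(4*x*w^2)) * a1) = a0"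
  shows "x * (1 - x^2) * (a2 * (4*(1-x)*w^3)^2 * w + a1 * (8*w^4*(x-2)*w - 2*(4*(1-x)*w^3)*w^2) + 2*a0*w^3)
     + (1 - 3*x^2) * (a1 * (4*(1-x)*w^3)*w - a0*w^2) - x * (a0 * w) = 0"
proof -
  define v where "v = 1 + x"
  have x: "x = v - 1" by (simp add: v_def)
  have vw: "v * w = 1" using assms by (simp add: v_def)
  \<comment> \<open>With x replaced by v - 1, every monomial that contains both v and w shrinks by
    this rule, so that normal forms can be compared.\<close>
  have 1: "v * (w * z) = z" for z using vw by (simp flip: mult.assoc)
  show ?thesis unfolding assms(2)[symmetric] unfolding x
    by (simp add: power2_eq_square power3_eq_cube power4_eq_xxxx algebra_simps 1 vw)
qed

text \<open>The substitution u = 4 x / (1 + x)^2, corrected by the factor 1/(1 + x), pulls the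
  hypergeometric equation back to the same operator as the substitution x^2. The derivatives are
  brought into the shape of \<open>landen_algebra\<close>.\<close>

lemma landen_op_quadratic:
  "landen_op ((hyp_fps oo (4 * fps_X * inverse (1 + fps_X)^2)) * inverse (1 + fps_X)) = 0"
proof -
  define x w u where "x = (fps_X :: complex fps)" and "w = inverse (1 + x)" and "u = 4 * x * w ^ 2"
  define a0 a1 a2 where "a0 = hyp_fps oo u" and "a1 = fps_deriv hyp_fps oo u"
    and "a2 = fps_deriv (fps_deriv hyp_fps) oo u"
  have z: "fps_nth u 0 = 0" by (simp add: u_def x_def)
  have xw: "(1 + x) * w = 1" unfolding w_def x_def by (rule inverse_mult_eq_1') simp
  have dw: "fps_deriv w = - (w ^ 2)"
    unfolding w_def x_def by (subst fps_inverse_deriv) simp_all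
  have dx: "fps_deriv x = 1" by (simp add: x_def)
  have du: "fps_deriv u = 4 * (1 - x) * w ^ 3"
  proof -
    have "fps_deriv u = 4 * w ^ 2 - 8 * x * w ^ 3"
      unfolding u_def by (simp add: dw dx power2_eq_square power3_eq_cube fps_numeral_fps_const algebra_simps)
    also have "\<dots> = 4 * (1 - x) * w ^ 3" using xw by algebra
    finally show ?thesis .
  qed
  have d0: "fps_deriv a0 = a1 * fps_deriv u" and d1: "fps_deriv a1 = a2 * fps_deriv u"
    unfolding a0_def a1_def a2_def fps_compose_deriv[OF z] by simp_all
  have "0 = (fps_X * (1 - fps_X) * fps_deriv (fps_deriv hyp_fps) + (1 - 2 * fps_X) * fps_deriv hyp_fps
     - fps_const (1/4) * hyp_fps) oo u"
    unfolding hyp_fps_ode by simp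
  also have "\<dots> = u * (1 - u) * a2 + (1 - 2 * u) * a1 - fps_const (1/4) * a0"
    by (simp add: fps_compose_add_distrib fps_compose_sub_distrib fps_compose_mult_distrib[OF z] a0_def a1_def a2_def z
        fps_numeral_fps_const del: fps_const_mult)
  finally have "u * (1 - u) * a2 + (1 - 2 * u) * a1 = fps_const (1/4) * a0" by simp
  then have "4 * (u * (1 - u) * a2 + (1 - 2 * u) * a1) = 4 * fps_const (1/4) * a0"
    by (simp only: mult.assoc)
  also have "4 * fps_const (1/4) = (1 :: complex fps)" by (simp add: fps_numeral_fps_const)
  finally have ode: "4 * (4*x*w^2 * (1 - 4*x*w^2) * a2 + (1 - 2*(4*x*w^2)) * a1) = a0" by (simp add: u_def)
  have ddu: "fps_deriv (fps_deriv u) = 8 * w ^ 4 * (x - 2)"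
  proof -
    have "fps_deriv (w ^ 3) = - 3 * w ^ 4"
      by (simp add: dw power2_eq_square power3_eq_cube power4_eq_xxxx algebra_simps)
    moreover have "fps_deriv (4 * (1 - x)) = - 4"
      by (simp add: dx fps_numeral_fps_const)
    ultimately have "fps_deriv (fps_deriv u) = - 4 * w ^ 3 - 12 * (1 - x) * w ^ 4"
      unfolding du by (simp add: algebra_simps)
    also have "\<dots> = 8 * w ^ 4 * (x - 2)" using xw by algebra
    finally show ?thesis .
  qed
  have g1: "fps_deriv (a0 * w) = a1 * (4*(1-x)*w^3)*w - a0*w^2"
    by (simp add: d0 dw du)
  have "fps_deriv (fps_deriv (a0 * w)) = fps_deriv (a1 * fps_deriv u * w - a0 * w * w)"
    by (simp add: d0 dw power2_eq_square mult.assoc)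
  also have "\<dots> = a2 * fps_deriv u ^ 2 * w + a1 * (fps_deriv (fps_deriv u) * w - 2 * fps_deriv u * w ^ 2) + 2 * a0 * w ^ 3"
    by (simp add: d0 d1 dw power2_eq_square power3_eq_cube algebra_simps)
  also have "\<dots> = a2 * (4*(1-x)*w^3)^2 * w + a1 * (8*w^4*(x-2)*w - 2*(4*(1-x)*w^3)*w^2) + 2*a0*w^3"
    unfolding ddu unfolding du ..
  finally have g2: "fps_deriv (fps_deriv (a0 * w)) = \<dots>" .
  have "landen_op (a0 * w) = 0"
    unfolding landen_op_def g2 unfolding g1 x_def[symmetric] by (rule landen_algebra[OF xw ode])
  then show ?thesis by (simp add: a0_def u_def w_def x_def)
qed

lemma landen_fps:
  "(hyp_fps oo (4 * fps_X * inverse (1 + fps_X)^2)) * inverse (1 + fps_X) = hyp_fps oo fps_X^2"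
  by (rule landen_op_unique[OF landen_op_quadratic landen_op_square]) simp

section \<open>Landen's transformation on the unit disc\<close>

lemma hyp_2F1_half: "hyp_2F1 (1/2) (1/2) 1 = eval_fps hyp_fps"
  by (simp add: hyp_2F1_def fun_eq_iff)

lemma holomorphic_hyp_2F1_half: "hyp_2F1 (1/2) (1/2) 1 holomorphic_on ball 0 1"
proof -
  have "ball 0 1 \<subseteq> eball (0::complex) (fps_conv_radius hyp_fps)"
    using ball_eball_mono[of 1 "fps_conv_radius hyp_fps" "0::complex"] fps_conv_radius_hyp by (simp add: one_ereal_def)
  then show ?thesis unfolding hyp_2F1_half by (rule holomorphic_on_eval_fps)
qed

lemma hyp_2F1_half_0: "hyp_2F1 (1/2) (1/2) 1 0 = 1"
  by (simp add: hyp_2F1_half eval_fps_at_0)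

text \<open>Equal power series give equal functions only near 0; the rest of the disc is reached by
  analytic continuation in \<open>landen_transformation\<close>.\<close>

lemma landen_near_0:
  "\<forall>\<^sub>F t in nhds 0. hyp_2F1 (1/2) (1/2) 1 (4 * t / (1 + t)^2) = (1 + t) * hyp_2F1 (1/2) (1/2) 1 (t^2)"
proof -
  have F: "hyp_2F1 (1/2) (1/2) 1 has_fps_expansion hyp_fps"
    unfolding hyp_2F1_half
    by (rule eval_fps_has_fps_expansion) (use fps_conv_radius_hyp in \<open>auto intro: less_le_trans[of 0 "1::ereal"]\<close>)
  have L: "(\<lambda>t. (hyp_2F1 (1/2) (1/2) 1 \<circ> (\<lambda>t. 4 * t * inverse (1 + t)^2)) t * inverse (1 + t)) has_fps_expansion
      ((hyp_fps oo (4 * fps_X * inverse (1 + fps_X)^2)) * inverse (1 + fps_X))"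
    by (intro fps_expansion_intros has_fps_expansion_compose F) (auto intro!: fps_expansion_intros)
  have R: "(hyp_2F1 (1/2) (1/2) 1 \<circ> (\<lambda>t. t^2)) has_fps_expansion (hyp_fps oo fps_X^2)"
    by (intro fps_expansion_intros has_fps_expansion_compose F) auto
  have "\<forall>\<^sub>F t in nhds 0. (hyp_2F1 (1/2) (1/2) 1 \<circ> (\<lambda>t. 4 * t * inverse (1 + t)^2)) t * inverse (1 + t) =
     (hyp_2F1 (1/2) (1/2) 1 \<circ> (\<lambda>t. t^2)) t"
    using L R unfolding landen_fps has_fps_expansion_def by (auto elim: eventually_elim2)
  moreover have "\<forall>\<^sub>F t in nhds 0. 1 + t \<noteq> (0::complex)"
    using eventually_nhds_in_open[of "- {-1::complex}" 0] by (auto elim!: eventually_mono simp: add_eq_0_iff)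
  ultimately show ?thesis
  proof eventually_elim
    case (elim t)
    then show ?case by (simp add: field_simps)
  qed
qed

theorem landen_transformation:
  assumes "norm z < 1"
  defines "x \<equiv> csqrt (1 - z)"
  shows "hyp_2F1 (1/2) (1/2) 1 z = 2 / (1 + x) * hyp_2F1 (1/2) (1/2) 1 (((1 - x) / (1 + x))^2)"
proof -
  let ?F = "hyp_2F1 (1/2) (1/2) 1"
  define X where "X = (\<lambda>z. csqrt (1 - z))"
  define t where "t = (\<lambda>z. (1 - X z) / (1 + X z))"
  have re: "Re (1 - w) > 0" if "w \<in> ball 0 1" for w :: complex
    using that complex_Re_le_cmod[of w] by (simp add: dist_norm)
  have nn: "1 - w \<notin> \<real>\<^sub>\<le>\<^sub>0" if "w \<in> ball 0 1" for w :: complex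
    using re[OF that] by (auto simp: complex_nonpos_Reals_iff)
  \<comment> \<open>The square 1 - w has positive real part, so its root is not purely imaginary,
    and the principal root lies strictly in the right half-plane.\<close>
  have ReX: "Re (X w) > 0" if "w \<in> ball 0 1" for w
  proof -
    have "Re (X w ^ 2) > 0" using re[OF that] by (simp add: X_def)
    then have "Re (X w) \<noteq> 0" by (auto simp: power2_eq_square)
    moreover have "Re (X w) \<ge> 0" unfolding X_def by (rule Re_csqrt)
    ultimately show ?thesis by linarith
  qed
  have nz: "1 + X w \<noteq> 0" if "w \<in> ball 0 1" for w
    using ReX[OF that] by (metis add_eq_0_iff one_complex.sel(1) uminus_complex.sel(1) less_asym neg_less_0_iff_less zero_less_one)
  have holX: "X holomorphic_on ball 0 1"
    unfolding X_def by (intro holomorphic_intros) (use nn in auto)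
  have holt: "t holomorphic_on ball 0 1"
    unfolding t_def by (intro holomorphic_intros holX) (use nz in auto)
  \<comment> \<open>The Cayley transform maps the right half-plane into the unit disc, where F is
    holomorphic.\<close>
  have tb: "t w ^ 2 \<in> ball 0 1" if "w \<in> ball 0 1" for w
  proof -
    have "norm (1 - X w) ^ 2 < norm (1 + X w) ^ 2"
      using ReX[OF that] unfolding cmod_power2 by (simp add: power2_eq_square algebra_simps)
    then have "norm (1 - X w) < norm (1 + X w)" by (rule power_less_imp_less_base) simp
    then have "norm (t w) < 1" using nz[OF that] by (simp add: t_def norm_divide)
    then show ?thesis by (simp add: norm_power power_less_one_iff)
  qed
  define G where "G = (\<lambda>w. 2 / (1 + X w) * ?F (t w ^ 2))"
  have holG: "G holomorphic_on ball 0 1"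
  proof -
    have "(?F \<circ> (\<lambda>w. t w ^ 2)) holomorphic_on ball 0 1"
      by (rule holomorphic_on_compose_gen[OF _ holomorphic_hyp_2F1_half]) (use tb holt in \<open>auto intro!: holomorphic_intros\<close>)
    then have "(\<lambda>w. ?F (t w ^ 2)) holomorphic_on ball 0 1" by (simp add: o_def)
    then show ?thesis unfolding G_def by (intro holomorphic_intros holX) (use nz in auto)
  qed
  have "isCont t 0" using holomorphic_on_imp_continuous_on[OF holt] by (simp add: continuous_on_eq_continuous_at)
  moreover have "t 0 = 0" by (simp add: t_def X_def)
  ultimately have "filterlim t (nhds 0) (nhds 0)" by (metis continuous_at tendsto_at_iff_tendsto_nhds)
  from filterlim_iff[THEN iffD1, rule_format, OF this landen_near_0]
  have "\<forall>\<^sub>F w in nhds 0. ?F (4 * t w / (1 + t w)^2) = (1 + t w) * ?F (t w ^ 2)" .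
  then obtain U where U: "open U" "0 \<in> U" "\<And>w. w \<in> U \<Longrightarrow> ?F (4 * t w / (1 + t w)^2) = (1 + t w) * ?F (t w ^ 2)"
    unfolding eventually_nhds by blast
  have eq: "?F w = G w" if w: "w \<in> U \<inter> ball 0 1" for w
  proof -
    have n: "1 + X w \<noteq> 0" using nz w by auto
    \<comment> \<open>\<open>t\<close> inverts w = 4 t / (1 + t)^2: because 1 + t = 2 / (1 + X), the
      right side becomes (1 - X) (1 + X) = 1 - X^2 = w.\<close>
    have 1: "1 + t w = 2 / (1 + X w)" using n by (simp add: t_def field_simps)
    have gen: "4 * (a / s) / (2 / s)^2 = a * s" if "s \<noteq> 0" for a s :: complex
      using that by (simp add: power2_eq_square field_simps)
    have "4 * t w / (1 + t w)^2 = (1 - X w) * (1 + X w)"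
      unfolding 1 using n gen[of "1 + X w" "1 - X w"] by (simp add: t_def)
    also have "\<dots> = 1 - X w ^ 2" by (simp add: algebra_simps power2_eq_square)
    also have "\<dots> = w" by (simp add: X_def)
    finally show ?thesis using U(3)[of w] w 1 by (simp add: G_def)
  qed
  have "?F z = G z"
  proof (rule analytic_continuation_open[of "U \<inter> ball 0 1" "ball 0 1" ?F G])
    show "U \<inter> ball 0 1 \<noteq> {}" using U by auto
  qed (use U eq holG holomorphic_hyp_2F1_half assms in auto)
  then show ?thesis by (simp add: G_def t_def X_def x_def)
qed

section \<open>Inversion of the theta constants\<close>

lemma
  fixes f :: "'a \<Rightarrow> real \<Rightarrow> real"
  assumes cont: "\<And>i. continuous_on {a..b} (f i)"
    and bound: "\<And>i x. i \<in> A \<Longrightarrow> x \<in> {a..b} \<Longrightarrow> \<bar>f i x\<bar> \<le> M i" and M: "M summable_on A"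
  shows has_sum_integral: "((\<lambda>i. integral {a..b} (f i)) has_sum integral {a..b} (\<lambda>x. \<Sum>\<^sub>\<infinity>i\<in>A. f i x)) A"
    and continuous_on_infsum: "continuous_on {a..b} (\<lambda>x. \<Sum>\<^sub>\<infinity>i\<in>A. f i x)"
proof -
  have ul: "uniform_limit {a..b} (\<lambda>X x. \<Sum>i\<in>X. f i x) (\<lambda>x. \<Sum>\<^sub>\<infinity>i\<in>A. f i x) (finite_subsets_at_top A)"
    by (rule Weierstrass_m_test_general[OF _ M]) (use bound in auto)
  have c: "continuous_on {a..b} (\<lambda>x. \<Sum>i\<in>X. f i x)" for X
    by (intro continuous_on_sum cont)
  show "continuous_on {a..b} (\<lambda>x. \<Sum>\<^sub>\<infinity>i\<in>A. f i x)"
    by (rule uniform_limit_theorem[OF _ ul]) (use c in auto)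
  obtain I J where I: "\<And>X. ((\<lambda>x. \<Sum>i\<in>X. f i x) has_integral I X) {a..b}"
    and J: "((\<lambda>x. \<Sum>\<^sub>\<infinity>i\<in>A. f i x) has_integral J) {a..b}" and lim: "(I \<longlongrightarrow> J) (finite_subsets_at_top A)"
    using uniform_limit_integral[OF ul c] by auto
  have "I X = (\<Sum>i\<in>X. integral {a..b} (f i))" if "finite X" for X
  proof -
    have "((\<lambda>x. \<Sum>i\<in>X. f i x) has_integral (\<Sum>i\<in>X. integral {a..b} (f i))) {a..b}"
      by (intro has_integral_sum that integrable_integral integrable_continuous_real cont)
    then show ?thesis using I has_integral_unique by blast
  qed
  then have "(sum (\<lambda>i. integral {a..b} (f i)) \<longlongrightarrow> J) (finite_subsets_at_top A)"
    using lim by (rule_tac Lim_transform_eventually[OF lim]) (auto intro: eventually_finite_subsets_at_top_weakI)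
  then show "((\<lambda>i. integral {a..b} (f i)) has_sum integral {a..b} (\<lambda>x. \<Sum>\<^sub>\<infinity>i\<in>A. f i x)) A"
    using integral_unique[OF J] by (simp add: has_sum_def)
qed

lemma integral_cos_period:
  "integral {0..1} (\<lambda>x. cos (2 * pi * of_int j * x)) = (if j = 0 then 1 else 0)"
proof (cases "j = 0")
  case False
  have "((\<lambda>x. cos (2 * pi * of_int j * x)) has_integral
      sin (2 * pi * of_int j * 1) / (2 * pi * of_int j) - sin (2 * pi * of_int j * 0) / (2 * pi * of_int j)) {0..1}"
    by (rule fundamental_theorem_of_calculus)
      (use False in \<open>auto intro!: derivative_eq_intros simp flip: has_real_derivative_iff_has_vector_derivative\<close>)
  moreover have "sin (2 * pi * of_int j) = 0"
    using sin_int_2pin[of j] by (simp add: mult_ac)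
  ultimately show ?thesis using False by (simp add: integral_unique)
qed simp

text \<open>Fourier uniqueness for functions even about \<open>1/2\<close>: such a function is a continuous function
  of \<open>cos (2 \<pi> x)\<close>, which polynomials approximate.\<close>
lemma cosine_coefficients_zero_imp_zero:
  fixes d :: "real \<Rightarrow> real"
  assumes cont: "continuous_on {0..1} d"
    and sym: "\<And>x. x \<in> {0..1} \<Longrightarrow> d (1 - x) = d x"
    and coeff: "\<And>m::int. integral {0..1} (\<lambda>x. d x * cos (2 * pi * of_int m * x)) = 0"
    and x: "x \<in> {0..1}"
  shows "d x = 0"
proof -
  define c where "c = (\<lambda>x. cos (2 * pi * x))"
  have cc: "continuous_on X c" for X unfolding c_def by (intro continuous_intros)
  \<comment> \<open>Multiplication by \<open>c\<close> shifts the frequency by 1 in both directions,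
    so by induction d is orthogonal to every power of \<open>c\<close>.\<close>
  have coeff2: "integral {0..1} (\<lambda>x. d x * c x ^ k * cos (2 * pi * of_int m * x)) = 0" for k and m :: int
  proof (induction k arbitrary: m)
    case (Suc k)
    have i: "(\<lambda>x. d x * c x ^ k * cos (2 * pi * of_int j * x)) integrable_on {0..1}" for j :: int
      by (intro integrable_continuous_real continuous_intros cont cc)
    have prod: "c x * cos (2 * pi * of_int m * x) = (cos (2 * pi * of_int (m + 1) * x) + cos (2 * pi * of_int (m - 1) * x)) / 2" for x
      unfolding c_def by (subst mult.commute, subst cos_times_cos) (simp add: algebra_simps)
    have "d x * c x ^ Suc k * cos (2 * pi * of_int m * x) =
       (d x * c x ^ k * cos (2 * pi * of_int (m + 1) * x)) * (1/2) + (d x * c x ^ k * cos (2 * pi * of_int (m - 1) * x)) * (1/2)" for x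
    proof -
      have "d x * c x ^ Suc k * cos (2 * pi * of_int m * x) = d x * c x ^ k * (c x * cos (2 * pi * of_int m * x))" by (simp only: power_Suc mult_ac)
      also have "\<dots> = d x * c x ^ k * ((cos (2 * pi * of_int (m + 1) * x) + cos (2 * pi * of_int (m - 1) * x)) / 2)"
        by (simp only: prod)
      also have "\<dots> = (d x * c x ^ k * cos (2 * pi * of_int (m + 1) * x)) * (1/2) + (d x * c x ^ k * cos (2 * pi * of_int (m - 1) * x)) * (1/2)"
        by (simp only: add_divide_distrib distrib_left times_divide_eq_right mult_1_right)
      finally show ?thesis .
    qed
    then have "integral {0..1} (\<lambda>x. d x * c x ^ Suc k * cos (2 * pi * of_int m * x)) =
       integral {0..1} (\<lambda>x. (d x * c x ^ k * cos (2 * pi * of_int (m + 1) * x)) * (1/2)) +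
       integral {0..1} (\<lambda>x. (d x * c x ^ k * cos (2 * pi * of_int (m - 1) * x)) * (1/2))"
      by (simp only:) (intro Henstock_Kurzweil_Integration.integral_add integrable_on_mult_left i)
    then show ?case using Suc.IH[of "m + 1"] Suc.IH[of "m - 1"] by simp
  qed (use coeff in simp)
  have coeff3: "integral {0..1} (\<lambda>x. d x * c x ^ k) = 0" for k
    using coeff2[of k 0] by simp
  \<comment> \<open>\<open>arccos\<close> recovers x on the first half of the interval only; the
    symmetry about 1/2 carries d = D(c(x)) over to the second half.\<close>
  define D where "D = (\<lambda>u. d (arccos u / (2 * pi)))"
  have Dc: "D (c x) = d x" if "x \<in> {0..1}" for x
  proof (cases "x \<le> 1/2")
    case True
    then have "arccos (c x) = 2 * pi * x" unfolding c_def using that by (intro arccos_cos) auto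
    then show ?thesis by (simp add: D_def)
  next
    case False
    have "c x = c (1 - x)" using cos_2pi_minus[of "2 * pi * x"] by (simp add: c_def algebra_simps)
    moreover have "arccos (c (1 - x)) = 2 * pi * (1 - x)"
      unfolding c_def using that False by (intro arccos_cos) (auto simp: field_simps)
    ultimately show ?thesis using sym[OF that] by (simp add: D_def)
  qed
  have contD: "continuous_on {-1..1} D"
    unfolding D_def
  proof (rule continuous_on_compose2[OF cont])
    show "continuous_on {-1..1} (\<lambda>u. arccos u / (2 * pi))" by (intro continuous_intros) auto
    show "(\<lambda>u. arccos u / (2 * pi)) ` {-1..1} \<subseteq> {0..1}"
    proof clarify
      fix u :: real assume "u \<in> {-1..1}"
      then have "0 \<le> arccos u" "arccos u \<le> pi" by (auto intro: arccos_lbound arccos_ubound)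
      then show "arccos u / (2 * pi) \<in> {0..1}" using pi_gt_zero by (auto simp: field_simps intro: order_trans[of _ pi])
    qed
  qed
  define K where "K = integral {0..1} (\<lambda>x. \<bar>d x\<bar>)"
  have K: "K \<ge> 0" unfolding K_def by (intro integral_nonneg integrable_continuous_real continuous_intros cont) auto
  \<comment> \<open>If g is within e of D, orthogonality to g(c(x)) replaces the integral of d^2 by
    that of d (d - g(c(x))), which is at most e times the integral of |d|.\<close>
  have small: "\<bar>integral {0..1} (\<lambda>x. d x * d x)\<bar> \<le> e * K" if e: "e > 0" for e
  proof -
    obtain g where g: "real_polynomial_function g" "\<And>u. u \<in> {-1..1} \<Longrightarrow> \<bar>D u - g u\<bar> < e"
      using Stone_Weierstrass_real_polynomial_function[OF _ contD e] by auto
    obtain a n where ga: "g = (\<lambda>x. \<Sum>i\<le>n. a i * x ^ i)"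
      using g(1) by (auto simp: real_polynomial_function_iff_sum)
    have c11: "c x \<in> {-1..1}" for x by (simp add: c_def)
    have cg: "continuous_on {0..1} (\<lambda>x. g (c x))" unfolding ga by (intro continuous_intros cc)
    have "integral {0..1} (\<lambda>x. d x * g (c x)) = integral {0..1} (\<lambda>x. \<Sum>i\<le>n. (d x * c x ^ i) * a i)"
      unfolding ga by (simp add: sum_distrib_left mult_ac)
    also have "\<dots> = (\<Sum>i\<le>n. integral {0..1} (\<lambda>x. (d x * c x ^ i) * a i))"
      by (intro integral_sum integrable_continuous_real continuous_intros cont cc) auto
    also have "\<dots> = 0" by (simp only: integral_mult_left coeff3) simp
    finally have z: "integral {0..1} (\<lambda>x. d x * g (c x)) = 0" .
    have "integral {0..1} (\<lambda>x. d x * d x) = integral {0..1} (\<lambda>x. d x * d x) - integral {0..1} (\<lambda>x. d x * g (c x))"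
      by (simp add: z)
    also have "\<dots> = integral {0..1} (\<lambda>x. d x * d x - d x * g (c x))"
      by (intro Henstock_Kurzweil_Integration.integral_diff[symmetric] integrable_continuous_real continuous_intros cont cg)
    finally have eq: "integral {0..1} (\<lambda>x. d x * d x) = integral {0..1} (\<lambda>x. d x * d x - d x * g (c x))" .
    have "\<bar>d x * d x - d x * g (c x)\<bar> \<le> e * \<bar>d x\<bar>" if "x \<in> {0..1}" for x
    proof -
      have "\<bar>d x * d x - d x * g (c x)\<bar> = \<bar>d x\<bar> * \<bar>D (c x) - g (c x)\<bar>"
        using Dc[OF that] by (simp add: abs_mult[symmetric] algebra_simps)
      also have "\<dots> \<le> \<bar>d x\<bar> * e" using g(2)[OF c11] by (intro mult_left_mono) (auto intro: less_imp_le)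
      finally show ?thesis by (simp add: mult_ac)
    qed
    then have "norm (integral {0..1} (\<lambda>x. d x * d x - d x * g (c x))) \<le> integral {0..1} (\<lambda>x. e * \<bar>d x\<bar>)"
      by (intro integral_norm_bound_integral integrable_continuous_real continuous_intros cont cg) auto
    then show ?thesis by (simp add: eq K_def)
  qed
  have "integral {0..1} (\<lambda>x. d x * d x) = 0"
  proof (rule ccontr)
    assume "integral {0..1} (\<lambda>x. d x * d x) \<noteq> 0"
    then have p: "\<bar>integral {0..1} (\<lambda>x. d x * d x)\<bar> > 0" by simp
    \<comment> \<open>This makes 2 (K + 1) e equal to the integral, which is more than the bound e
      K; taking K + 1 keeps the denominator positive.\<close>
    define e where "e = \<bar>integral {0..1} (\<lambda>x. d x * d x)\<bar> / (2 * (K + 1))"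
    have "e > 0" using p K by (simp add: e_def)
    have "2 * (K + 1) * e = \<bar>integral {0..1} (\<lambda>x. d x * d x)\<bar>" using K by (simp add: e_def)
    with small[OF \<open>e > 0\<close>] have "2 * (K + 1) * e \<le> e * K" by simp
    moreover have "e * K < 2 * (K + 1) * e" using \<open>e > 0\<close> mult_nonneg_nonneg[OF K less_imp_le[OF \<open>e > 0\<close>]] by (simp add: algebra_simps)
    ultimately show False by linarith
  qed
  then have "\<forall>x\<in>{0..1}. d x * d x = 0"
    by (subst (asm) integral_eq_0_iff) (auto intro!: continuous_intros cont)
  then show ?thesis using x by simp
qed

text \<open>Up to scaling by sqrt(2 pi y), the integral is the real part of the characteristic
  function of the standard normal distribution.\<close>

lemma
  assumes y: "y > 0"
  shows integrable_gaussian_cos: "integrable lborel (\<lambda>x. exp (- (pi * x\<^sup>2 * y)) * cos (b * x))"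
    and integral_gaussian_cos: "(\<integral>x. exp (- (pi * x\<^sup>2 * y)) * cos (2 * pi * m * x) \<partial>lborel) = exp (- (pi * m\<^sup>2 / y)) / sqrt y"
proof -
  define c where "c = sqrt (2 * pi * y)"
  have c: "c > 0" "c ^ 2 = 2 * pi * y" using y by (auto simp: c_def)
  have sq: "(c * x)\<^sup>2 / 2 = pi * x\<^sup>2 * y" for x by (simp add: power_mult_distrib c)
  have g: "std_normal_density (0 + c * x) = exp (- (pi * x\<^sup>2 * y)) / sqrt (2 * pi)" for x
    using sq[of x] by (simp add: std_normal_density_def)
  have "integrable lborel (\<lambda>x. std_normal_density (0 + c * x))"
    using c by (intro lborel_integrable_real_affine) auto
  then have "integrable lborel (\<lambda>x. exp (- (pi * x\<^sup>2 * y)) / sqrt (2 * pi))" unfolding g .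
  from integrable_mult_right[OF this, of "sqrt (2 * pi)"]
  have "integrable lborel (\<lambda>x. exp (- (pi * x\<^sup>2 * y)))" by simp
  then show int: "integrable lborel (\<lambda>x. exp (- (pi * x\<^sup>2 * y)) * cos (b * x))" for b
    by (rule Bochner_Integration.integrable_bound) (auto simp: abs_mult mult_left_le)
  define t where "t = 2 * pi * m / c"
  have "(\<integral>x. std_normal_density x * cos (t * x) \<partial>lborel) = exp (- t\<^sup>2 / 2)"
  proof -
    interpret real_distribution std_normal_distribution by (rule real_dist_normal_dist)
    have "char std_normal_distribution t = complex_of_real (exp (- (t^2) / 2))"
      by (simp add: char_std_normal_distribution)
    then have "Re (CLINT x|std_normal_distribution. iexp (t * x)) = exp (- (t^2) / 2)"
      unfolding char_def by simp
    moreover have "integrable std_normal_distribution (\<lambda>x. iexp (t * x))"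
      using integrable_iexp[of "\<lambda>x. of_real (t * x)"] by simp
    ultimately have "(\<integral>x. Re (iexp (t * x)) \<partial>std_normal_distribution) = exp (- (t^2) / 2)"
      by (simp only: integral_Re)
    moreover have "Re (iexp (t * x)) = cos (t * x)" for x
      by (simp add: Re_exp)
    ultimately have "(\<integral>x. cos (t * x) \<partial>std_normal_distribution) = exp (- (t^2) / 2)" by simp
    then show ?thesis by (subst (asm) integral_density) auto
  qed
  moreover have "(\<integral>x. std_normal_density x * cos (t * x) \<partial>lborel) = c * (\<integral>x. std_normal_density (0 + c * x) * cos (t * (0 + c * x)) \<partial>lborel)"
    using lborel_integral_real_affine[of c "\<lambda>x. std_normal_density x * cos (t * x)" 0] c by simp
  moreover have "(\<lambda>x. cos (t * (0 + c * x))) = (\<lambda>x. cos (2 * pi * m * x))" using c by (simp add: t_def mult_ac)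
  ultimately have "c * (\<integral>x. exp (- (pi * x\<^sup>2 * y)) / sqrt (2 * pi) * cos (2 * pi * m * x) \<partial>lborel) = exp (- t\<^sup>2 / 2)"
    unfolding g by (simp add: fun_eq_iff)
  moreover have "(\<lambda>x. exp (- (pi * x\<^sup>2 * y)) / sqrt (2 * pi) * cos (2 * pi * m * x)) = (\<lambda>x. (exp (- (pi * x\<^sup>2 * y)) * cos (2 * pi * m * x)) / sqrt (2 * pi))"
    by auto
  ultimately have "c / sqrt (2 * pi) * (\<integral>x. exp (- (pi * x\<^sup>2 * y)) * cos (2 * pi * m * x) \<partial>lborel) = exp (- t\<^sup>2 / 2)"
    by simp
  moreover have "c / sqrt (2 * pi) = sqrt y" by (simp add: c_def real_sqrt_mult)
  moreover have "- t\<^sup>2 / 2 = - (pi * m\<^sup>2 / y)"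
  proof -
    have "t\<^sup>2 = (2 * pi * m)\<^sup>2 / (2 * pi * y)" by (simp only: t_def power_divide c)
    then show ?thesis using y by (simp add: power2_eq_square)
  qed
  ultimately show "(\<integral>x. exp (- (pi * x\<^sup>2 * y)) * cos (2 * pi * m * x) \<partial>lborel) = exp (- (pi * m\<^sup>2 / y)) / sqrt y"
    using y by (simp add: field_simps)
qed

text \<open>The ranges are half-open so that the unit intervals [n, n + 1] with n in the range fill
  [-N, N] exactly.\<close>

lemma has_sum_int_symmetric_limit:
  fixes f :: "int \<Rightarrow> real"
  assumes "(f has_sum S) UNIV"
  shows "(\<lambda>N. \<Sum>n\<in>{- int N..<int N}. f n) \<longlonglongrightarrow> S"
proof -
  have "filterlim (\<lambda>N. {- int N..<int N}) (finite_subsets_at_top UNIV) sequentially"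
    unfolding filterlim_finite_subsets_at_top
  proof safe
    fix X :: "int set" assume X: "finite X"
    define B where "B = nat (\<Sum>x\<in>X. \<bar>x\<bar>) + 1"
    have "\<bar>x\<bar> < int B" if "x \<in> X" for x
      unfolding B_def using member_le_sum[of x X "\<lambda>x. \<bar>x\<bar>"] X that by simp
    then have "X \<subseteq> {- int N..<int N}" if "N \<ge> B" for N
      using that by (fastforce simp: abs_less_iff)
    then show "\<forall>\<^sub>F N in sequentially. finite {- int N..<int N} \<and> X \<subseteq> {- int N..<int N} \<and> {- int N..<int N} \<subseteq> UNIV"
      using eventually_mono[OF eventually_ge_at_top[of B], of "\<lambda>N. X \<subseteq> {- int N..<int N}"] by simp
  qed
  then show ?thesis using assms unfolding has_sum_def by (rule filterlim_compose[rotated])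
qed

text \<open>Unit intervals tile the line: the finite sums are integrals over [-N, N], and dominated
  convergence with majorant |g| leads to the whole line.\<close>

lemma has_sum_integral_unfold:
  fixes g :: "real \<Rightarrow> real"
  assumes cont: "continuous_on UNIV g" and int: "integrable lborel g"
    and hs: "((\<lambda>n::int. integral {0..1} (\<lambda>x. g (of_int n + x))) has_sum S) UNIV"
  shows "S = (\<integral>x. g x \<partial>lborel)"
proof (rule LIMSEQ_unique)
  show "(\<lambda>N. \<Sum>n\<in>{- int N..<int N}. integral {0..1} (\<lambda>x. g (of_int n + x))) \<longlonglongrightarrow> S"
    by (rule has_sum_int_symmetric_limit[OF hs])
  have ig: "g integrable_on {a..b}" for a b
    using cont by (intro integrable_continuous_real) (auto intro: continuous_on_subset)
  have shift: "integral {0..1} (\<lambda>x. g (of_int n + x)) = integral {of_int n..of_int n + 1} g" for n :: int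
  proof -
    have "(g has_integral integral {of_int n..of_int n + 1} g) (cbox (of_int n) (of_int n + 1))"
      using ig by (simp add: integrable_integral)
    from has_integral_affinity[OF this, of 1 "of_int n"]
    have "((\<lambda>x. g (of_int n + x)) has_integral integral {of_int n..of_int n + 1} g) {0..1}"
      by (simp add: add.commute)
    then show ?thesis by (rule integral_unique)
  qed
  have "(\<Sum>n\<in>{- int N..<int N}. integral {0..1} (\<lambda>x. g (of_int n + x))) = integral {- real N..real N} g" for N
  proof (induction N)
    case (Suc N)
    have e: "{- int (Suc N)..<int (Suc N)} = insert (- int N - 1) (insert (int N) {- int N..<int N})" by auto
    have "integral {- real (Suc N)..real (Suc N)} g = integral {- real N - 1..- real N} g + integral {- real N..real N + 1} g"
      using Henstock_Kurzweil_Integration.integral_combine[of "- real N - 1" "- real N" "real N + 1" g] ig by (simp add: minus_diff_commute add.commute)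
    also have "integral {- real N..real N + 1} g = integral {- real N..real N} g + integral {real N..real N + 1} g"
      using Henstock_Kurzweil_Integration.integral_combine[of "- real N" "real N" "real N + 1" g] ig by simp
    finally show ?case unfolding e using Suc.IH shift[of "- int N - 1"] shift[of "int N"] by simp
  qed simp
  moreover have "(\<lambda>N. integral {- real N..real N} g) \<longlonglongrightarrow> (\<integral>x. g x \<partial>lborel)"
  proof -
    have "(\<lambda>N. \<integral>x. indicator {- real N..real N} x * g x \<partial>lborel) \<longlonglongrightarrow> (\<integral>x. g x \<partial>lborel)"
    proof (rule integral_dominated_convergence[where w = "\<lambda>x. \<bar>g x\<bar>"])
      show "AE x in lborel. (\<lambda>N. indicator {- real N..real N} x * g x) \<longlonglongrightarrow> g x"
      proof (rule AE_I2)
        fix x :: real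
        have "\<forall>\<^sub>F N in sequentially. g x = indicator {- real N..real N} x * g x"
          using eventually_ge_at_top[of "nat \<lceil>\<bar>x\<bar>\<rceil>"]
        proof eventually_elim
          case (elim N)
          then have "\<bar>x\<bar> \<le> real N" by linarith
          then show ?case by (simp add: abs_le_iff)
        qed
        then show "(\<lambda>N. indicator {- real N..real N} x * g x) \<longlonglongrightarrow> g x"
          by (rule Lim_transform_eventually[OF tendsto_const])
      qed
    qed (use int in \<open>auto simp: indicator_def\<close>)
    moreover have "(\<integral>x. indicator {- real N..real N} x * g x \<partial>lborel) = integral {- real N..real N} g" for N
    proof -
      have "set_integrable lborel {- real N..real N} g"
        using int unfolding set_integrable_def by (intro integrable_mult_indicator) auto
      from set_borel_integral_eq_integral(2)[OF this] show ?thesis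
        by (simp add: set_lebesgue_integral_def)
    qed
    ultimately show ?thesis by simp
  qed
  ultimately show "(\<lambda>N. \<Sum>n\<in>{- int N..<int N}. integral {0..1} (\<lambda>x. g (of_int n + x))) \<longlonglongrightarrow> (\<integral>x. g x \<partial>lborel)"
    by simp
qed

text \<open>Poisson summation: the periodised Gaussian \<phi> and the cosine series \<psi> divided
  by sqrt y are continuous, even about 1/2 and have the same cosine coefficients, hence agree; the
  claim is their equality at 0.\<close>

lemma theta_imaginary_inversion_real:
  assumes y: "y > 0"
  shows "(\<Sum>\<^sub>\<infinity>n\<in>(UNIV::int set). exp (- (pi * (of_int n)\<^sup>2 * y))) = (\<Sum>\<^sub>\<infinity>n\<in>(UNIV::int set). exp (- (pi * (of_int n)\<^sup>2 * (1 / y)))) / sqrt y"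
proof -
  define h where "h = (\<lambda>x::real. exp (- (pi * x\<^sup>2 * y)))"
  define e where "e = (\<lambda>n::int. exp (- (pi * (of_int n)\<^sup>2 * (1 / y))))"
  define \<phi> where "\<phi> = (\<lambda>x. \<Sum>\<^sub>\<infinity>n\<in>(UNIV::int set). h (of_int n + x))"
  define \<psi> where "\<psi> = (\<lambda>x. \<Sum>\<^sub>\<infinity>n\<in>(UNIV::int set). e n * cos (2 * pi * of_int n * x))"
  define M where "M = (\<lambda>n::int. exp (- (pi * y * (real (nat \<bar>n\<bar>) - 1))))"
  have M: "M summable_on UNIV" unfolding M_def by (rule summable_on_exp_abs_int[OF y])
  have esum: "e summable_on UNIV" unfolding e_def using summable_on_gaussian_int[of 0 "1/y"] y by simp
  have hc: "continuous_on X h" for X unfolding h_def by (intro continuous_intros)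
  have hM: "\<bar>h (of_int n + x)\<bar> \<le> M n" if "x \<in> {0..1}" for n x
    using mult_left_mono[OF square_int_add_ge[of x n], of "pi * y"] that y
    by (simp add: h_def M_def mult_ac)
  have hM': "\<bar>h (of_int n + x) * cos t\<bar> \<le> M n" if "x \<in> {0..1}" for n x t
    using hM[OF that, of n] mult_left_le[of "\<bar>cos t\<bar>" "\<bar>h (of_int n + x)\<bar>"] by (simp add: abs_mult)
  have hcn: "continuous_on {0..1} (\<lambda>x. h (of_int n + x))" for n :: int
    unfolding h_def by (intro continuous_intros)
  have eM: "\<bar>e n * cos t\<bar> \<le> e n" for n t by (simp add: abs_mult e_def mult_left_le)
  have c\<phi>: "continuous_on {0..1} \<phi>" unfolding \<phi>_def by (rule continuous_on_infsum[OF hcn hM M])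
  have c\<psi>: "continuous_on {0..1} \<psi>" unfolding \<psi>_def
    by (rule continuous_on_infsum[OF _ _ esum]) (intro continuous_intros, rule eM)
  have per: "cos (2 * pi * of_int m * (of_int n + x)) = cos (2 * pi * of_int m * x)" for m n :: int and x :: real
  proof -
    have "2 * pi * of_int m * (of_int n + x) = 2 * pi * of_int m * x + 2 * pi * of_int (m * n)" by (simp add: algebra_simps)
    then show ?thesis using sin_int_2pin[of "m * n"] cos_int_2pin[of "m * n"] by (simp only: cos_add mult_1_right mult_zero_right diff_zero)
  qed
  \<comment> \<open>By \<open>per\<close> the cosine may be taken at n + x, so the integrals over
    the unit interval unfold to one Gaussian integral over the line.\<close>
  have coeff\<phi>: "integral {0..1} (\<lambda>x. \<phi> x * cos (2 * pi * of_int m * x)) = e m / sqrt y" for m :: int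
  proof -
    define g where "g = (\<lambda>x. h x * cos (2 * pi * of_int m * x))"
    have gn: "g (of_int n + x) = h (of_int n + x) * cos (2 * pi * of_int m * x)" for n :: int and x
      by (simp add: g_def per)
    have "((\<lambda>n::int. integral {0..1} (\<lambda>x. g (of_int n + x))) has_sum
        integral {0..1} (\<lambda>x. \<Sum>\<^sub>\<infinity>n\<in>(UNIV::int set). g (of_int n + x))) UNIV"
      by (rule has_sum_integral[OF _ _ M]) (unfold gn, intro continuous_intros hcn, rule hM')
    then have "integral {0..1} (\<lambda>x. \<Sum>\<^sub>\<infinity>n\<in>(UNIV::int set). g (of_int n + x)) = (\<integral>x. g x \<partial>lborel)"
    proof (rule has_sum_integral_unfold[rotated 2])
      show "continuous_on UNIV g" unfolding g_def by (intro continuous_intros hc)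
      show "integrable lborel g" unfolding g_def h_def by (rule integrable_gaussian_cos[OF y])
    qed
    also have "(\<integral>x. g x \<partial>lborel) = e m / sqrt y"
      using integral_gaussian_cos[OF y, of "of_int m"] by (simp add: g_def h_def e_def)
    finally show ?thesis unfolding gn \<phi>_def by (simp only: infsum_cmult_left')
  qed
  have coeff\<psi>: "integral {0..1} (\<lambda>x. \<psi> x * cos (2 * pi * of_int m * x)) = e m" for m :: int
  proof -
    define T where "T = (\<lambda>(n::int) x. e n * cos (2 * pi * of_int n * x) * cos (2 * pi * of_int m * x))"
    have Te: "T n x = (e n / 2) * cos (2 * pi * of_int (n - m) * x) + (e n / 2) * cos (2 * pi * of_int (n + m) * x)" for n x
      unfolding T_def mult.assoc[of "e n"] cos_times_cos by (simp add: algebra_simps add_divide_distrib)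
    have int: "(\<lambda>x. cos (2 * pi * of_int j * x)) integrable_on {0..1}" for j :: int
      by (intro integrable_continuous_real continuous_intros)
    have Ti: "integral {0..1} (T n) = (e n / 2) * (if n = m then 1 else 0) + (e n / 2) * (if n = - m then 1 else 0)" for n
    proof -
      have "integral {0..1} (T n) = integral {0..1} (\<lambda>x. (e n / 2) * cos (2 * pi * of_int (n - m) * x)) + integral {0..1} (\<lambda>x. (e n / 2) * cos (2 * pi * of_int (n + m) * x))"
        unfolding Te by (intro Henstock_Kurzweil_Integration.integral_add integrable_on_mult_right int)
      then show ?thesis by (simp only: integral_mult_right integral_cos_period) (simp add: eq_neg_iff_add_eq_0)
    qed
    have "((\<lambda>n. integral {0..1} (T n)) has_sum integral {0..1} (\<lambda>x. \<Sum>\<^sub>\<infinity>n\<in>UNIV. T n x)) UNIV"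
    proof (rule has_sum_integral[OF _ _ esum])
      show "continuous_on {0..1} (T n)" for n unfolding T_def by (intro continuous_intros)
      show "\<bar>T n x\<bar> \<le> e n" for n x
        using eM[of n "2 * pi * of_int n * x"] mult_left_le[of "\<bar>cos (2 * pi * of_int m * x)\<bar>" "\<bar>e n * cos (2 * pi * of_int n * x)\<bar>"]
        by (simp add: T_def abs_mult)
    qed
    then have "integral {0..1} (\<lambda>x. \<Sum>\<^sub>\<infinity>n\<in>UNIV. T n x) = (\<Sum>\<^sub>\<infinity>n\<in>UNIV. (e n / 2) * (if n = m then 1 else 0) + (e n / 2) * (if n = - m then 1 else 0))"
      unfolding Ti by (simp add: infsumI)
    \<comment> \<open>For m = 0 the index set has one element, to which both halves contribute;
      otherwise the halves come from m and -m and agree because \<open>e\<close> is even.\<close>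
    also have "\<dots> = (\<Sum>\<^sub>\<infinity>n\<in>{m, - m}. (e n / 2) * (if n = m then 1 else 0) + (e n / 2) * (if n = - m then 1 else 0))"
      by (rule infsum_cong_neutral) auto
    also have "\<dots> = e m" by (cases "m = 0") (auto simp: e_def)
    finally show ?thesis unfolding T_def \<psi>_def by (simp only: infsum_cmult_left')
  qed
  \<comment> \<open>Replacing n by -n - 1 turns n + 1 - x into -(n + x), and \<open>h\<close> is
    even.\<close>
  have sym\<phi>: "\<phi> (1 - x) = \<phi> x" for x
  proof -
    have b: "bij_betw (\<lambda>n::int. - n - 1) UNIV UNIV" by (rule bij_betwI[of _ _ _ "\<lambda>n. - n - 1"]) auto
    show ?thesis unfolding \<phi>_def
      by (subst infsum_reindex_bij_betw[OF b, symmetric], rule infsum_cong)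
         (simp add: h_def power2_eq_square algebra_simps)
  qed
  have sym\<psi>: "\<psi> (1 - x) = \<psi> x" for x
  proof -
    have "cos (2 * pi * of_int n * (1 - x)) = cos (2 * pi * of_int n * x)" for n
      using per[of n 1 "- x"] by simp
    then show ?thesis by (simp add: \<psi>_def)
  qed
  have "\<phi> 0 - \<psi> 0 / sqrt y = 0"
  proof (rule cosine_coefficients_zero_imp_zero[where d = "\<lambda>x. \<phi> x - \<psi> x / sqrt y" and x = 0])
    show "continuous_on {0..1} (\<lambda>x. \<phi> x - \<psi> x / sqrt y)" using y by (intro continuous_intros c\<phi> c\<psi>) auto
    show "integral {0..1} (\<lambda>x. (\<phi> x - \<psi> x / sqrt y) * cos (2 * pi * of_int m * x)) = 0" for m :: int
    proof -
      have i1: "(\<lambda>x. \<phi> x * cos (2 * pi * of_int m * x)) integrable_on {0..1}"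
        and i2: "(\<lambda>x. \<psi> x * cos (2 * pi * of_int m * x) * (1 / sqrt y)) integrable_on {0..1}"
        by (intro integrable_continuous_real continuous_intros c\<phi> c\<psi>)+
      have "integral {0..1} (\<lambda>x. (\<phi> x - \<psi> x / sqrt y) * cos (2 * pi * of_int m * x)) =
         integral {0..1} (\<lambda>x. \<phi> x * cos (2 * pi * of_int m * x) - \<psi> x * cos (2 * pi * of_int m * x) * (1 / sqrt y))"
        by (simp add: algebra_simps)
      also have "\<dots> = e m / sqrt y - e m * (1 / sqrt y)"
        by (simp only: Henstock_Kurzweil_Integration.integral_diff[OF i1 i2] integral_mult_left coeff\<phi> coeff\<psi>)
      finally show ?thesis by simp
    qed
  qed (use sym\<phi> sym\<psi> in auto)
  then show ?thesis by (simp add: \<phi>_def \<psi>_def h_def e_def)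
qed

section \<open>Transformation under \<tau> to -1/\<tau>\<close>

lemma Im_neg_inverse: "Im (-1 / \<tau>) = Im \<tau> / (cmod \<tau>)\<^sup>2"
  by (simp add: Im_divide cmod_power2)

lemma Im_neg_inverse_pos: "Im \<tau> > 0 \<Longrightarrow> Im (-1 / \<tau>) > 0"
proof -
  assume "Im \<tau> > 0"
  then have "\<tau> \<noteq> 0" by auto
  then show ?thesis unfolding Im_neg_inverse using \<open>Im \<tau> > 0\<close> by simp
qed

lemma theta3_imaginary:
  assumes y: "y > 0"
  shows "theta3 (\<i> * of_real (1 / y)) = of_real (sqrt y) * theta3 (\<i> * of_real y)"
proof -
  have t: "theta3 (\<i> * of_real s) = of_real (\<Sum>\<^sub>\<infinity>n\<in>(UNIV::int set). exp (- (pi * (of_int n)\<^sup>2 * s)))" if s: "s > 0" for s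
  proof -
    have "(\<lambda>n::int. exp (- (pi * (of_int n)\<^sup>2 * s))) summable_on UNIV"
      using summable_on_gaussian_int[of 0 s] s by simp
    from has_sum_of_real[OF has_sum_infsum[OF this], where 'a = complex]
    have "(\<Sum>\<^sub>\<infinity>n\<in>(UNIV::int set). complex_of_real (exp (- (pi * (of_int n)\<^sup>2 * s)))) = of_real (\<Sum>\<^sub>\<infinity>n\<in>(UNIV::int set). exp (- (pi * (of_int n)\<^sup>2 * s)))"
      by (rule infsumI)
    moreover have "complex_of_real (exp (- (pi * (of_int n)\<^sup>2 * s))) = exp (pi * \<i> * (of_int n) ^ 2 * (\<i> * of_real s))" for n :: int
      by (simp add: exp_of_real[symmetric] mult_ac)
    ultimately show ?thesis by (simp only: theta3_def)
  qed
  show ?thesis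
    using theta_imaginary_inversion_real[OF y] y by (simp only: t zero_less_divide_1_iff) (simp add: field_simps)
qed

lemma holomorphic_neg_inverse:
  assumes "f holomorphic_on upper_half_plane"
  shows "(\<lambda>z. f (-1 / z)) holomorphic_on upper_half_plane"
proof -
  have "f \<circ> (\<lambda>z. -1 / z) holomorphic_on upper_half_plane"
    by (rule holomorphic_on_compose_gen[OF _ assms]) (auto intro!: holomorphic_intros simp del: divide_minus_left intro: Im_neg_inverse_pos)
  then show ?thesis by (simp add: o_def)
qed

text \<open>The identity theorem, with \<i> as an accumulation point of the axis; it transports
  real-variable identities to the half-plane.\<close>

lemma eq_on_imaginary_axis_imp_eq:
  assumes f: "f holomorphic_on upper_half_plane" and g: "g holomorphic_on upper_half_plane"
    and eq: "\<And>y. y > 0 \<Longrightarrow> f (\<i> * of_real y) = g (\<i> * of_real y)"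
    and z: "Im z > 0"
  shows "f z = g z"
proof -
  define U where "U = {z. Re z = 0 \<and> Im z > 0}"
  have "f z - g z = 0"
  proof (rule analytic_continuation[of "\<lambda>z. f z - g z" upper_half_plane U \<i>])
    show "(\<lambda>z. f z - g z) holomorphic_on upper_half_plane" by (intro holomorphic_intros f g)
    show "U \<subseteq> upper_half_plane" by (auto simp: U_def)
    show "\<i> islimpt U"
      unfolding islimpt_approachable
    proof safe
      fix e :: real assume e: "e > 0"
      show "\<exists>x'\<in>U. x' \<noteq> \<i> \<and> dist x' \<i> < e"
        by (rule bexI[of _ "\<i> * of_real (1 + e/2)"]) (use e in \<open>auto simp: U_def dist_norm algebra_simps norm_mult\<close>)
    qed
    show "f w - g w = 0" if "w \<in> U" for w
    proof -
      have "w = \<i> * of_real (Im w)" using that by (auto simp: U_def complex_eq_iff)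
      then show ?thesis using eq[of "Im w"] that by (auto simp: U_def)
    qed
  qed (use z open_upper_half_plane connected_upper_half_plane in auto)
  then show ?thesis by simp
qed

text \<open>On the imaginary axis -\<i> \<tau> is the positive number y, and the claim is the square
  of \<open>theta3_imaginary\<close>. Squaring avoids choosing a branch of the root of -\<i>
  \<tau>.\<close>

theorem theta3_inversion:
  assumes "Im \<tau> > 0"
  shows "theta3 (-1 / \<tau>) ^ 2 = - \<i> * \<tau> * theta3 \<tau> ^ 2"
proof (rule eq_on_imaginary_axis_imp_eq[where f = "\<lambda>\<tau>. theta3 (-1 / \<tau>) ^ 2" and g = "\<lambda>\<tau>. - \<i> * \<tau> * theta3 \<tau> ^ 2"])
  fix y :: real assume y: "y > 0"
  have e: "-1 / (\<i> * of_real y) = \<i> * of_real (1 / y)" using y by (simp add: field_simps)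
  have "(of_real (sqrt y) :: complex) ^ 2 = of_real y" using y by (simp flip: of_real_power)
  then show "theta3 (-1 / (\<i> * of_real y)) ^ 2 = - \<i> * (\<i> * of_real y) * theta3 (\<i> * of_real y) ^ 2"
    unfolding e theta3_imaginary[OF y] by (simp add: power_mult_distrib)
qed (use assms in \<open>auto intro!: holomorphic_intros holomorphic_neg_inverse holomorphic_theta3 simp del: divide_minus_left\<close>)

text \<open>Splitting into even and odd indices expresses both sides through theta3: theta4(s) = 2
  theta3(4 s) - theta3(s) and theta2(\<tau>) = theta3(\<tau>/4) - theta3(\<tau>). So
  \<open>theta3_imaginary\<close> at y and at y/4 is enough.\<close>

theorem theta4_inversion:
  assumes "Im \<tau> > 0"
  shows "theta4 (-1 / \<tau>) ^ 2 = - \<i> * \<tau> * theta2 \<tau> ^ 2"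
proof (rule eq_on_imaginary_axis_imp_eq[where f = "\<lambda>\<tau>. theta4 (-1 / \<tau>) ^ 2" and g = "\<lambda>\<tau>. - \<i> * \<tau> * theta2 \<tau> ^ 2"])
  fix y :: real assume y: "y > 0"
  have e: "-1 / (\<i> * of_real y) = \<i> * of_real (1 / y)" using y by (simp add: field_simps)
  have 1: "theta4 (\<i> * of_real (1 / y)) = 2 * theta3 (4 * (\<i> * of_real (1 / y))) - theta3 (\<i> * of_real (1 / y))"
    using theta3_split[of "\<i> * of_real (1 / y)"] theta4_split[of "\<i> * of_real (1 / y)"] y by simp
  have 2: "theta3 (\<i> * of_real (y / 4)) = theta3 (\<i> * of_real y) + theta2 (\<i> * of_real y)"
    using theta3_split[of "\<i> * of_real (y / 4)"] y by simp
  have 3: "theta3 (4 * (\<i> * of_real (1 / y))) = of_real (sqrt y / 2) * theta3 (\<i> * of_real (y / 4))"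
    using theta3_imaginary[of "y / 4"] y by (simp add: real_sqrt_divide mult_ac)
  have "theta4 (\<i> * of_real (1 / y)) = of_real (sqrt y) * theta2 (\<i> * of_real y)"
    unfolding 1 3 2 theta3_imaginary[OF y] by (simp add: algebra_simps)
  moreover have "(of_real (sqrt y) :: complex) ^ 2 = of_real y" using y by (simp flip: of_real_power)
  ultimately show "theta4 (-1 / (\<i> * of_real y)) ^ 2 = - \<i> * (\<i> * of_real y) * theta2 (\<i> * of_real y) ^ 2"
    unfolding e by (simp add: power_mult_distrib)
qed (use assms in \<open>auto intro!: holomorphic_intros holomorphic_neg_inverse holomorphic_theta4 holomorphic_theta2 simp del: divide_minus_left\<close>)

corollary theta2_inversion:
  assumes "Im \<tau> > 0"
  shows "theta2 (-1 / \<tau>) ^ 2 = - \<i> * \<tau> * theta4 \<tau> ^ 2"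
proof -
  have "\<tau> \<noteq> 0" using assms by auto
  moreover have "theta4 \<tau> ^ 2 = - \<i> * (-1 / \<tau>) * theta2 (-1 / \<tau>) ^ 2"
    using theta4_inversion[of "-1 / \<tau>"] Im_neg_inverse_pos[OF assms] by simp
  ultimately show ?thesis by (simp add: field_simps)
qed

section \<open>The triple product and the eta function\<close>

definition euler_phi :: "complex \<Rightarrow> complex" where
  "euler_phi p = (\<Prod>n. 1 - p ^ Suc n)"

definition qpoch :: "complex \<Rightarrow> nat \<Rightarrow> complex" where
  "qpoch p n = (\<Prod>k<n. 1 - p ^ Suc k)"

lemma convergent_prod_euler:
  assumes "norm (p::complex) < 1"
  shows "convergent_prod (\<lambda>n. 1 - p ^ Suc n)"
proof -
  have "summable (\<lambda>n. norm (- (p ^ Suc n)))"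
    using assms summable_mult[OF summable_geometric[of "norm p"], of "norm p"] by (simp add: norm_mult norm_power)
  then have "abs_convergent_prod (\<lambda>n. 1 + - (p ^ Suc n))"
    by (simp add: summable_imp_abs_convergent_prod)
  then show ?thesis by (simp add: abs_convergent_prod_imp_convergent_prod)
qed

lemma one_minus_power_nonzero:
  assumes "norm (p::complex) < 1"
  shows "1 - p ^ Suc n \<noteq> 0"
proof
  assume "1 - p ^ Suc n = 0"
  then have "norm p ^ Suc n = 1" by (metis eq_iff_diff_eq_0 norm_one norm_power)
  moreover have "norm p ^ Suc n < 1" using assms by (simp add: power_less_one_iff del: power_Suc)
  ultimately show False by simp
qed

lemma euler_phi_nonzero: "norm p < 1 \<Longrightarrow> euler_phi p \<noteq> 0"
  unfolding euler_phi_def by (rule prodinf_nonzero[OF convergent_prod_euler one_minus_power_nonzero])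

lemma qpoch_nonzero: "norm p < 1 \<Longrightarrow> qpoch p n \<noteq> 0"
  unfolding qpoch_def using one_minus_power_nonzero by simp

lemma qpoch_LIMSEQ: "norm p < 1 \<Longrightarrow> qpoch p \<longlonglongrightarrow> euler_phi p"
  using convergent_prod_LIMSEQ[OF convergent_prod_euler[of p]] LIMSEQ_lessThan_iff_atMost[of "\<lambda>A. \<Prod>k\<in>A. 1 - p ^ Suc k"]
  unfolding euler_phi_def qpoch_def[abs_def] by simp

text \<open>The partial products converge uniformly on every closed disc of radius less than
  1.\<close>

lemma continuous_on_euler_phi: "continuous_on (ball 0 1) euler_phi"
proof -
  have "continuous_on (cball 0 r) euler_phi" if r: "0 < r" "r < 1" for r
  proof -
    have "uniformly_convergent_on (cball 0 r) (\<lambda>N x. \<Prod>n<N. 1 + (- (x ^ Suc n)) :: complex)"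
    proof (rule Infinite_Products.uniformly_convergent_on_prod)
      show "uniformly_convergent_on (cball 0 r) (\<lambda>N x. \<Sum>n<N. norm (- (x ^ Suc n) :: complex))"
      proof (rule Weierstrass_m_test')
        show "norm (norm (- (x ^ Suc n))) \<le> r ^ Suc n" if "x \<in> cball 0 r" for n and x :: complex
          using power_mono[of "norm x" r "Suc n"] that by (simp add: norm_power norm_mult)
        show "summable (\<lambda>n. r ^ Suc n)"
          using r summable_mult[OF summable_geometric[of r], of r] by simp
      qed
    qed (auto intro!: continuous_intros)
    then obtain l where l: "uniform_limit (cball 0 r) (\<lambda>N x. \<Prod>n<N. 1 + (- (x ^ Suc n)) :: complex) l sequentially"
      unfolding uniformly_convergent_on_def by blast
    have "l x = euler_phi x" if x: "x \<in> cball 0 r" for x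
    proof (rule LIMSEQ_unique)
      show "qpoch x \<longlonglongrightarrow> l x" using tendsto_uniform_limitI[OF l x] by (simp add: qpoch_def[abs_def])
      show "qpoch x \<longlonglongrightarrow> euler_phi x" using x r by (intro qpoch_LIMSEQ) auto
    qed
    moreover have "continuous_on (cball 0 r) l"
      by (rule uniform_limit_theorem[OF _ l]) (auto intro!: always_eventually continuous_intros)
    ultimately show ?thesis by (metis (no_types, lifting) continuous_on_cong)
  qed
  note c = this
  have "isCont euler_phi p" if p: "p \<in> ball 0 1" for p
  proof -
    define r where "r = (1 + norm p) / 2"
    have r: "0 < r" "r < 1" "norm p < r" using p by (auto simp: r_def add_pos_nonneg)
    have "continuous_on (ball 0 r) euler_phi" using c[OF r(1,2)] continuous_on_subset ball_subset_cball by blast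
    then show ?thesis using r by (simp add: continuous_on_eq_continuous_at)
  qed
  then show ?thesis by (simp add: continuous_at_imp_continuous_on)
qed

lemma euler_phi_0: "euler_phi 0 = 1"
  by (simp add: euler_phi_def)

lemma dedekind_eta_eq: "dedekind_eta \<tau> = exp (pi * \<i> * \<tau> / 12) * euler_phi (exp (2 * pi * \<i> * \<tau>))"
proof -
  have "exp (2 * pi * \<i> * of_nat (Suc n) * \<tau>) = exp (2 * pi * \<i> * \<tau>) ^ Suc n" for n
    by (simp add: exp_of_nat_mult[symmetric] mult_ac del: of_nat_Suc power_Suc)
  then show ?thesis by (simp only: dedekind_eta_def euler_phi_def)
qed

text \<open>The reciprocal \<open>1 / (p; p)\<^sub>n\<close>, extended by 0 so that the recursion below holds for all integers.\<close>
definition rqpoch :: "complex \<Rightarrow> int \<Rightarrow> complex" where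
  "rqpoch p n = (if n < 0 then 0 else inverse (qpoch p (nat n)))"

text \<open>At n = 0 the factor 1 - p^0 vanishes, in accordance with the value 0 given to negative
  arguments; this is what makes the convention consistent.\<close>

lemma rqpoch_rec:
  assumes "norm p < 1"
  shows "rqpoch p (n - 1) = (1 - p powi n) * rqpoch p n"
proof (cases "n > 0")
  case True
  then obtain m where m: "n = int (Suc m)" using pos_int_cases zero_less_imp_eq_int by (metis gr0_conv_Suc)
  have "p powi n = p ^ Suc m" unfolding m power_int_of_nat ..
  moreover have "nat (n - 1) = m" "nat n = Suc m" using m by auto
  ultimately show ?thesis using True qpoch_nonzero[OF assms, of m] one_minus_power_nonzero[OF assms, of m]
    by (simp add: rqpoch_def qpoch_def field_simps del: power_Suc)
next
  case False
  then show ?thesis by (cases "n = 0") (auto simp: rqpoch_def)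
qed

text \<open>The Gaussian binomial coefficient of 2 N over N + n in base \<open>q^2\<close>, times
  \<open>q powi (n^2)\<close>; its vanishing for |n| > N is built into
  \<open>rqpoch\<close>.\<close>

definition jtp_coeff :: "complex \<Rightarrow> nat \<Rightarrow> int \<Rightarrow> complex" where
  "jtp_coeff q N n = qpoch (q^2) (2 * N) * q powi (n^2) * rqpoch (q^2) (int N + n) * rqpoch (q^2) (int N - n)"

text \<open>The effect on Laurent coefficients of the two new factors, whose product is 1 + q^(4N+2)
  + q^(2N+1) (z + 1/z).\<close>

lemma jtp_coeff_rec:
  assumes q: "norm q < 1" "q \<noteq> 0"
  shows "jtp_coeff q (Suc N) n = (1 + q ^ (4 * N + 2)) * jtp_coeff q N n + q ^ (2 * N + 1) * (jtp_coeff q N (n - 1) + jtp_coeff q N (n + 1))"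
proof -
  define p where "p = q^2"
  have p: "norm p < 1" "p \<noteq> 0" using q by (auto simp: p_def norm_power power_less_one_iff)
  \<comment> \<open>In terms of a = p^n and b = p^(N+1) all four coefficients are rational multiples
    of one quantity \<open>Q\<close>, which leaves an identity of rational functions in a, b, p and
    q.\<close>
  define a b where "a = p powi n" and "b = p powi (int N + 1)"
  have a: "a \<noteq> 0" using p by (simp add: a_def)
  define R where "R = rqpoch p (int N + 1 + n) * rqpoch p (int N + 1 - n)"
  have e1: "p powi (int N + 1 + n) = b * a" "p powi (int N + 1 - n) = b / a"
    using p by (simp_all add: a_def b_def power_int_add power_int_diff)
  have e2: "p powi (int N + n) = b * a / p" "p powi (int N - n) = b / (a * p)"
    using p by (simp_all add: a_def b_def power_int_add power_int_diff)
  have r1: "rqpoch p (int N + n) = (1 - b * a) * rqpoch p (int N + 1 + n)"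
    using rqpoch_rec[OF p(1), of "int N + 1 + n"] unfolding e1 by (simp add: algebra_simps)
  have r2: "rqpoch p (int N - n) = (1 - b / a) * rqpoch p (int N + 1 - n)"
    using rqpoch_rec[OF p(1), of "int N + 1 - n"] unfolding e1 by (simp add: algebra_simps)
  have r3: "rqpoch p (int N + (n - 1)) = (1 - b * a / p) * rqpoch p (int N + n)"
    using rqpoch_rec[OF p(1), of "int N + n"] unfolding e2 by (simp add: algebra_simps)
  have r4: "rqpoch p (int N - (n + 1)) = (1 - b / (a * p)) * rqpoch p (int N - n)"
    using rqpoch_rec[OF p(1), of "int N - n"] unfolding e2 by (simp add: algebra_simps)
  define Q where "Q = qpoch p (2 * N) * q powi (n^2) * R"
  have q2n: "q powi (2 * n) = a" unfolding a_def p_def by (simp add: power_int_mult)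
  have x1: "q powi ((n - 1)^2) = q powi (n^2) * q / a"
  proof -
    have "(n - 1)^2 = n^2 + 1 - 2 * n" by (simp add: power2_eq_square algebra_simps)
    then show ?thesis using q by (simp add: power_int_add power_int_diff q2n)
  qed
  have x2: "q powi ((n + 1)^2) = q powi (n^2) * q * a"
  proof -
    have "(n + 1)^2 = n^2 + 1 + 2 * n" by (simp add: power2_eq_square algebra_simps)
    then show ?thesis using q by (simp add: power_int_add q2n)
  qed
  have b1: "b = p ^ Suc N" unfolding b_def by (metis power_int_of_nat of_nat_Suc add.commute)
  have b2: "b = q * q ^ (2 * N + 1)" by (simp add: b1 p_def power_mult power2_eq_square)
  have x4: "q ^ (2 * N + 1) = b / q" using q unfolding b2 by simp
  have x3: "q ^ (4 * N + 2) = b^2 / p"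
  proof -
    have "q ^ (4 * N + 2) = q ^ (2 * N + 1) * q ^ (2 * N + 1)" by (simp flip: power_add)
    then show ?thesis unfolding x4 p_def by (simp add: power2_eq_square)
  qed
  have x5: "qpoch p (2 * Suc N) = qpoch p (2 * N) * ((1 - b^2 / p) * (1 - b^2))"
  proof -
    have "p ^ Suc (2 * N) = b^2 / p" "p ^ Suc (Suc (2 * N)) = b^2" using p
      by (simp_all add: b1 power_mult[symmetric] power2_eq_square mult_2 power_add)
    then show ?thesis unfolding qpoch_def by (simp only: mult_Suc_right add_2_eq_Suc prod.lessThan_Suc mult.assoc)
  qed
  have A1: "jtp_coeff q (Suc N) n = Q * ((1 - b^2 / p) * (1 - b^2))"
    unfolding jtp_coeff_def p_def[symmetric] x5 Q_def R_def by (simp add: algebra_simps)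
  have A2: "jtp_coeff q N n = Q * ((1 - b * a) * (1 - b / a))"
    unfolding jtp_coeff_def p_def[symmetric] r1 r2 Q_def R_def by (simp only: mult_ac)
  have A3: "jtp_coeff q N (n - 1) = Q * (q / a * (1 - b * a) * (1 - b * a / p))"
  proof -
    have "rqpoch p (int N - (n - 1)) = rqpoch p (int N + 1 - n)" by (simp add: algebra_simps)
    then show ?thesis unfolding jtp_coeff_def p_def[symmetric] r3 r1 x1 Q_def R_def by (simp add: mult_ac)
  qed
  have A4: "jtp_coeff q N (n + 1) = Q * (q * a * (1 - b / a) * (1 - b / (a * p)))"
  proof -
    have "rqpoch p (int N + (n + 1)) = rqpoch p (int N + 1 + n)" by (simp add: algebra_simps)
    then show ?thesis unfolding jtp_coeff_def p_def[symmetric] r4 r2 x2 Q_def R_def by (simp add: mult_ac)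
  qed
  have "(1 - b^2 / p) * (1 - b^2) = (1 + b^2 / p) * ((1 - b * a) * (1 - b / a)) +
      b / q * (q / a * (1 - b * a) * (1 - b * a / p) + q * a * (1 - b / a) * (1 - b / (a * p)))"
    using a p q by (simp add: divide_simps) algebra
  then have "Q * ((1 - b^2 / p) * (1 - b^2)) = Q * ((1 + b^2 / p) * ((1 - b * a) * (1 - b / a)) +
      b / q * (q / a * (1 - b * a) * (1 - b * a / p) + q * a * (1 - b / a) * (1 - b / (a * p))))" by simp
  then show ?thesis unfolding A1 A2 A3 A4 x3 x4 by (simp only: distrib_left mult_ac)
qed

lemma jtp_coeff_eq_0: "\<bar>n\<bar> > int N \<Longrightarrow> jtp_coeff q N n = 0"
  by (cases "n \<ge> 0") (auto simp: jtp_coeff_def rqpoch_def)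

lemma finite_jacobi_triple_product:
  assumes q: "norm q < 1" "q \<noteq> 0" and z: "z \<noteq> 0"
  shows "(\<Prod>k<N. (1 + z * q ^ (2*k+1)) * (1 + q ^ (2*k+1) / z)) = (\<Sum>n\<in>{-int N..int N}. jtp_coeff q N n * z powi n)"
proof (induction N)
  case 0
  then show ?case by (simp add: jtp_coeff_def rqpoch_def qpoch_def)
next
  case (Suc N)
  \<comment> \<open>All three sums of the recursion are taken over the index range for N + 1; the
    added coefficients vanish by \<open>jtp_coeff_eq_0\<close>.\<close>
  define X where "X = {-int (Suc N)..int (Suc N)}"
  have shift: "(\<Sum>n\<in>X. jtp_coeff q N (n - j) * z powi n) = z powi j * (\<Sum>n\<in>{-int N..int N}. jtp_coeff q N n * z powi n)"
    if j: "j \<in> {-1,0,1}" for j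
  proof -
    have "(\<Sum>n\<in>X. jtp_coeff q N (n - j) * z powi n) = (\<Sum>n\<in>(\<lambda>m. m + j) ` {-int N..int N}. jtp_coeff q N (n - j) * z powi n)"
    proof (rule sum.mono_neutral_right)
      show "(\<lambda>m. m + j) ` {-int N..int N} \<subseteq> X" using j by (auto simp: X_def)
      show "\<forall>n\<in>X - (\<lambda>m. m + j) ` {-int N..int N}. jtp_coeff q N (n - j) * z powi n = 0"
      proof
        fix n assume "n \<in> X - (\<lambda>m. m + j) ` {-int N..int N}"
        then have "n - j \<notin> {-int N..int N}" by (auto simp: image_iff)
        then have "\<bar>n - j\<bar> > int N" by auto
        then show "jtp_coeff q N (n - j) * z powi n = 0" by (simp add: jtp_coeff_eq_0)
      qed
    qed (simp add: X_def)
    also have "\<dots> = (\<Sum>n\<in>{-int N..int N}. jtp_coeff q N n * z powi (n + j))"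
      by (subst sum.reindex) (auto simp: inj_on_def)
    finally show ?thesis using z by (simp add: sum_distrib_left power_int_add mult_ac)
  qed
  define P where "P = (\<Prod>k<N. (1 + z * q ^ (2*k+1)) * (1 + q ^ (2*k+1) / z))"
  have P0: "(\<Sum>n\<in>X. jtp_coeff q N n * z powi n) = P" using shift[of 0] Suc by (simp add: P_def)
  have P1: "(\<Sum>n\<in>X. jtp_coeff q N (n - 1) * z powi n) = z * P" using shift[of 1] Suc by (simp add: P_def)
  have P2: "(\<Sum>n\<in>X. jtp_coeff q N (n + 1) * z powi n) = P / z" using shift[of "-1"] Suc by (simp add: P_def power_int_minus field_simps)
  have "(\<Sum>n\<in>X. jtp_coeff q (Suc N) n * z powi n) = (\<Sum>n\<in>X. (1 + q ^ (4 * N + 2)) * (jtp_coeff q N n * z powi n)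
      + (q ^ (2 * N + 1) * (jtp_coeff q N (n - 1) * z powi n) + q ^ (2 * N + 1) * (jtp_coeff q N (n + 1) * z powi n)))"
    unfolding jtp_coeff_rec[OF q] by (intro sum.cong) (simp_all add: algebra_simps)
  also have "\<dots> = (1 + q ^ (4 * N + 2)) * P + (q ^ (2 * N + 1) * (z * P) + q ^ (2 * N + 1) * (P / z))"
    by (simp only: sum.distrib sum_distrib_left[symmetric] P0 P1 P2)
  also have "q ^ (4 * N + 2) = q ^ (2 * N + 1) * q ^ (2 * N + 1)" by (simp flip: power_add)
  also have "(1 + q ^ (2 * N + 1) * q ^ (2 * N + 1)) * P + (q ^ (2 * N + 1) * (z * P) + q ^ (2 * N + 1) * (P / z)) =
      P * ((1 + z * q ^ (2*N+1)) * (1 + q ^ (2*N+1) / z))"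
    using z by (simp add: field_simps)
  finally show ?case by (simp add: P_def X_def)
qed

text \<open>Termwise passage to the limit in the finite version: the three q-products in each
  coefficient stay bounded, so a multiple of the given summable family is a majorant, and of their
  limits one factor 1 / \<open>euler_phi (q^2)\<close> is left.\<close>

theorem jacobi_triple_product:
  assumes q: "norm q < 1" "q \<noteq> 0" and z: "z \<noteq> 0"
    and summable: "(\<lambda>n::int. norm (q powi (n^2) * z powi n)) summable_on UNIV"
  shows "(\<lambda>N. \<Prod>k<N. (1 + z * q ^ (2*k+1)) * (1 + q ^ (2*k+1) / z)) \<longlonglongrightarrow>
      (\<Sum>\<^sub>\<infinity>n\<in>(UNIV::int set). q powi (n^2) * z powi n) / euler_phi (q^2)"
proof -
  define p where "p = q^2"
  have p: "norm p < 1" using q by (simp add: p_def norm_power power_less_one_iff)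
  have ph: "euler_phi p \<noteq> 0" by (rule euler_phi_nonzero[OF p])
  obtain K1 where K1: "\<And>n. norm (qpoch p n) \<le> K1"
    using convergent_imp_bounded[OF qpoch_LIMSEQ[OF p]] unfolding bounded_iff by auto
  have linv: "(\<lambda>n. inverse (qpoch p n)) \<longlonglongrightarrow> inverse (euler_phi p)"
    by (intro tendsto_inverse qpoch_LIMSEQ p ph)
  obtain K2 where K2: "\<And>n. norm (inverse (qpoch p n)) \<le> K2"
    using convergent_imp_bounded[OF linv] unfolding bounded_iff by auto
  have K0: "0 \<le> K1" "0 \<le> K2" using K1[of 0] K2[of 0] norm_ge_zero order_trans by blast+
  have K2': "norm (rqpoch p n) \<le> K2" for n using K2 K0 by (simp add: rqpoch_def)
  have lim: "(\<lambda>N. rqpoch p (int N + n)) \<longlonglongrightarrow> inverse (euler_phi p)" for n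
  proof -
    have "filterlim (\<lambda>N. nat (int N + n)) at_top sequentially"
      unfolding filterlim_at_top eventually_sequentially
    proof
      fix Z
      show "\<exists>N. \<forall>m\<ge>N. Z \<le> nat (int m + n)" by (rule exI[of _ "Z + nat \<bar>n\<bar>"]) auto
    qed
    from filterlim_compose[OF linv this] show ?thesis
      by (rule Lim_transform_eventually) (auto simp: rqpoch_def eventually_sequentially intro!: exI[of _ "nat \<bar>n\<bar>"])
  qed
  have lim2: "(\<lambda>N. qpoch p (2 * N)) \<longlonglongrightarrow> euler_phi p"
    by (rule filterlim_compose[OF qpoch_LIMSEQ[OF p]]) (simp add: filterlim_subseq strict_mono_def)
  have "(\<lambda>N. \<Sum>\<^sub>\<infinity>n\<in>(UNIV::int set). jtp_coeff q N n * z powi n) \<longlonglongrightarrow>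
      (\<Sum>\<^sub>\<infinity>n\<in>(UNIV::int set). (q powi (n^2) * z powi n) * inverse (euler_phi p))"
  proof (rule tendsto_infsum_dominated)
    show "(\<lambda>n::int. K1 * K2 * K2 * norm (q powi (n^2) * z powi n)) summable_on UNIV"
      by (intro summable_on_cmult_right summable)
    show "\<forall>\<^sub>F N in sequentially. \<forall>n\<in>UNIV. norm (jtp_coeff q N n * z powi n) \<le> K1 * K2 * K2 * norm (q powi (n^2) * z powi n)"
    proof (intro always_eventually allI ballI)
      fix N and n :: int
      have "norm (jtp_coeff q N n * z powi n) = (norm (qpoch p (2 * N)) * norm (rqpoch p (int N + n)) * norm (rqpoch p (int N - n))) * norm (q powi (n^2) * z powi n)"
        by (simp add: jtp_coeff_def p_def norm_mult mult_ac)
      also have "\<dots> \<le> (K1 * K2 * K2) * norm (q powi (n^2) * z powi n)"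
        by (intro mult_right_mono mult_mono K1 K2' mult_nonneg_nonneg K0 norm_ge_zero)
      finally show "norm (jtp_coeff q N n * z powi n) \<le> K1 * K2 * K2 * norm (q powi (n^2) * z powi n)" .
    qed
    fix n :: int
    have "(\<lambda>N. qpoch p (2 * N) * q powi (n^2) * rqpoch p (int N + n) * rqpoch p (int N + (- n)) * z powi n) \<longlonglongrightarrow>
       euler_phi p * q powi (n^2) * inverse (euler_phi p) * inverse (euler_phi p) * z powi n"
      by (intro tendsto_intros lim lim2)
    then show "(\<lambda>N. jtp_coeff q N n * z powi n) \<longlonglongrightarrow> (q powi (n^2) * z powi n) * inverse (euler_phi p)"
      using ph by (simp add: jtp_coeff_def p_def field_simps)
  qed simp
  moreover have "(\<Sum>\<^sub>\<infinity>n\<in>(UNIV::int set). jtp_coeff q N n * z powi n) = (\<Prod>k<N. (1 + z * q ^ (2*k+1)) * (1 + q ^ (2*k+1) / z))" for N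
  proof -
    have "(\<Sum>\<^sub>\<infinity>n\<in>(UNIV::int set). jtp_coeff q N n * z powi n) = (\<Sum>\<^sub>\<infinity>n\<in>{-int N..int N}. jtp_coeff q N n * z powi n)"
      by (rule infsum_cong_neutral) (auto simp: jtp_coeff_eq_0)
    then show ?thesis by (simp only: finite_jacobi_triple_product[OF q z] infsum_finite finite_atLeastAtMost_int)
  qed
  ultimately show ?thesis by (simp add: infsum_cmult_left' p_def divide_inverse)
qed

text \<open>The triple product at z = 1, -1 and q gives theta3, theta4 and, up to q^(1/4), theta2.
  In the product of the three, Euler's identity that the factors 1 - x^(2k+1) and 1 + x^(k+1)
  multiply to 1 leaves only the factor 2 and the cube of \<open>euler_phi x\<close>.\<close>

theorem theta_product_eta:
  assumes \<tau>: "Im \<tau> > 0"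
  shows "theta2 \<tau> * theta3 \<tau> * theta4 \<tau> = 2 * dedekind_eta \<tau> ^ 3"
proof -
  define q where "q = exp (pi * \<i> * \<tau>)"
  define x where "x = q ^ 2"
  define r where "r = exp (pi * \<i> * \<tau> / 4)"
  have q: "norm q < 1" "q \<noteq> 0" using \<tau> by (auto simp: q_def norm_exp_eq_Re)
  have x: "norm x < 1" using q by (simp add: x_def norm_power power_less_one_iff)
  have r: "r \<noteq> 0" by (simp add: r_def)
  have xe: "x = exp (2 * pi * \<i> * \<tau>)" unfolding x_def q_def by (simp flip: exp_of_nat_mult add: mult_ac)
  have ph: "euler_phi x \<noteq> 0" by (rule euler_phi_nonzero[OF x])
  have qn: "q powi (n^2) = exp (pi * \<i> * (of_int n + of_real 0) ^ 2 * \<tau>)" for n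
    unfolding q_def exp_power_int by (simp add: mult_ac)
  have s0: "(\<lambda>n::int. norm (q powi (n^2))) summable_on UNIV"
    unfolding qn by (rule abs_summable_theta) (use \<tau> in auto)
  have m1: "(-1) powi n = (if even n then 1 else -1 :: complex)" for n :: int by (rule power_int_minus_one_minus[THEN trans] | simp add: power_int_minus_left)
  have q2: "q powi (n^2) * q powi n = exp (pi * \<i> * (of_int n + of_real (1/2)) ^ 2 * \<tau>) / r" for n :: int
    unfolding q_def exp_power_int exp_add[symmetric] r_def exp_diff[symmetric]
    by (rule arg_cong[of _ _ exp]) (simp add: power2_eq_square field_simps)
  have P3: "(\<lambda>N. \<Prod>k<N. (1 + q ^ (2*k+1)) * (1 + q ^ (2*k+1))) \<longlonglongrightarrow> theta3 \<tau> / euler_phi x"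
    using jacobi_triple_product[OF q, of 1] s0 by (simp add: qn theta3_eq_shift theta_shift_def x_def)
  have P4: "(\<lambda>N. \<Prod>k<N. (1 - q ^ (2*k+1)) * (1 - q ^ (2*k+1))) \<longlonglongrightarrow> theta4 \<tau> / euler_phi x"
  proof -
    have "(\<Sum>\<^sub>\<infinity>n\<in>(UNIV::int set). q powi (n^2) * (-1) powi n) = theta4 \<tau>"
      unfolding theta4_eq m1 qn by (simp add: mult_ac)
    moreover have "(\<lambda>n::int. norm (q powi (n^2) * (-1) powi n)) summable_on UNIV"
      using s0 by (simp add: norm_mult norm_power_int)
    ultimately show ?thesis using jacobi_triple_product[OF q, of "-1"] by (simp add: x_def)
  qed
  have P2: "(\<lambda>N. \<Prod>k<N. (1 + q * q ^ (2*k+1)) * (1 + q ^ (2*k+1) / q)) \<longlonglongrightarrow> theta2 \<tau> / r / euler_phi x"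
  proof -
    have "(\<Sum>\<^sub>\<infinity>n\<in>(UNIV::int set). q powi (n^2) * q powi n) = theta2 \<tau> / r"
      unfolding q2 theta2_eq_shift theta_shift_def divide_inverse by (simp only: infsum_cmult_left')
    moreover have "(\<lambda>n::int. norm (q powi (n^2) * q powi n)) summable_on UNIV"
    proof -
      have "(\<lambda>n::int. norm (exp (pi * \<i> * (of_int n + of_real (1/2)) ^ 2 * \<tau>)) * (1 / norm r)) summable_on UNIV"
        by (intro summable_on_cmult_left abs_summable_theta) (use \<tau> in auto)
      then show ?thesis unfolding q2 by (simp add: norm_divide)
    qed
    ultimately show ?thesis using jacobi_triple_product[OF q q(2)] unfolding x_def by simp
  qed
  \<comment> \<open>At z = q the two factors are 1 + x^(k+1) and 1 + x^k. The second family starts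
    with 1 + x^0 = 2 and stops one step earlier, which the extra factor 1 + x^N makes good.\<close>
  have fin2: "(\<Prod>k<N. (1 + q * q ^ (2*k+1)) * (1 + q ^ (2*k+1) / q)) * (1 + x ^ N) = 2 * (\<Prod>k<N. 1 + x ^ Suc k) ^ 2" for N
  proof (induction N)
    case (Suc N)
    have "q * q ^ (2*N+1) = x ^ Suc N" "q ^ (2*N+1) / q = x ^ N"
      using q by (simp_all add: x_def power2_eq_square power_add mult_2 power_mult_distrib)
    then have "(\<Prod>k<Suc N. (1 + q * q ^ (2*k+1)) * (1 + q ^ (2*k+1) / q)) * (1 + x ^ Suc N) =
       ((\<Prod>k<N. (1 + q * q ^ (2*k+1)) * (1 + q ^ (2*k+1) / q)) * (1 + x ^ N)) * (1 + x ^ Suc N) ^ 2"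
      by (simp add: power2_eq_square del: power_Suc)
    then show ?case unfolding Suc.IH by (simp add: power_mult_distrib del: power_Suc)
  qed simp
  have fin34: "(\<Prod>k<N. (1 + q ^ (2*k+1)) * (1 + q ^ (2*k+1))) * (\<Prod>k<N. (1 - q ^ (2*k+1)) * (1 - q ^ (2*k+1))) = (\<Prod>k<N. 1 - x ^ (2*k+1)) ^ 2" for N
  proof -
    have "(1 + q ^ (2*k+1)) * (1 + q ^ (2*k+1)) * ((1 - q ^ (2*k+1)) * (1 - q ^ (2*k+1))) = (1 - x ^ (2*k+1)) ^ 2" for k
    proof -
      have "x ^ (2*k+1) = q ^ (2*k+1) * q ^ (2*k+1)" by (simp only: x_def power2_eq_square power_mult_distrib)
      then show ?thesis by (simp add: power2_eq_square algebra_simps del: power_Suc)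
    qed
    then show ?thesis by (simp only: prod.distrib[symmetric] prod_power_distrib)
  qed
  \<comment> \<open>Each (1 + x^k) (1 - x^k) = 1 - x^(2k) supplies an even exponent, and together
    with the odd ones they form \<open>qpoch x (2 * N)\<close>.\<close>
  have euler: "(\<Prod>k<N. 1 - x ^ (2*k+1)) * (\<Prod>k<N. 1 + x ^ Suc k) * qpoch x N = qpoch x (2 * N)" for N
  proof (induction N)
    case (Suc N)
    have f: "(1 + x ^ Suc N) * (1 - x ^ Suc N) = 1 - x ^ Suc (2 * N + 1)"
      by (simp add: algebra_simps power_add power_mult power2_eq_square)
    have "(\<Prod>k<Suc N. 1 - x ^ (2*k+1)) * (\<Prod>k<Suc N. 1 + x ^ Suc k) * qpoch x (Suc N) =
       ((\<Prod>k<N. 1 - x ^ (2*k+1)) * (\<Prod>k<N. 1 + x ^ Suc k) * qpoch x N) * ((1 - x ^ (2*N+1)) * (1 - x ^ Suc (2 * N + 1)))"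
      unfolding qpoch_def prod.lessThan_Suc f[symmetric] by (simp only: mult_ac)
    also have "\<dots> = qpoch x (2 * Suc N)"
      by (simp only: Suc.IH) (simp add: qpoch_def del: power_Suc)
    finally show ?case .
  qed (simp add: qpoch_def)
  have "(\<lambda>N. qpoch x (2 * N) / qpoch x N) \<longlonglongrightarrow> euler_phi x / euler_phi x"
    by (intro tendsto_divide qpoch_LIMSEQ x ph filterlim_compose[OF qpoch_LIMSEQ[OF x]]) (simp add: filterlim_subseq strict_mono_def)
  moreover have "qpoch x (2 * N) / qpoch x N = (\<Prod>k<N. 1 - x ^ (2*k+1)) * (\<Prod>k<N. 1 + x ^ Suc k)" for N
    using euler[of N] qpoch_nonzero[OF x, of N] by (simp add: field_simps)
  ultimately have E: "(\<lambda>N. (\<Prod>k<N. 1 - x ^ (2*k+1)) * (\<Prod>k<N. 1 + x ^ Suc k)) \<longlonglongrightarrow> 1"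
    using ph by simp
  have "(\<lambda>N. 2 * ((\<Prod>k<N. 1 - x ^ (2*k+1)) * (\<Prod>k<N. 1 + x ^ Suc k)) ^ 2) \<longlonglongrightarrow> 2 * 1 ^ 2"
    by (intro tendsto_intros E)
  moreover have "(\<lambda>N. 2 * ((\<Prod>k<N. 1 - x ^ (2*k+1)) * (\<Prod>k<N. 1 + x ^ Suc k)) ^ 2) \<longlonglongrightarrow>
      theta3 \<tau> / euler_phi x * (theta4 \<tau> / euler_phi x) * (theta2 \<tau> / r / euler_phi x * (1 + 0))"
  proof -
    have "(\<lambda>N. x ^ N) \<longlonglongrightarrow> 0" using x by (rule LIMSEQ_power_zero)
    then have "(\<lambda>N. (\<Prod>k<N. (1 + q ^ (2*k+1)) * (1 + q ^ (2*k+1))) * (\<Prod>k<N. (1 - q ^ (2*k+1)) * (1 - q ^ (2*k+1))) *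
        ((\<Prod>k<N. (1 + q * q ^ (2*k+1)) * (1 + q ^ (2*k+1) / q)) * (1 + x ^ N))) \<longlonglongrightarrow>
      theta3 \<tau> / euler_phi x * (theta4 \<tau> / euler_phi x) * (theta2 \<tau> / r / euler_phi x * (1 + 0))"
      by (intro tendsto_mult P2 P3 P4 tendsto_add tendsto_const)
    then show ?thesis unfolding fin2 fin34 by (simp add: power_mult_distrib mult_ac)
  qed
  ultimately have "2 * 1 ^ 2 = theta3 \<tau> / euler_phi x * (theta4 \<tau> / euler_phi x) * (theta2 \<tau> / r / euler_phi x * (1 + 0))"
    by (rule LIMSEQ_unique)
  then have "theta2 \<tau> * theta3 \<tau> * theta4 \<tau> = 2 * (r * euler_phi x ^ 3)"
    using ph r by (simp add: field_simps power3_eq_cube)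
  moreover have "r = exp (pi * \<i> * \<tau> / 12) ^ 3"
    using exp_of_nat_mult[of 3 "pi * \<i> * \<tau> / 12"] by (simp add: r_def mult_ac)
  ultimately show ?thesis unfolding dedekind_eta_eq xe[symmetric] power_mult_distrib by simp
qed

lemma norm_exp_2pi_less_one:
  assumes "Im \<tau> > 0"
  shows "norm (exp (2 * pi * \<i> * \<tau>)) < 1"
  using assms by (simp add: norm_exp_eq_Re)

lemma dedekind_eta_nonzero:
  assumes "Im \<tau> > 0"
  shows "dedekind_eta \<tau> \<noteq> 0"
  unfolding dedekind_eta_eq using euler_phi_nonzero[OF norm_exp_2pi_less_one[OF assms]] by simp

lemma
  assumes "Im \<tau> > 0"
  shows theta2_nonzero: "theta2 \<tau> \<noteq> 0" and theta3_nonzero: "theta3 \<tau> \<noteq> 0" and theta4_nonzero: "theta4 \<tau> \<noteq> 0"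
  using theta_product_eta[OF assms] dedekind_eta_nonzero[OF assms] by auto

lemma continuous_on_dedekind_eta: "continuous_on upper_half_plane dedekind_eta"
  unfolding dedekind_eta_eq[abs_def]
  by (intro continuous_intros continuous_on_compose2[OF continuous_on_euler_phi])
     (auto simp: norm_exp_2pi_less_one)

lemma tendsto_dedekind_eta_scaled:
  "((\<lambda>t. dedekind_eta t / exp (pi * \<i> * t / 12)) \<longlongrightarrow> 1) (filtercomap Im at_top)"
proof -
  have "((\<lambda>t. exp (2 * pi * \<i> * t)) \<longlongrightarrow> 0) (filtercomap Im at_top)"
    using tendsto_exp_Im_at_top[of "2 * pi"] by (simp add: mult_ac)
  moreover have "isCont euler_phi 0"
    using continuous_on_euler_phi by (simp add: continuous_on_eq_continuous_at)
  ultimately have "((\<lambda>t. euler_phi (exp (2 * pi * \<i> * t))) \<longlongrightarrow> euler_phi 0) (filtercomap Im at_top)"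
    by (rule isCont_tendsto_compose[rotated])
  then show ?thesis by (simp add: dedekind_eta_eq euler_phi_0)
qed

section \<open>Values of the zeta function\<close>

text \<open>The logarithmic derivative of Gamma(x) Gamma(1 - x) = pi / sin(pi x).\<close>

lemma Polygamma_reflection_0:
  fixes x :: real
  assumes x: "0 < x" "x < 1"
  shows "Digamma (1 - x) - Digamma x = pi * (cos (pi * x) / sin (pi * x))"
proof -
  have G: "Gamma t * Gamma (1 - t) = pi / sin (pi * t)" for t :: real
  proof -
    have "Gamma (of_real t) * Gamma (of_real (1 - t)) = of_real pi / sin (complex_of_real (pi * t))"
      using Gamma_reflection_complex[of "of_real t"] by simp
    then have "complex_of_real (Gamma t * Gamma (1 - t)) = of_real (pi / sin (pi * t))"
      unfolding Gamma_complex_of_real sin_of_real by simp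
    then show ?thesis by (simp only: of_real_eq_iff)
  qed
  have sp: "sin (pi * t) > 0" if "0 < t" "t < 1" for t
    using that by (intro sin_gt_zero) auto
  have d1: "((\<lambda>t. ln_Gamma t + ln_Gamma (1 - t)) has_real_derivative (Digamma x - Digamma (1 - x))) (at x)"
    using x by (auto intro!: derivative_eq_intros)
  have d2: "((\<lambda>t. ln pi - ln (sin (pi * t))) has_real_derivative - (pi * (cos (pi * x) / sin (pi * x)))) (at x)"
    using sp[OF x] by (auto intro!: derivative_eq_intros)
  have "ln_Gamma t + ln_Gamma (1 - t) = ln pi - ln (sin (pi * t))" if "t \<in> {0<..<1}" for t :: real
  proof -
    have "exp (ln_Gamma t + ln_Gamma (1 - t)) = exp (ln pi - ln (sin (pi * t)))"
      using that G[of t] sp[of t] by (simp add: exp_add exp_diff Gamma_real_pos_exp[symmetric])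
    then show ?thesis by simp
  qed
  note eq = this
  have "((\<lambda>t. ln pi - ln (sin (pi * t))) has_real_derivative (Digamma x - Digamma (1 - x))) (at x)"
    by (rule has_field_derivative_transform_within_open[OF d1, of "{0<..<1}"]) (use x eq in auto)
  then have "Digamma x - Digamma (1 - x) = - (pi * (cos (pi * x) / sin (pi * x)))"
    using d2 by (rule DERIV_unique)
  then show ?thesis by simp
qed

text \<open>Differentiating the term at 1 - x changes its sign; renormalising it to +1 flips
  \<open>s\<close> and the right side.\<close>

lemma Polygamma_reflection_step:
  fixes f :: "real \<Rightarrow> real"
  assumes eq: "\<And>x. x \<in> {0<..<1} \<Longrightarrow> Polygamma n (1 - x) - s * Polygamma n x = f x"
    and der: "\<And>x. x \<in> {0<..<1} \<Longrightarrow> (f has_real_derivative f' x) (at x)"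
    and x: "x \<in> {0<..<1}"
  shows "Polygamma (Suc n) (1 - x) - (- s) * Polygamma (Suc n) x = - f' x"
proof -
  have nn: "x \<notin> \<int>\<^sub>\<le>\<^sub>0" "1 - x \<notin> \<int>\<^sub>\<le>\<^sub>0" using x by (auto elim!: nonpos_Ints_cases)
  have "((\<lambda>t. Polygamma n (1 - t) - s * Polygamma n t) has_real_derivative - Polygamma (Suc n) (1 - x) - s * Polygamma (Suc n) x) (at x)"
    using nn by (auto intro!: derivative_eq_intros)
  moreover have "((\<lambda>t. Polygamma n (1 - t) - s * Polygamma n t) has_real_derivative f' x) (at x)"
    using has_field_derivative_transform_within_open[OF der[OF x], of "{0<..<1}" "\<lambda>t. Polygamma n (1 - t) - s * Polygamma n t"] eq x
    by auto
  ultimately have "- Polygamma (Suc n) (1 - x) - s * Polygamma (Suc n) x = f' x" by (rule DERIV_unique)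
  then show ?thesis by simp
qed

text \<open>The cotangent k satisfies k' = -pi (1 + k^2), so every derivative is a polynomial in k.
  At 1/2 k vanishes and only the constant term remains, while for odd order the two polygamma values
  coincide and add up.\<close>

lemma
  shows Polygamma_3_half: "Polygamma 3 (1/2) = pi ^ 4"
    and Polygamma_5_half: "Polygamma 5 (1/2) = 8 * pi ^ 6"
proof -
  define k where "k = (\<lambda>x::real. cos (pi * x) / sin (pi * x))"
  have k: "(k has_real_derivative - (pi * (1 + k x ^ 2))) (at x)" if "x \<in> {0<..<1}" for x
  proof -
    have s: "sin (pi * x) \<noteq> 0" using that sin_gt_zero[of "pi * x"] by auto
    have "(k has_real_derivative (- (sin (pi * x) * pi) * sin (pi * x) - cos (pi * x) * (cos (pi * x) * pi)) / (sin (pi * x) * sin (pi * x))) (at x)"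
      unfolding k_def using s by (auto intro!: derivative_eq_intros)
    also have "(- (sin (pi * x) * pi) * sin (pi * x) - cos (pi * x) * (cos (pi * x) * pi)) / (sin (pi * x) * sin (pi * x)) = - (pi * (1 + k x ^ 2))"
    proof -
      have "(- (b * pi) * b - a * (a * pi)) / (b * b) = - (pi * (1 + (a / b) ^ 2))" if "b \<noteq> 0" for a b :: real
        using that by (simp add: power2_eq_square field_simps)
      then show ?thesis using s by (simp only: k_def)
    qed
    finally show ?thesis .
  qed
  note [derivative_intros] = DERIV_chain2[OF k]
  have D0: "Polygamma 0 (1 - x) - 1 * Polygamma 0 x = pi * k x" if "x \<in> {0<..<1}" for x
    using Polygamma_reflection_0[of x] that by (simp add: k_def)
  have D1: "Polygamma (Suc 0) (1 - x) - (- 1) * Polygamma (Suc 0) x = - (- (pi^2 * (1 + k x ^ 2)))" if "x \<in> {0<..<1}" for x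
    by (rule Polygamma_reflection_step[OF D0 _ that]) (auto intro!: derivative_eq_intros k simp: power2_eq_square algebra_simps)
  have D2: "Polygamma (Suc (Suc 0)) (1 - x) - (- (- 1)) * Polygamma (Suc (Suc 0)) x = - (- (2 * pi^3 * (k x + k x ^ 3)))" if "x \<in> {0<..<1}" for x
    by (rule Polygamma_reflection_step[OF D1 _ that]) (auto intro!: derivative_eq_intros k simp: power2_eq_square power3_eq_cube algebra_simps)
  have D3: "Polygamma (Suc (Suc (Suc 0))) (1 - x) - (- (- (- 1))) * Polygamma (Suc (Suc (Suc 0))) x = - (- (2 * pi^4 * (1 + 4 * k x ^ 2 + 3 * k x ^ 4)))" if "x \<in> {0<..<1}" for x
    by (rule Polygamma_reflection_step[OF D2 _ that]) (auto intro!: derivative_eq_intros k simp: eval_nat_numeral algebra_simps)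
  have D4: "Polygamma (Suc (Suc (Suc (Suc 0)))) (1 - x) - (- (- (- (- 1)))) * Polygamma (Suc (Suc (Suc (Suc 0)))) x = - (- (2 * pi^5 * (8 * k x + 20 * k x ^ 3 + 12 * k x ^ 5)))" if "x \<in> {0<..<1}" for x
    by (rule Polygamma_reflection_step[OF D3 _ that]) (auto intro!: derivative_eq_intros k simp: eval_nat_numeral algebra_simps)
  have D5: "Polygamma (Suc (Suc (Suc (Suc (Suc 0))))) (1 - x) - (- (- (- (- (- 1))))) * Polygamma (Suc (Suc (Suc (Suc (Suc 0))))) x = - (- (2 * pi^6 * ((8 + 60 * k x ^ 2 + 60 * k x ^ 4) * (1 + k x ^ 2))))" if "x \<in> {0<..<1}" for x
    by (rule Polygamma_reflection_step[OF D4 _ that]) (auto intro!: derivative_eq_intros k simp: eval_nat_numeral algebra_simps)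
  have k0: "k (1/2) = 0" by (simp add: k_def)
  have n: "3 = Suc (Suc (Suc 0))" "5 = Suc (Suc (Suc (Suc (Suc 0))))" by simp_all
  show "Polygamma 3 (1/2) = pi ^ 4" unfolding n(1) using D3[of "1/2"] by (simp add: k0)
  show "Polygamma 5 (1/2) = 8 * pi ^ 6" unfolding n(2) using D5[of "1/2"] by (simp add: k0)
qed

text \<open>The even denominators contribute 2^(-p) times the whole series, so the odd ones make up
  the share 1 - 2^(-p).\<close>

lemma zeta_from_odd:
  fixes p :: nat
  assumes p: "p \<ge> 2" and odd: "(\<lambda>k. 1 / (2 * real k + 1) ^ p) sums s"
  shows "(\<lambda>k. 1 / real (Suc k) ^ p) sums (s / (1 - 1 / 2 ^ p))"
proof -
  define f where "f = (\<lambda>k. 1 / real (Suc k) ^ p)"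
  have "summable f"
    using inverse_power_summable[OF p, where 'a = real] unfolding f_def by (subst summable_Suc_iff) (simp add: inverse_eq_divide)
  then have S: "f sums suminf f" by (rule summable_sums)
  have "(\<lambda>n. sum f {n * 2..<n * 2 + 2}) sums suminf f" by (rule sums_group[OF S]) simp
  moreover have "sum f {n * 2..<n * 2 + 2} = 1 / (2 * real n + 1) ^ p + (1 / 2 ^ p) * f n" for n
  proof -
    have "{n * 2..<n * 2 + 2} = {2 * n, 2 * n + 1}" by auto
    moreover have "real (Suc (2 * n + 1)) = 2 * real (Suc n)" by simp
    ultimately show ?thesis by (simp add: f_def power_mult_distrib add.commute del: of_nat_Suc) (simp add: add.commute)
  qed
  moreover have "(\<lambda>n. 1 / (2 * real n + 1) ^ p + (1 / 2 ^ p) * f n) sums (s + (1 / 2 ^ p) * suminf f)"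
    by (intro sums_add odd sums_mult S)
  ultimately have "suminf f = s + (1 / 2 ^ p) * suminf f" using sums_unique2 by simp
  moreover have "(2::real) ^ p > 1" using p by (intro one_less_power) auto
  ultimately have "suminf f = s / (1 - 1 / 2 ^ p)" by (simp add: field_simps)
  then show ?thesis using S by (simp add: f_def)
qed

text \<open>The polygamma series at 1/2 runs over powers of k + 1/2; the factor 2^p clears the
  halves, and for even p its sign is positive.\<close>

lemma Polygamma_half_sums:
  assumes "even p" "p \<ge> 2"
  shows "(\<lambda>k. 1 / (2 * real k + 1) ^ p) sums (Polygamma (p - 1) (1/2) / (2 ^ p * fact (p - 1)))"
proof -
  obtain n where n: "p = Suc n" "n > 0" using assms by (cases p) auto
  have "summable (\<lambda>k. inverse ((1/2 + real k) ^ Suc n))"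
    using Polygamma_converges'[of "1/2::real" "Suc n"] n by simp
  then have "(\<lambda>k. inverse ((1/2 + real k) ^ Suc n)) sums (Polygamma n (1/2) / fact n)"
    using n assms by (simp add: Polygamma_def summable_sums)
  from sums_mult[OF this, of "1 / 2 ^ Suc n"]
  have "(\<lambda>k. 1 / 2 ^ Suc n * inverse ((1/2 + real k) ^ Suc n)) sums (1 / 2 ^ Suc n * (Polygamma n (1/2) / fact n))" .
  moreover have "1 / 2 ^ Suc n * inverse ((1/2 + real k) ^ Suc n) = 1 / (2 * real k + 1) ^ Suc n" for k
  proof -
    have "2 * real k + 1 = 2 * (1/2 + real k)" by simp
    then have "(2 * real k + 1) ^ Suc n = 2 ^ Suc n * (1/2 + real k) ^ Suc n" by (simp only: power_mult_distrib)
    then show ?thesis by (simp only: inverse_eq_divide) simp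
  qed
  ultimately show ?thesis by (simp add: n mult_ac)
qed

theorem zeta_4: "(\<lambda>k. 1 / real (Suc k) ^ 4) sums (pi ^ 4 / 90)"
proof -
  have e: "pi ^ 4 / 90 = Polygamma (4 - 1) (1/2) / (2 ^ 4 * fact (4 - 1)) / (1 - 1 / 2 ^ 4)"
    by (simp add: Polygamma_3_half fact_numeral)
  show ?thesis unfolding e by (rule zeta_from_odd[OF _ Polygamma_half_sums]) auto
qed

theorem zeta_6: "(\<lambda>k. 1 / real (Suc k) ^ 6) sums (pi ^ 6 / 945)"
proof -
  have e: "pi ^ 6 / 945 = Polygamma (6 - 1) (1/2) / (2 ^ 6 * fact (6 - 1)) / (1 - 1 / 2 ^ 6)"
    by (simp add: Polygamma_5_half fact_numeral)
  show ?thesis unfolding e by (rule zeta_from_odd[OF _ Polygamma_half_sums]) auto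
qed

section \<open>Eisenstein series\<close>

text \<open>The unnormalised series of the lattice spanned by 1 and \<tau>, indexed by pairs so that
  modular substitutions become bijections of the index set.\<close>

definition eisenstein :: "nat \<Rightarrow> complex \<Rightarrow> complex" where
  "eisenstein k \<tau> = (\<Sum>\<^sub>\<infinity>(m,n)\<in>UNIV - {(0::int,0::int)}. 1 / (of_int m + of_int n * \<tau>) ^ k)"

lemma lattice_point_nonzero:
  assumes "Im \<tau> > 0" "(m, n) \<noteq> (0::int, 0::int)"
  shows "of_int m + of_int n * \<tau> \<noteq> 0"
proof
  assume *: "of_int m + of_int n * \<tau> = 0"
  then have "of_int n * Im \<tau> = 0" by (simp add: complex_eq_iff)
  then have "n = 0" using assms by simp
  then show False using * assms by simp
qed

lemma inj_lattice_point:
  assumes "Im \<tau> > 0"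
  shows "inj (\<lambda>(m::int, n::int). of_int m + of_int n * \<tau>)"
proof (rule injI, clarify)
  fix m n m' n' :: int
  assume "of_int m + of_int n * \<tau> = of_int m' + of_int n' * \<tau>"
  then have "of_int (m - m') + of_int (n - n') * \<tau> = 0" by (simp add: algebra_simps)
  then have "(m - m', n - n') = (0, 0)" using lattice_point_nonzero[OF assms] by blast
  then show "m = m' \<and> n = n'" by simp
qed

lemma eisenstein_sum_lattice:
  assumes \<tau>: "Im \<tau> > 0" "\<tau> = \<omega>2 / \<omega>1"
  shows "eisenstein_sum k (lattice_of \<omega>1 \<omega>2) = eisenstein k \<tau> / \<omega>1 ^ k"
proof -
  have \<omega>: "\<omega>1 \<noteq> 0" using assms by auto
  define p where "p = (\<lambda>(m::int, n::int). \<omega>1 * (of_int m + of_int n * \<tau>))"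
  have inj: "inj p"
    using inj_lattice_point[OF \<tau>(1)] \<omega> by (auto simp: p_def inj_def)
  have "lattice_of \<omega>1 \<omega>2 = range p"
    using \<omega> \<tau>(2) by (auto simp: lattice_of_def p_def image_iff algebra_simps)
  moreover have "p x = 0 \<longleftrightarrow> x = (0, 0)" for x
    using \<omega> lattice_point_nonzero[OF \<tau>(1)] by (cases x) (auto simp: p_def)
  ultimately have "lattice_of \<omega>1 \<omega>2 - {0} = p ` (UNIV - {(0, 0)})" by auto
  then have "eisenstein_sum k (lattice_of \<omega>1 \<omega>2) = infsum ((\<lambda>w. 1 / w ^ k) \<circ> p) (UNIV - {(0, 0)})"
    unfolding eisenstein_sum_def using inj by (simp add: infsum_reindex inj_on_subset)
  also have "\<dots> = (\<Sum>\<^sub>\<infinity>(m,n)\<in>UNIV - {(0::int,0::int)}. 1 / (of_int m + of_int n * \<tau>) ^ k * (1 / \<omega>1 ^ k))"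
    by (intro infsum_cong) (auto simp: p_def power_mult_distrib)
  also have "\<dots> = eisenstein k \<tau> / \<omega>1 ^ k"
    unfolding eisenstein_def case_prod_unfold by (simp only: infsum_cmult_left') simp
  finally show ?thesis .
qed

text \<open>With x = Re \<tau>, m^2 \<le> 2 (m + n x)^2 + 2 (n x)^2, because the difference is (m +
  2 n x)^2. Multiplication by y^2 \<le> 1 keeps the first term in check and lets n^2 y^2 be absorbed
  by (n Im \<tau>)^2.\<close>

lemma norm_lattice_point_ge:
  assumes "\<bar>Re \<tau>\<bar> \<le> B" "Im \<tau> \<ge> y" "0 < y" "y \<le> 1"
  shows "(cmod (of_int m + of_int n * \<tau>))\<^sup>2 \<ge> y\<^sup>2 / (2 + 2 * B\<^sup>2) * (of_int (m\<^sup>2 + n\<^sup>2))"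
proof -
  define M N x v where "M = real_of_int m" and "N = real_of_int n" and "x = Re \<tau>" and "v = Im \<tau>"
  have x2: "x\<^sup>2 \<le> B\<^sup>2" using assms(1) by (metis abs_ge_zero power2_abs power_mono x_def)
  have v2: "y\<^sup>2 \<le> v\<^sup>2" using assms by (intro power_mono) (auto simp: v_def)
  have y2: "y\<^sup>2 \<le> 1" using assms by (simp add: power_le_one)
  have B: "0 \<le> B\<^sup>2" by simp
  have norm: "(cmod (of_int m + of_int n * \<tau>))\<^sup>2 = (M + N * x)\<^sup>2 + (N * v)\<^sup>2"
    by (simp add: cmod_power2 M_def N_def x_def v_def)
  have "M\<^sup>2 \<le> 2 * (M + N * x)\<^sup>2 + 2 * (N * x)\<^sup>2"
    using zero_le_power2[of "M + 2 * N * x"] by (simp add: power2_eq_square algebra_simps)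
  also have "(N * x)\<^sup>2 \<le> N\<^sup>2 * B\<^sup>2" using x2 by (simp add: power_mult_distrib mult_left_mono)
  finally have 1: "M\<^sup>2 \<le> 2 * (M + N * x)\<^sup>2 + 2 * (N\<^sup>2 * B\<^sup>2)" by simp
  have "y\<^sup>2 * (M\<^sup>2 + N\<^sup>2) \<le> y\<^sup>2 * (2 * (M + N * x)\<^sup>2) + y\<^sup>2 * (N\<^sup>2 * (1 + 2 * B\<^sup>2))"
    using mult_left_mono[OF 1, of "y\<^sup>2"] by (simp add: algebra_simps)
  also have "y\<^sup>2 * (2 * (M + N * x)\<^sup>2) \<le> 2 * (M + N * x)\<^sup>2" using y2 by (simp add: mult_left_le_one_le)
  also have "y\<^sup>2 * (N\<^sup>2 * (1 + 2 * B\<^sup>2)) \<le> v\<^sup>2 * (N\<^sup>2 * (1 + 2 * B\<^sup>2))"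
    by (rule mult_right_mono[OF v2]) simp
  also have "2 * (M + N * x)\<^sup>2 + v\<^sup>2 * (N\<^sup>2 * (1 + 2 * B\<^sup>2)) \<le> (2 + 2 * B\<^sup>2) * ((M + N * x)\<^sup>2 + (N * v)\<^sup>2)"
    using B mult_nonneg_nonneg[OF B zero_le_power2[of "M + N * x"]] zero_le_power2[of "N * v"]
    by (simp add: power_mult_distrib algebra_simps)
  finally have "y\<^sup>2 * (M\<^sup>2 + N\<^sup>2) \<le> (2 + 2 * B\<^sup>2) * ((M + N * x)\<^sup>2 + (N * v)\<^sup>2)" by simp
  moreover have "2 + 2 * B\<^sup>2 > 0" by (simp add: add_pos_nonneg)
  ultimately have "y\<^sup>2 * (M\<^sup>2 + N\<^sup>2) / (2 + 2 * B\<^sup>2) \<le> (M + N * x)\<^sup>2 + (N * v)\<^sup>2"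
    by (simp add: divide_le_eq mult.commute)
  then show ?thesis unfolding norm by (simp add: M_def N_def)
qed

lemma summable_on_inverse_square_int: "(\<lambda>n::int. 1 / (1 + (of_int n)\<^sup>2 :: real)) summable_on UNIV"
proof (rule summable_on_int)
  have s: "summable (\<lambda>n. 1 / (real (Suc n))\<^sup>2)"
    using inverse_power_summable[of 2, where 'a = real] by (subst summable_Suc_iff) (simp add: inverse_eq_divide)
  have "summable (\<lambda>n. 1 / (1 + (real n)\<^sup>2))"
  proof (rule summable_comparison_test'[of "\<lambda>n. 2 * (1 / (real (Suc n))\<^sup>2)" 0])
    show "norm (1 / (1 + (real n)\<^sup>2)) \<le> 2 * (1 / (real (Suc n))\<^sup>2)" for n
    proof -
      have "(real (Suc n))\<^sup>2 \<le> 2 * (1 + (real n)\<^sup>2)"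
        using zero_le_power2[of "real n - 1"] by (simp add: power2_eq_square algebra_simps)
      moreover have "1 + (real n)\<^sup>2 > 0" by (simp add: add_pos_nonneg)
      ultimately show ?thesis by (simp add: divide_simps del: of_nat_Suc)
    qed
  qed (intro summable_mult s)
  then show "(\<lambda>n. 1 / (1 + (real_of_int (int n))\<^sup>2)) summable_on UNIV"
    by (intro summable_nonneg_imp_summable_on) auto
  have "summable (\<lambda>n. 1 / (1 + (real (Suc n))\<^sup>2))"
    by (rule summable_comparison_test'[OF s, of 0]) (simp add: frac_le)
  moreover have "1 + (real (Suc n))\<^sup>2 = 1 + (real_of_int (- int n - 1))\<^sup>2" for n
    by (simp add: power2_eq_square algebra_simps)
  ultimately show "(\<lambda>n. 1 / (1 + (real_of_int (- int n - 1))\<^sup>2)) summable_on UNIV"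
    by (intro summable_nonneg_imp_summable_on) (simp_all del: of_nat_Suc)
qed

text \<open>In product form, so that summability over pairs reduces to a sum over one
  integer.\<close>

definition eis_majorant :: "int \<times> int \<Rightarrow> real" where
  "eis_majorant p = 1 / ((1 + (of_int (fst p))\<^sup>2) * (1 + (of_int (snd p))\<^sup>2))"

lemma summable_eis_majorant: "eis_majorant summable_on X"
proof -
  have a: "(\<lambda>n::int. norm (complex_of_real (1 / (1 + (of_int n)\<^sup>2)))) summable_on UNIV"
    unfolding norm_of_real using summable_on_inverse_square_int by (simp add: abs_of_nonneg)
  have "eis_majorant = (\<lambda>p. norm (complex_of_real (1 / (1 + (of_int (fst p))\<^sup>2)) * complex_of_real (1 / (1 + (of_int (snd p))\<^sup>2))))"
    unfolding norm_mult norm_of_real by (auto simp: eis_majorant_def fun_eq_iff abs_of_nonneg)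
  then have "eis_majorant summable_on UNIV" using abs_summable_on_Times[OF a a] by simp
  then show ?thesis by (rule summable_on_subset_banach) simp
qed

lemma eisenstein_term_bound:
  assumes "\<bar>Re \<tau>\<bar> \<le> B" "Im \<tau> \<ge> y" "0 < y" "y \<le> 1" and k: "k \<ge> 2" and mn: "(m, n) \<noteq> (0, 0)"
  shows "norm (1 / (of_int m + of_int n * \<tau>) ^ (2 * k)) \<le> 4 * ((2 + 2 * B\<^sup>2) / y\<^sup>2) ^ k * eis_majorant (m, n)"
proof -
  define c where "c = y\<^sup>2 / (2 + 2 * B\<^sup>2)"
  define S where "S = real_of_int (m\<^sup>2 + n\<^sup>2)"
  have c: "c > 0" using assms by (simp add: c_def add_pos_nonneg)
  have "m\<^sup>2 + n\<^sup>2 \<noteq> 0" using mn by (simp add: sum_power2_eq_zero_iff)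
  then have "m\<^sup>2 + n\<^sup>2 \<ge> 1" using sum_power2_ge_zero[of m n] by linarith
  then have "real_of_int 1 \<le> real_of_int (m\<^sup>2 + n\<^sup>2)" by (simp only: of_int_le_iff)
  then have S: "S \<ge> 1" by (simp only: S_def of_int_1)
  \<comment> \<open>Away from the origin S \<ge> 1, so each factor 1 + m^2, 1 + n^2 is at most 2 S
    and their product at most 4 S^2. Here weight at least 4 enters: S^2 \<le> S^k.\<close>
  have "1 + (of_int m)\<^sup>2 \<le> 2 * S" "1 + (of_int n)\<^sup>2 \<le> 2 * S"
  proof -
    have "S = (of_int m)\<^sup>2 + (of_int n)\<^sup>2" by (simp add: S_def)
    then show "1 + (of_int m)\<^sup>2 \<le> 2 * S" "1 + (of_int n)\<^sup>2 \<le> 2 * S"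
      using S zero_le_power2[of "real_of_int m"] zero_le_power2[of "real_of_int n"] by linarith+
  qed
  then have "(1 + (of_int m)\<^sup>2) * (1 + (of_int n)\<^sup>2) \<le> (2 * S) * (2 * S)"
    using S by (intro mult_mono) (auto simp: add_nonneg_nonneg)
  also have "\<dots> = 4 * S ^ 2" by (simp add: power2_eq_square)
  also have "\<dots> \<le> 4 * S ^ k" using S k by (intro mult_left_mono power_increasing) auto
  finally have A: "(1 + (of_int m)\<^sup>2) * (1 + (of_int n)\<^sup>2) \<le> 4 * S ^ k" .
  have pos: "(1 + (of_int m)\<^sup>2) * (1 + (of_int n)\<^sup>2) > (0::real)" by (simp add: add_pos_nonneg)
  have "c * S \<le> (cmod (of_int m + of_int n * \<tau>))\<^sup>2"
    using norm_lattice_point_ge[OF assms(1-4), of m n] by (simp add: c_def S_def)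
  then have "(c * S) ^ k \<le> ((cmod (of_int m + of_int n * \<tau>))\<^sup>2) ^ k"
    using c S by (intro power_mono) auto
  then have 1: "c ^ k * S ^ k \<le> norm ((of_int m + of_int n * \<tau>) ^ (2 * k))"
    by (simp add: power_mult_distrib norm_power power_mult)
  have cS: "c ^ k * S ^ k > 0" using c S by simp
  have "norm (1 / (of_int m + of_int n * \<tau>) ^ (2 * k)) \<le> 1 / (c ^ k * S ^ k)"
    unfolding norm_divide norm_one by (rule divide_left_mono[OF 1]) (use cS 1 in \<open>auto intro!: mult_pos_pos less_le_trans[OF cS 1] simp del: norm_power\<close>)
  also have "\<dots> = 4 * (1 / c ^ k) * (1 / (4 * S ^ k))" using c S by simp
  also have "\<dots> \<le> 4 * (1 / c ^ k) * eis_majorant (m, n)"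
    unfolding eis_majorant_def fst_conv snd_conv using A pos c
    by (intro mult_left_mono divide_left_mono) (auto intro!: mult_pos_pos simp: S_def order_less_le_trans[OF pos A])
  also have "1 / c ^ k = ((2 + 2 * B\<^sup>2) / y\<^sup>2) ^ k" by (simp add: c_def power_divide)
  finally show ?thesis .
qed

lemma holomorphic_eisenstein:
  assumes k: "k \<ge> 2"
  shows "eisenstein (2 * k) holomorphic_on upper_half_plane"
  unfolding eisenstein_def[abs_def]
proof (rule holomorphic_on_infsum[OF open_upper_half_plane])
  fix p assume p: "p \<in> UNIV - {(0::int, 0::int)}"
  then show "(\<lambda>t. case p of (m, n) \<Rightarrow> 1 / (of_int m + of_int n * t) ^ (2 * k)) holomorphic_on upper_half_plane"
    using lattice_point_nonzero by (cases p) (auto intro!: holomorphic_intros)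
next
  fix z :: complex assume z: "z \<in> upper_half_plane"
  define y B where "y = min 1 (Im z / 2)" and "B = \<bar>Re z\<bar> + Im z / 2"
  have y: "0 < y" "y \<le> 1" using z by (auto simp: y_def)
  have "norm (case p of (m, n) \<Rightarrow> 1 / (of_int m + of_int n * t) ^ (2 * k)) \<le> 4 * ((2 + 2 * B\<^sup>2) / y\<^sup>2) ^ k * eis_majorant p"
    if t: "t \<in> cball z (Im z / 2)" and p: "p \<in> UNIV - {(0, 0)}" for t p
  proof -
    obtain m n where mn: "p = (m, n)" by (cases p)
    have "Im t \<ge> y" using Im_in_cball_half[OF t] by (simp add: y_def)
    moreover have "\<bar>Re t\<bar> \<le> B"
      using t abs_Re_le_cmod[of "z - t"] by (simp add: B_def dist_norm)
    ultimately show ?thesis using eisenstein_term_bound[of t B y k m n] y k p by (simp add: mn)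
  qed
  then show "\<exists>r>0. \<exists>M. M summable_on UNIV - {(0, 0)} \<and> (\<forall>t\<in>cball z r. \<forall>p\<in>UNIV - {(0, 0)}.
      norm (case p of (m, n) \<Rightarrow> 1 / (of_int m + of_int n * t) ^ (2 * k)) \<le> M p)"
    using z by (intro exI[of _ "Im z / 2"] conjI exI[of _ "\<lambda>p. 4 * ((2 + 2 * B\<^sup>2) / y\<^sup>2) ^ k * eis_majorant p"]
        summable_on_cmult_right summable_eis_majorant) auto
qed

lemma eisenstein_add_1: "eisenstein k (\<tau> + 1) = eisenstein k \<tau>"
proof -
  have b: "bij_betw (\<lambda>(m::int, n::int). (m - n, n)) (UNIV - {(0, 0)}) (UNIV - {(0, 0)})"
    by (rule bij_betwI[of _ _ _ "\<lambda>(m, n). (m + n, n)"]) auto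
  show ?thesis unfolding eisenstein_def
    by (subst infsum_reindex_bij_betw[OF b, symmetric], rule infsum_cong) (auto simp: algebra_simps)
qed

lemma eisenstein_neg_inverse:
  assumes \<tau>: "Im \<tau> > 0"
  shows "eisenstein (2 * k) (-1 / \<tau>) = \<tau> ^ (2 * k) * eisenstein (2 * k) \<tau>"
proof -
  have \<tau>0: "\<tau> \<noteq> 0" using \<tau> by auto
  have b: "bij_betw (\<lambda>(m::int, n::int). (n, - m)) (UNIV - {(0, 0)}) (UNIV - {(0, 0)})"
    by (rule bij_betwI[of _ _ _ "\<lambda>(m, n). (- n, m)"]) auto
  define g where "g = (\<lambda>(m::int, n::int). 1 / (of_int m + of_int n * (-1 / \<tau>)) ^ (2 * k))"
  have g: "g (case p of (m, n) \<Rightarrow> (n, - m)) = (case p of (m, n) \<Rightarrow> \<tau> ^ (2 * k) * (1 / (of_int m + of_int n * \<tau>) ^ (2 * k)))" for p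
  proof (cases p)
    case (Pair m n)
    have "of_int n + of_int (- m) * (-1 / \<tau>) = (of_int m + of_int n * \<tau>) / \<tau>" using \<tau>0 by (simp add: field_simps)
    then show ?thesis by (simp only: g_def Pair prod.case power_divide) simp
  qed
  have "eisenstein (2 * k) (-1 / \<tau>) = infsum g (UNIV - {(0, 0)})" by (simp add: eisenstein_def g_def)
  also have "\<dots> = (\<Sum>\<^sub>\<infinity>p\<in>UNIV - {(0,0)}. g (case p of (m, n) \<Rightarrow> (n, - m)))"
    by (rule infsum_reindex_bij_betw[OF b, symmetric])
  finally have "eisenstein (2 * k) (-1 / \<tau>) = (\<Sum>\<^sub>\<infinity>(m,n)\<in>UNIV - {(0::int,0::int)}. \<tau> ^ (2 * k) * (1 / (of_int m + of_int n * \<tau>) ^ (2 * k)))"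
    by (simp only: g)
  then show ?thesis unfolding eisenstein_def case_prod_unfold by (simp only: infsum_cmult_right')
qed

text \<open>Terms with n \<noteq> 0 tend to 0 and those with n = 0 add up to twice the zeta value.
  The restriction to a strip is due to the majorant, which requires a bounded real part.\<close>

lemma tendsto_eisenstein_strip:
  assumes k: "k \<ge> 2" and s: "(\<lambda>j. 1 / real (Suc j) ^ (2 * k)) sums s"
  shows "(eisenstein (2 * k) \<longlongrightarrow> of_real (2 * s)) (inf (filtercomap Im at_top) (principal {t. \<bar>Re t\<bar> \<le> 1}))"
proof -
  let ?F = "inf (filtercomap Im at_top) (principal {t. \<bar>Re t\<bar> \<le> 1})"
  define M where "M = (\<lambda>p. 4 * ((2 + 2 * 1\<^sup>2) / 1\<^sup>2) ^ k * eis_majorant p)"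
  have ev: "\<forall>\<^sub>F t in ?F. \<bar>Re t\<bar> \<le> 1 \<and> Im t \<ge> 1"
    using eventually_Im_ge[of 1] by (auto simp: eventually_inf_principal elim: eventually_mono)
  have nb: "?F \<noteq> bot"
  proof
    assume "?F = bot"
    then have "eventually (\<lambda>t. \<not> \<bar>Re t\<bar> \<le> 1) (filtercomap Im at_top)"
      by (metis (mono_tags, lifting) eventually_inf_principal eventually_bot mem_Collect_eq eventually_mono)
    then obtain y0 where "\<And>t. Im t \<ge> y0 \<Longrightarrow> \<not> \<bar>Re t\<bar> \<le> 1"
      by (auto simp: eventually_filtercomap eventually_at_top_linorder)
    from this[of "Complex 0 y0"] show False by simp
  qed
  have "((\<lambda>t. \<Sum>\<^sub>\<infinity>p\<in>UNIV - {(0::int,0::int)}. case p of (m, n) \<Rightarrow> 1 / (of_int m + of_int n * t) ^ (2 * k)) \<longlongrightarrow>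
      (\<Sum>\<^sub>\<infinity>p\<in>UNIV - {(0::int,0::int)}. if snd p = 0 then 1 / of_int (fst p) ^ (2 * k) else 0)) ?F"
  proof (rule tendsto_infsum_dominated)
    show "M summable_on UNIV - {(0, 0)}" unfolding M_def by (intro summable_on_cmult_right summable_eis_majorant)
    show "\<forall>\<^sub>F t in ?F. \<forall>p\<in>UNIV - {(0, 0)}. norm (case p of (m, n) \<Rightarrow> 1 / (of_int m + of_int n * t) ^ (2 * k)) \<le> M p"
      using ev
    proof eventually_elim
      case (elim t)
      show ?case
      proof
        fix p assume p: "p \<in> UNIV - {(0::int, 0::int)}"
        then show "norm (case p of (m, n) \<Rightarrow> 1 / (of_int m + of_int n * t) ^ (2 * k)) \<le> M p"
          using eisenstein_term_bound[of t 1 1 k "fst p" "snd p"] elim k by (cases p) (simp add: M_def)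
      qed
    qed
    fix p assume p: "p \<in> UNIV - {(0::int, 0::int)}"
    obtain m n where mn: "p = (m, n)" by (cases p)
    show "((\<lambda>t. case p of (m, n) \<Rightarrow> 1 / (of_int m + of_int n * t) ^ (2 * k)) \<longlongrightarrow> (if snd p = 0 then 1 / of_int (fst p) ^ (2 * k) else 0)) ?F"
    proof (cases "n = 0")
      case False
      have "filterlim (\<lambda>t. Im t) at_top ?F"
        by (rule filterlim_mono[OF filterlim_filtercomap[of Im]]) auto
      then have lim: "((\<lambda>t. 1 / (Im t) ^ (2 * k)) \<longlongrightarrow> 0) ?F"
        using k by (intro tendsto_divide_0[OF tendsto_const] filterlim_at_top_imp_at_infinity filterlim_pow_at_top) auto
      have "((\<lambda>t. 1 / (of_int m + of_int n * t) ^ (2 * k)) \<longlongrightarrow> 0) ?F"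
      proof (rule Lim_null_comparison[OF _ lim])
        show "\<forall>\<^sub>F t in ?F. norm (1 / (of_int m + of_int n * t) ^ (2 * k)) \<le> 1 / (Im t) ^ (2 * k)"
          using ev
        proof eventually_elim
          case (elim t)
          have "\<bar>of_int n * Im t\<bar> \<le> cmod (of_int m + of_int n * t)" using abs_Im_le_cmod[of "of_int m + of_int n * t"] by simp
          moreover have "1 * Im t \<le> \<bar>of_int n\<bar> * \<bar>Im t\<bar>" using elim False by (intro mult_mono) auto
          ultimately have "Im t \<le> cmod (of_int m + of_int n * t)" by (simp add: abs_mult)
          then have "Im t ^ (2 * k) \<le> cmod (of_int m + of_int n * t) ^ (2 * k)" using elim by (intro power_mono) auto
          moreover have "Im t ^ (2 * k) > 0" using elim by (intro zero_less_power) auto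
          ultimately show ?case by (auto simp: norm_divide norm_power intro!: divide_left_mono mult_pos_pos)
        qed
      qed
      then show ?thesis using False by (simp add: mn)
    qed (simp add: mn)
  qed (use nb in auto)
  also have "(\<Sum>\<^sub>\<infinity>p\<in>UNIV - {(0::int,0::int)}. if snd p = 0 then 1 / of_int (fst p) ^ (2 * k) else (0::complex)) = of_real (2 * s)"
  proof -
    have inj: "inj_on (\<lambda>m::int. (m, 0::int)) (UNIV - {0})" by (auto simp: inj_on_def)
    have "(\<Sum>\<^sub>\<infinity>p\<in>UNIV - {(0::int,0::int)}. if snd p = 0 then 1 / of_int (fst p) ^ (2 * k) else (0::complex)) =
       (\<Sum>\<^sub>\<infinity>p\<in>(\<lambda>m::int. (m, 0::int)) ` (UNIV - {0}). 1 / of_int (fst p) ^ (2 * k))"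
      by (rule infsum_cong_neutral) auto
    also have "\<dots> = (\<Sum>\<^sub>\<infinity>m\<in>UNIV - {0::int}. 1 / of_int m ^ (2 * k))"
      by (subst infsum_reindex[OF inj]) (simp add: o_def)
    \<comment> \<open>The index m = 0 may be added because division by 0 yields 0.\<close>
    also have "\<dots> = (\<Sum>\<^sub>\<infinity>m\<in>UNIV. 1 / of_int m ^ (2 * k))"
      using k by (intro infsum_cong_neutral) auto
    also have "\<dots> = of_real s + of_real s"
    proof -
      have hs: "((\<lambda>j. 1 / real (Suc j) ^ (2 * k)) has_sum s) UNIV"
        using s by (intro sums_nonneg_imp_has_sum) auto
      have hc: "((\<lambda>j. 1 / of_nat (Suc j) ^ (2 * k)) has_sum complex_of_real s) UNIV"
        using has_sum_of_real[OF hs, where 'a = complex] by simp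
      have c2: "((\<lambda>j. 1 / of_int (- int j - 1) ^ (2 * k)) has_sum complex_of_real s) UNIV"
      proof -
        have "of_int (- int j - 1) ^ (2 * k) = (of_nat (Suc j) :: complex) ^ (2 * k)" for j
        proof -
          have "of_int (- int j - 1) = - (of_nat (Suc j) :: complex)" by simp
          then show ?thesis by (simp only: power_mult power2_minus)
        qed
        then show ?thesis using hc by simp
      qed
      have c1: "((\<lambda>j. 1 / of_int (int j) ^ (2 * k)) has_sum complex_of_real s) UNIV"
      proof -
        have "((\<lambda>j. 1 / of_nat j ^ (2 * k)) has_sum complex_of_real s) (Suc ` UNIV)"
          using hc by (subst has_sum_reindex) (auto simp: o_def)
        moreover have "((\<lambda>j. 1 / of_nat j ^ (2 * k)) has_sum complex_of_real s) (range Suc) \<longleftrightarrow>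
            ((\<lambda>j. 1 / of_nat j ^ (2 * k)) has_sum complex_of_real s) UNIV"
        proof (rule has_sum_cong_neutral)
          fix j :: nat assume "j \<in> UNIV - range Suc"
          then have "j = 0" by (cases j) auto
          then show "1 / of_nat j ^ (2 * k) = (0::complex)" using k by simp
        qed auto
        ultimately have "((\<lambda>j. 1 / of_nat j ^ (2 * k)) has_sum complex_of_real s) UNIV" by blast
        then show ?thesis by simp
      qed
      show ?thesis
        using infsum_int[of "\<lambda>m. 1 / of_int m ^ (2 * k) :: complex"] c1 c2
        by (simp add: has_sum_imp_summable infsumI)
    qed
    finally show ?thesis by simp
  qed
  finally show ?thesis by (simp add: eisenstein_def[abs_def])
qed

lemma periodic_shift_int:
  assumes "\<And>t. f (t + 1) = f (t::complex)"
  shows "f (t + of_int n) = f t"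
proof (induction n rule: int_induct[where k = 0])
  case (step1 i)
  then show ?case using assms[of "t + of_int i"] by (simp add: add.assoc)
next
  case (step2 i)
  then show ?case using assms[of "t + of_int (i - 1)"] by (simp add: add.assoc)
qed simp

text \<open>An integer translation moves any point into the strip and changes neither its imaginary
  part nor the value.\<close>

lemma tendsto_eisenstein:
  assumes k: "k \<ge> 2" and s: "(\<lambda>j. 1 / real (Suc j) ^ (2 * k)) sums s"
  shows "(eisenstein (2 * k) \<longlongrightarrow> of_real (2 * s)) (filtercomap Im at_top)"
proof (rule tendstoI)
  fix e :: real assume "e > 0"
  from tendstoD[OF tendsto_eisenstein_strip[OF k s] this]
  have "\<forall>\<^sub>F t in filtercomap Im at_top. \<bar>Re t\<bar> \<le> 1 \<longrightarrow> dist (eisenstein (2 * k) t) (of_real (2 * s)) < e"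
    by (simp add: eventually_inf_principal)
  then obtain y0 where y0: "\<And>t. Im t \<ge> y0 \<Longrightarrow> \<bar>Re t\<bar> \<le> 1 \<Longrightarrow> dist (eisenstein (2 * k) t) (of_real (2 * s)) < e"
    by (auto simp: eventually_filtercomap eventually_at_top_linorder)
  have "dist (eisenstein (2 * k) t) (of_real (2 * s)) < e" if "Im t \<ge> y0" for t
  proof -
    define u where "u = t + of_int (- \<lfloor>Re t\<rfloor>)"
    have "Re t - of_int \<lfloor>Re t\<rfloor> \<ge> 0" "Re t - of_int \<lfloor>Re t\<rfloor> \<le> 1" by linarith+
    then have "Im u \<ge> y0" "\<bar>Re u\<bar> \<le> 1" using that by (simp_all add: u_def)
    from y0[OF this] show ?thesis
      unfolding u_def periodic_shift_int[of "eisenstein (2 * k)", OF eisenstein_add_1] .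
  qed
  then show "\<forall>\<^sub>F t in filtercomap Im at_top. dist (eisenstein (2 * k) t) (of_real (2 * s)) < e"
    using eventually_Im_ge[of y0] by (auto elim: eventually_mono)
qed

section \<open>Modular functions and the discriminant\<close>

text \<open>With the height 1/2 instead of the optimal sqrt(3)/2, a point below it has |t|^2 \<le>
  1/2 after translation, so each inversion at least doubles Im t and induction on the number of
  doublings suffices.\<close>

lemma reduce_to_strip:
  fixes g :: "complex \<Rightarrow> complex"
  assumes T: "\<And>t. g (t + 1) = g t" and S: "\<And>t. Im t > 0 \<Longrightarrow> g (-1 / t) = g t"
    and \<tau>: "Im \<tau> > 0"
  shows "\<exists>t. \<bar>Re t\<bar> \<le> 1/2 \<and> Im t \<ge> 1/2 \<and> g t = g \<tau>"
proof -
  have "\<exists>t. \<bar>Re t\<bar> \<le> 1/2 \<and> Im t \<ge> 1/2 \<and> g t = g \<tau>" if "Im \<tau> > 0" "Im \<tau> * 2 ^ N \<ge> 1/2" for N \<tau>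
    using that
  proof (induction N arbitrary: \<tau>)
    case 0
    define t where "t = \<tau> + of_int (- round (Re \<tau>))"
    have "g t = g \<tau>" unfolding t_def by (rule periodic_shift_int[of g, OF T])
    moreover have "\<bar>Re t\<bar> \<le> 1/2" using of_int_round_abs_le[of "Re \<tau>"] by (simp add: t_def abs_minus_commute)
    ultimately show ?case using 0 by (intro exI[of _ t]) (simp add: t_def)
  next
    case (Suc N)
    define t where "t = \<tau> + of_int (- round (Re \<tau>))"
    have gt: "g t = g \<tau>" unfolding t_def by (rule periodic_shift_int[of g, OF T])
    have re: "\<bar>Re t\<bar> \<le> 1/2" using of_int_round_abs_le[of "Re \<tau>"] by (simp add: t_def abs_minus_commute)
    have im: "Im t = Im \<tau>" by (simp add: t_def)
    show ?case
    proof (cases "Im t \<ge> 1/2")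
      case True
      then show ?thesis using gt re by blast
    next
      case False
      have "(Re t)\<^sup>2 \<le> (1/2)\<^sup>2" using re by (metis abs_ge_zero power2_abs power_mono)
      moreover have "(Im t)\<^sup>2 \<le> (1/2)\<^sup>2" using False Suc.prems im by (intro power_mono) auto
      ultimately have "(cmod t)\<^sup>2 \<le> 1/2" unfolding cmod_power2 by (simp add: power2_eq_square)
      moreover have "(cmod t)\<^sup>2 > 0" using Suc.prems im by auto
      ultimately have "Im t * 2 \<le> Im (-1 / t)"
        unfolding Im_neg_inverse using Suc.prems im by (simp add: field_simps)
      then have "Im \<tau> * 2 * 2 ^ N \<le> Im (-1 / t) * 2 ^ N" using im by (intro mult_right_mono) auto
      then have "Im (-1 / t) * 2 ^ N \<ge> 1/2" using Suc.prems by (simp add: mult.assoc)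
      moreover have "Im (-1 / t) > 0" using Suc.prems im by (intro Im_neg_inverse_pos) simp
      ultimately obtain t' where "\<bar>Re t'\<bar> \<le> 1/2" "Im t' \<ge> 1/2" "g t' = g (-1 / t)" using Suc.IH by blast
      moreover have "g (-1 / t) = g \<tau>" using S[of t] gt im Suc.prems by simp
      ultimately show ?thesis by auto
    qed
  qed
  moreover obtain N where "1/2 / Im \<tau> < 2 ^ N" using real_arch_pow[of 2 "1/2 / Im \<tau>"] by auto
  moreover from this have "Im \<tau> * 2 ^ N \<ge> 1/2" using \<tau> by (simp add: field_simps)
  ultimately show ?thesis using \<tau> by blast
qed

text \<open>Above some height |g| is smaller than |g(\<tau>)|, so by invariance it attains its
  maximum over the half-plane in a compact rectangle. The maximum principle makes g constant, and
  the constant is the limit 0.\<close>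

theorem modular_function_vanishing_at_cusp:
  assumes hol: "g holomorphic_on upper_half_plane"
    and T: "\<And>t. g (t + 1) = g t" and S: "\<And>t. Im t > 0 \<Longrightarrow> g (-1 / t) = g t"
    and lim: "(g \<longlongrightarrow> 0) (filtercomap Im at_top)" and \<tau>: "Im \<tau> > 0"
  shows "g \<tau> = 0"
proof (rule ccontr)
  assume nz: "g \<tau> \<noteq> 0"
  then have "\<forall>\<^sub>F t in filtercomap Im at_top. dist (g t) 0 < cmod (g \<tau>)" by (intro tendstoD[OF lim]) simp
  then obtain Y where Y: "\<And>t. Im t \<ge> Y \<Longrightarrow> cmod (g t) < cmod (g \<tau>)"
    by (auto simp: eventually_filtercomap eventually_at_top_linorder)
  define K where "K = cbox (Complex (-1/2) (1/2)) (Complex (1/2) (max Y 1))"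
  have inK: "t \<in> K" if "\<bar>Re t\<bar> \<le> 1/2" "Im t \<ge> 1/2" "Im t \<le> max Y 1" for t
    using that by (auto simp: K_def in_cbox_complex_iff abs_le_iff)
  have KH: "K \<subseteq> upper_half_plane" by (auto simp: K_def in_cbox_complex_iff)
  obtain t0 where t0: "\<bar>Re t0\<bar> \<le> 1/2" "Im t0 \<ge> 1/2" "g t0 = g \<tau>" using reduce_to_strip[of g, OF T S \<tau>] by blast
  have "\<not> Im t0 \<ge> Y" using t0(3) Y[of t0] by auto
  then have t0K: "t0 \<in> K" using t0 by (intro inK) auto
  have "continuous_on K (\<lambda>t. cmod (g t))"
    using holomorphic_on_imp_continuous_on[OF hol] KH continuous_on_subset by (intro continuous_on_norm) blast
  then obtain z where z: "z \<in> K" "\<And>t. t \<in> K \<Longrightarrow> cmod (g t) \<le> cmod (g z)"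
    using continuous_attains_sup[of K "\<lambda>t. cmod (g t)"] t0K by (auto simp: K_def)
  have big: "cmod (g \<tau>) \<le> cmod (g z)" using z(2)[OF t0K] t0 by simp
  have max: "cmod (g t) \<le> cmod (g z)" if "t \<in> upper_half_plane" for t
  proof -
    have "Im t > 0" using that by simp
    from reduce_to_strip[of g, OF T S this]
    obtain t' where t': "\<bar>Re t'\<bar> \<le> 1/2" "Im t' \<ge> 1/2" "g t' = g t" by auto
    show ?thesis
    proof (cases "Im t' \<le> max Y 1")
      case True
      then show ?thesis using z(2)[OF inK[OF t'(1,2)]] t' by simp
    next
      case False
      then have "Im t' \<ge> Y" by simp
      then show ?thesis using Y[of t'] t' big by simp
    qed
  qed
  have "g constant_on upper_half_plane"
    by (rule maximum_modulus_principle[OF hol, of upper_half_plane z])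
       (use open_upper_half_plane connected_upper_half_plane KH z max in auto)
  then obtain c where c: "\<And>t. Im t > 0 \<Longrightarrow> g t = c" by (auto simp: constant_on_def)
  have "\<forall>\<^sub>F t in filtercomap Im at_top. g t = c"
    using eventually_Im_ge[of 1] by eventually_elim (auto intro: c)
  from Lim_transform_eventually[OF lim this]
  have "((\<lambda>t. c) \<longlongrightarrow> 0) (filtercomap Im at_top)" .
  then have "c = 0" by (simp add: tendsto_const_iff)
  then show False using c[OF \<tau>] nz by simp
qed

lemma periodic_eq_of_exp_eq:
  fixes f :: "complex \<Rightarrow> complex"
  assumes T: "\<And>t. f (t + 1) = f t" and e: "exp (2 * pi * \<i> * a) = exp (2 * pi * \<i> * b)"
  shows "f a = f b"
proof -
  obtain n :: int where "2 * pi * \<i> * a = 2 * pi * \<i> * b + of_int (2 * n) * pi * \<i>"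
    using e unfolding exp_eq by auto
  then have "2 * pi * \<i> * a = 2 * pi * \<i> * (b + of_int n)" by (simp add: algebra_simps)
  then have "a = b + of_int n" by simp
  then show ?thesis using periodic_shift_int[of f, OF T] by simp
qed

text \<open>In the variable \<open>q = exp (2 \<pi> i t)\<close> the singularity at 0 is removable and \<open>f\<close> vanishes there.\<close>
lemma periodic_vanishing_imp_exp_decay:
  assumes hol: "f holomorphic_on upper_half_plane" and T: "\<And>t. f (t + 1) = f t"
    and lim: "(f \<longlongrightarrow> 0) (filtercomap Im at_top)"
  shows "\<exists>D. ((\<lambda>t. f t / exp (2 * pi * \<i> * t)) \<longlongrightarrow> D) (filtercomap Im at_top)"
proof -
  define s where "s = (\<lambda>q. Ln q / (2 * pi * \<i>))"
  define h where "h = (\<lambda>q. if q = 0 then 0 else f (s q))"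
  have exps: "exp (2 * pi * \<i> * s q) = q" if "q \<noteq> 0" for q using that by (simp add: s_def)
  have Ims: "Im (s q) = - ln (cmod q) / (2 * pi)" if "q \<noteq> 0" for q
    using that by (simp add: s_def Im_divide power2_eq_square)
  have Ims_pos: "Im (s q) > 0" if "q \<noteq> 0" "cmod q < 1" for q
    unfolding Ims[OF that(1)] using that by (simp add: divide_neg_pos)
  \<comment> \<open>Taking the logarithm of -q moves the cut to the positive axis, and the shift by
    1/2 compensates for the sign. The two slit discs \<open>A\<close> and \<open>B\<close> together
    cover the punctured disc.\<close>
  have h_eq: "h q = f (s (- q) + 1/2)" if "q \<noteq> 0" for q
  proof -
    have "exp (2 * pi * \<i> * (s (- q) + 1/2)) = exp (2 * pi * \<i> * s (- q)) * exp (pi * \<i>)"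
      unfolding exp_add[symmetric] by (rule arg_cong[of _ _ exp]) (simp add: algebra_simps)
    also have "\<dots> = q" using exps[of "- q"] that by simp
    finally have "exp (2 * pi * \<i> * s q) = exp (2 * pi * \<i> * (s (- q) + 1/2))" using exps[OF that] by simp
    from periodic_eq_of_exp_eq[of f, OF T this] show ?thesis using that by (simp add: h_def)
  qed
  define A B where "A = (ball 0 1 - {0::complex}) - \<real>\<^sub>\<le>\<^sub>0" and "B = (ball 0 1 - {0::complex}) - \<real>\<^sub>\<ge>\<^sub>0"
  have oA: "open A" and oB: "open B" unfolding A_def B_def by (intro open_Diff; auto)+
  have AB: "A \<union> B = ball 0 1 - {0}"
    by (auto simp: A_def B_def complex_nonpos_Reals_iff complex_nonneg_Reals_iff complex_eq_iff)
  have hA: "h holomorphic_on A"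
  proof -
    have "f \<circ> s holomorphic_on A"
    proof (rule holomorphic_on_compose_gen[OF _ hol])
      show "s holomorphic_on A" unfolding s_def A_def by (intro holomorphic_intros) auto
      show "s ` A \<subseteq> upper_half_plane" using Ims_pos by (auto simp: A_def)
    qed
    then show ?thesis by (rule holomorphic_transform) (auto simp: h_def A_def)
  qed
  have hB: "h holomorphic_on B"
  proof -
    have "f \<circ> (\<lambda>q. s (- q) + 1/2) holomorphic_on B"
    proof (rule holomorphic_on_compose_gen[OF _ hol])
      show "(\<lambda>q. s (- q) + 1/2) holomorphic_on B" unfolding s_def B_def
        by (intro holomorphic_intros) (auto simp: complex_nonpos_Reals_iff complex_nonneg_Reals_iff)
      show "(\<lambda>q. s (- q) + 1/2) ` B \<subseteq> upper_half_plane" using Ims_pos[of "- q" for q] by (auto simp: B_def)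
    qed
    then show ?thesis by (rule holomorphic_transform) (auto simp: h_eq B_def)
  qed
  have hol0: "h holomorphic_on ball 0 1 - {0}"
    using holomorphic_on_Un[OF hA hB oA oB] by (simp add: AB)
  have "(h \<longlongrightarrow> 0) (at 0)"
  proof -
    have "filterlim (\<lambda>q. - ln (cmod q) / (2 * pi)) at_top (at (0::complex))"
    proof -
      have "filterlim (\<lambda>x::real. - ln x / (2 * pi)) at_top (at_right 0)" by real_asymp
      moreover have "filterlim cmod (at_right 0) (at (0::complex))"
        by (auto simp: filterlim_at tendsto_norm_zero eventually_at_filter)
      ultimately show ?thesis by (rule filterlim_compose)
    qed
    moreover have "\<forall>\<^sub>F q in at (0::complex). - ln (cmod q) / (2 * pi) = Im (s q)"
      using Ims by (auto simp: eventually_at_filter)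
    ultimately have "filterlim (\<lambda>q. Im (s q)) at_top (at 0)" using filterlim_cong by fastforce
    then have "filterlim s (filtercomap Im at_top) (at 0)" by (simp add: filterlim_filtercomap_iff o_def)
    from filterlim_compose[OF lim this] have "((\<lambda>q. f (s q)) \<longlongrightarrow> 0) (at 0)" .
    then show ?thesis by (rule Lim_transform_eventually) (auto simp: eventually_at_filter h_def)
  qed
  then have "isCont h 0" by (simp add: isCont_def h_def)
  then have "continuous_on (ball 0 1) h"
    using holomorphic_on_imp_continuous_on[OF hol0]
    by (metis (no_types, lifting) Diff_iff continuous_at_imp_continuous_at_within continuous_on_eq_continuous_at continuous_on_eq_continuous_within open_ball open_delete singletonD)
  then have "h holomorphic_on ball 0 1"
    by (rule no_isolated_singularity[OF _ hol0]) auto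
  then obtain D where "(h has_field_derivative D) (at 0)"
    using holomorphic_on_imp_differentiable_at[of h "ball 0 1" 0] by (auto simp: field_differentiable_def)
  then have D: "((\<lambda>q. h q / q) \<longlongrightarrow> D) (at 0)" by (simp add: has_field_derivative_iff h_def)
  have "filterlim (\<lambda>t. exp (2 * pi * \<i> * t)) (at 0) (filtercomap Im at_top)"
    using tendsto_exp_Im_at_top[of "2 * pi"] by (auto simp: filterlim_at mult_ac)
  from filterlim_compose[OF D this]
  have "((\<lambda>t. h (exp (2 * pi * \<i> * t)) / exp (2 * pi * \<i> * t)) \<longlongrightarrow> D) (filtercomap Im at_top)" .
  moreover have "h (exp (2 * pi * \<i> * t)) = f t" for t
  proof -
    have "exp (2 * pi * \<i> * s (exp (2 * pi * \<i> * t))) = exp (2 * pi * \<i> * t)" by (rule exps) simp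
    from periodic_eq_of_exp_eq[of f, OF T this] show ?thesis by (simp add: h_def)
  qed
  ultimately show ?thesis by auto
qed

text \<open>By \<open>theta_product_eta\<close> this is 256 times the 24th power of eta, the cusp
  form of weight 12; in this form its transformation laws follow from those of the theta
  constants.\<close>

definition theta_disc :: "complex \<Rightarrow> complex" where
  "theta_disc \<tau> = (theta2 \<tau> * theta3 \<tau> * theta4 \<tau>) ^ 8"

lemma theta_disc_add_1: "theta_disc (\<tau> + 1) = theta_disc \<tau>"
proof -
  have "theta2 (\<tau> + 1) ^ 8 = theta2 \<tau> ^ 8"
    using arg_cong[OF theta2_add_1_pow4[of \<tau>], of "\<lambda>x. x ^ 2"] by (simp flip: power_mult)
  then show ?thesis by (simp add: theta_disc_def power_mult_distrib)
qed

lemma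
  assumes "Im \<tau> > 0"
  shows theta2_inversion_pow4: "theta2 (-1 / \<tau>) ^ 4 = - (\<tau> ^ 2 * theta4 \<tau> ^ 4)"
    and theta3_inversion_pow4: "theta3 (-1 / \<tau>) ^ 4 = - (\<tau> ^ 2 * theta3 \<tau> ^ 4)"
    and theta4_inversion_pow4: "theta4 (-1 / \<tau>) ^ 4 = - (\<tau> ^ 2 * theta2 \<tau> ^ 4)"
proof -
  have e: "x ^ 4 = (x ^ 2) ^ 2" for x :: complex by (simp flip: power_mult)
  show "theta2 (-1 / \<tau>) ^ 4 = - (\<tau> ^ 2 * theta4 \<tau> ^ 4)" unfolding e theta2_inversion[OF assms] by (simp add: power_mult_distrib)
  show "theta3 (-1 / \<tau>) ^ 4 = - (\<tau> ^ 2 * theta3 \<tau> ^ 4)" unfolding e theta3_inversion[OF assms] by (simp add: power_mult_distrib)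
  show "theta4 (-1 / \<tau>) ^ 4 = - (\<tau> ^ 2 * theta2 \<tau> ^ 4)" unfolding e theta4_inversion[OF assms] by (simp add: power_mult_distrib)
qed

lemma theta_disc_neg_inverse:
  assumes "Im \<tau> > 0"
  shows "theta_disc (-1 / \<tau>) = \<tau> ^ 12 * theta_disc \<tau>"
proof -
  have d: "theta_disc t = (theta2 t ^ 4 * theta3 t ^ 4 * theta4 t ^ 4) ^ 2" for t
    by (simp add: theta_disc_def power_mult_distrib flip: power_mult)
  show ?thesis
    unfolding d theta2_inversion_pow4[OF assms] theta3_inversion_pow4[OF assms] theta4_inversion_pow4[OF assms]
    by (simp add: power_mult_distrib mult_ac flip: power_mult)
qed

lemma tendsto_theta_disc_scaled: "((\<lambda>t. theta_disc t / exp (2 * pi * \<i> * t)) \<longlongrightarrow> 256) (filtercomap Im at_top)"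
proof -
  have "((\<lambda>t. (theta2 t / exp (pi * \<i> * t / 4) * theta3 t * theta4 t) ^ 8) \<longlongrightarrow> (2 * 1 * 1) ^ 8) (filtercomap Im at_top)"
    by (intro tendsto_intros tendsto_theta2_scaled tendsto_theta3 tendsto_theta4)
  moreover have "exp (pi * \<i> * t / 4) ^ 8 = exp (2 * pi * \<i> * t)" for t
    using exp_of_nat_mult[of 8 "pi * \<i> * t / 4"] by (simp add: mult_ac)
  ultimately show ?thesis by (simp add: theta_disc_def power_mult_distrib power_divide)
qed

text \<open>There are no cusp forms of weight less than 12: a power of \<open>f\<close> divided by \<open>theta_disc\<close> has weight 0.\<close>
lemma no_small_weight_cusp_form:
  assumes hol: "f holomorphic_on upper_half_plane" and T: "\<And>t. f (t + 1) = f t"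
    and S: "\<And>t. Im t > 0 \<Longrightarrow> f (-1 / t) = t ^ k * f t"
    and lim: "(f \<longlongrightarrow> 0) (filtercomap Im at_top)"
    and k: "k * m = 12" "m \<ge> 2" and \<tau>: "Im \<tau> > 0"
  shows "f \<tau> = 0"
proof -
  define g where "g = (\<lambda>t. f t ^ m / theta_disc t)"
  have nz: "theta_disc t \<noteq> 0" if "Im t > 0" for t
    using theta2_nonzero[OF that] theta3_nonzero[OF that] theta4_nonzero[OF that] by (simp add: theta_disc_def)
  have "g \<tau> = 0"
  proof (rule modular_function_vanishing_at_cusp[OF _ _ _ _ \<tau>])
    show "g holomorphic_on upper_half_plane"
      unfolding g_def by (intro holomorphic_intros hol)
        (use nz in \<open>auto simp: theta_disc_def[abs_def] intro!: holomorphic_intros holomorphic_theta2 holomorphic_theta3 holomorphic_theta4\<close>)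
    show "g (t + 1) = g t" for t by (simp add: g_def T theta_disc_add_1)
    show "g (-1 / t) = g t" if "Im t > 0" for t
    proof -
      have "t \<noteq> 0" using that by auto
      have "(t ^ k * f t) ^ m = t ^ 12 * f t ^ m" by (simp add: power_mult_distrib flip: power_mult k(1))
      then show ?thesis using \<open>t \<noteq> 0\<close> unfolding g_def S[OF that] theta_disc_neg_inverse[OF that] by simp
    qed
    obtain D where D: "((\<lambda>t. f t / exp (2 * pi * \<i> * t)) \<longlongrightarrow> D) (filtercomap Im at_top)"
      using periodic_vanishing_imp_exp_decay[OF hol T lim] by blast
    have q: "((\<lambda>t. exp (2 * pi * \<i> * t)) \<longlongrightarrow> 0) (filtercomap Im at_top)"
      using tendsto_exp_Im_at_top[of "2 * pi"] by (simp add: mult_ac)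
    \<comment> \<open>At the cusp the numerator f^m vanishes to order at least m \<ge> 2 in q and
      \<open>theta_disc\<close> to order exactly 1, so a positive power of q is left over.\<close>
    have "((\<lambda>t. (f t / exp (2 * pi * \<i> * t)) ^ m * exp (2 * pi * \<i> * t) ^ (m - 1) / (theta_disc t / exp (2 * pi * \<i> * t))) \<longlongrightarrow>
       D ^ m * 0 ^ (m - 1) / 256) (filtercomap Im at_top)"
      by (intro tendsto_intros D q tendsto_theta_disc_scaled) auto
    moreover have "(f t / exp (2 * pi * \<i> * t)) ^ m * exp (2 * pi * \<i> * t) ^ (m - 1) / (theta_disc t / exp (2 * pi * \<i> * t)) = g t" for t
    proof -
      define Q where "Q = exp (2 * pi * \<i> * t)"
      have Q: "Q \<noteq> 0" by (simp add: Q_def)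
      have m: "Q ^ m = Q * Q ^ (m - 1)" using k(2) by (metis Suc_diff_1 less_le_trans pos2 power_Suc)
      have "(f t / Q) ^ m * Q ^ (m - 1) / (theta_disc t / Q) = f t ^ m * (Q * Q ^ (m - 1)) / (Q ^ m * theta_disc t)"
        by (simp add: power_divide field_simps)
      also have "\<dots> = g t" using Q unfolding m[symmetric] by (simp add: g_def)
      finally show ?thesis unfolding Q_def .
    qed
    ultimately show "(g \<longlongrightarrow> 0) (filtercomap Im at_top)" using k(2) by (simp add: power_0_left)
  qed
  then show ?thesis using nz[OF \<tau>] by (simp add: g_def)
qed

text \<open>The sum of eighth powers is invariant under the permutations, up to sign, of the fourth
  powers. The constant is twice zeta(4), so the difference is a cusp form of weight 4, and m = 3
  reaches weight 12.\<close>

theorem eisenstein_4_theta: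
  assumes \<tau>: "Im \<tau> > 0"
  shows "eisenstein 4 \<tau> = of_real (pi ^ 4 / 45) * ((theta2 \<tau> ^ 8 + theta3 \<tau> ^ 8 + theta4 \<tau> ^ 8) / 2)"
proof -
  define E where "E = (\<lambda>t. (theta2 t ^ 8 + theta3 t ^ 8 + theta4 t ^ 8) / 2)"
  define f where "f = (\<lambda>t. eisenstein (2 * 2) t - of_real (2 * (pi ^ 4 / 90)) * E t)"
  have e8: "x ^ 8 = (x ^ 4) ^ 2" for x :: complex by (simp flip: power_mult)
  have "f \<tau> = 0"
  proof (rule no_small_weight_cusp_form[where f = f and \<tau> = \<tau> and k = 4 and m = 3])
    show "f holomorphic_on upper_half_plane"
      unfolding f_def E_def by (intro holomorphic_intros holomorphic_eisenstein holomorphic_theta2 holomorphic_theta3 holomorphic_theta4) auto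
    show "f (t + 1) = f t" for t
      unfolding f_def E_def e8 eisenstein_add_1 theta2_add_1_pow4 theta3_add_1 theta4_add_1 by simp
    show "f (-1 / t) = t ^ 4 * f t" if t: "Im t > 0" for t
      unfolding f_def E_def e8 eisenstein_neg_inverse[OF t] theta2_inversion_pow4[OF t] theta3_inversion_pow4[OF t] theta4_inversion_pow4[OF t]
      by (simp add: power_mult_distrib algebra_simps add_divide_distrib flip: power_mult)
    have "(f \<longlongrightarrow> of_real (2 * (pi ^ 4 / 90)) - of_real (2 * (pi ^ 4 / 90)) * ((0 ^ 8 + 1 ^ 8 + 1 ^ 8) / 2)) (filtercomap Im at_top)"
      unfolding f_def E_def
      by (intro tendsto_intros tendsto_eisenstein tendsto_theta2 tendsto_theta3 tendsto_theta4) (use zeta_4 in auto)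
    then show "(f \<longlongrightarrow> 0) (filtercomap Im at_top)" by simp
  qed (use \<tau> in auto)
  then show ?thesis by (simp add: f_def E_def)
qed

text \<open>Both generators permute the three factors up to sign: \<tau> + 1 swaps the outer two,
  and under -1/\<tau> the four signs that arise cancel.\<close>

theorem eisenstein_6_theta:
  assumes \<tau>: "Im \<tau> > 0"
  shows "eisenstein 6 \<tau> = of_real (2 * pi ^ 6 / 945) *
     ((theta2 \<tau> ^ 4 + theta3 \<tau> ^ 4) * (theta3 \<tau> ^ 4 + theta4 \<tau> ^ 4) * (theta4 \<tau> ^ 4 - theta2 \<tau> ^ 4) / 2)"
proof -
  define E where "E = (\<lambda>t. (theta2 t ^ 4 + theta3 t ^ 4) * (theta3 t ^ 4 + theta4 t ^ 4) * (theta4 t ^ 4 - theta2 t ^ 4) / 2)"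
  define f where "f = (\<lambda>t. eisenstein (2 * 3) t - of_real (2 * (pi ^ 6 / 945)) * E t)"
  have "f \<tau> = 0"
  proof (rule no_small_weight_cusp_form[where f = f and \<tau> = \<tau> and k = 6 and m = 2])
    show "f holomorphic_on upper_half_plane"
      unfolding f_def E_def by (intro holomorphic_intros holomorphic_eisenstein holomorphic_theta2 holomorphic_theta3 holomorphic_theta4) auto
    show "f (t + 1) = f t" for t
      unfolding f_def E_def eisenstein_add_1 theta2_add_1_pow4 theta3_add_1 theta4_add_1 by (simp add: algebra_simps)
    show "f (-1 / t) = t ^ 6 * f t" if t: "Im t > 0" for t
    proof -
      have "E (-1 / t) = t ^ 6 * E t"
        unfolding E_def theta2_inversion_pow4[OF t] theta3_inversion_pow4[OF t] theta4_inversion_pow4[OF t]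
        by (simp add: algebra_simps add_divide_distrib diff_divide_distrib power_add[symmetric])
      then show ?thesis unfolding f_def eisenstein_neg_inverse[OF t] by (simp add: algebra_simps)
    qed
    have "(f \<longlongrightarrow> of_real (2 * (pi ^ 6 / 945)) - of_real (2 * (pi ^ 6 / 945)) * ((0 ^ 4 + 1 ^ 4) * (1 ^ 4 + 1 ^ 4) * (1 ^ 4 - 0 ^ 4) / 2)) (filtercomap Im at_top)"
      unfolding f_def E_def
      by (intro tendsto_intros tendsto_eisenstein tendsto_theta2 tendsto_theta3 tendsto_theta4) (use zeta_6 in auto)
    then show "(f \<longlongrightarrow> 0) (filtercomap Im at_top)" by simp
  qed (use \<tau> in auto)
  then show ?thesis by (simp add: f_def E_def)
qed

text \<open>With a = theta2^4, b = theta4^4 and theta3^4 = a + b, the differences of the roots of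
  the cubic are proportional to a, b and a + b, so the discriminant becomes 16 pi^12 (a b (a + b))^2
  / \<omega>1^12.\<close>

theorem curve_discr_eta:
  assumes \<tau>: "Im \<tau> > 0" "\<tau> = \<omega>2 / \<omega>1" and L: "is_period_lattice g2 g3 (lattice_of \<omega>1 \<omega>2)"
  shows "curve_discr g2 g3 = (2 * pi * dedekind_eta \<tau> ^ 2 / \<omega>1) ^ 12"
proof -
  have \<omega>: "\<omega>1 \<noteq> 0" using \<tau> by auto
  define a b c where "a = theta2 \<tau> ^ 4" and "b = theta4 \<tau> ^ 4" and "c = theta3 \<tau> ^ 4"
  have c: "c = a + b" using jacobi_quartic[OF \<tau>(1)] by (simp add: a_def b_def c_def)
  have e8: "x ^ 8 = (x ^ 4) ^ 2" for x :: complex by (simp flip: power_mult)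
  have G4: "eisenstein 4 \<tau> = of_real (pi ^ 4 / 45) * (a^2 + a * b + b^2)"
    unfolding eisenstein_4_theta[OF \<tau>(1)] e8 a_def[symmetric] b_def[symmetric] c_def[symmetric] c
    by (simp add: power2_eq_square field_simps)
  have G6: "eisenstein 6 \<tau> = of_real (2 * pi ^ 6 / 945) * ((2 * a + b) * (a + 2 * b) * (b - a) / 2)"
    unfolding eisenstein_6_theta[OF \<tau>(1)] a_def[symmetric] b_def[symmetric] c_def[symmetric] c
    by (simp add: algebra_simps)
  define P where "P = complex_of_real pi"
  have g2: "g2 = 60 * (P ^ 4 / 45 * (a^2 + a * b + b^2)) / \<omega>1 ^ 4"
    using L G4 eisenstein_sum_lattice[OF \<tau>, of 4] by (simp add: is_period_lattice_def P_def)
  have g3: "g3 = 140 * (2 * P ^ 6 / 945 * ((2 * a + b) * (a + 2 * b) * (b - a) / 2)) / \<omega>1 ^ 6"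
    using L G6 eisenstein_sum_lattice[OF \<tau>, of 6] by (simp add: is_period_lattice_def P_def)
  have "g2 ^ 3 = (60 * (P ^ 4 / 45 * (a^2 + a * b + b^2))) ^ 3 / \<omega>1 ^ 12"
    unfolding g2 power_divide by (simp flip: power_mult)
  moreover have "g3 ^ 2 = (140 * (2 * P ^ 6 / 945 * ((2 * a + b) * (a + 2 * b) * (b - a) / 2))) ^ 2 / \<omega>1 ^ 12"
    unfolding g3 power_divide by (simp flip: power_mult)
  ultimately have "curve_discr g2 g3 = ((60 * (P ^ 4 / 45 * (a^2 + a * b + b^2))) ^ 3 - 27 * (140 * (2 * P ^ 6 / 945 * ((2 * a + b) * (a + 2 * b) * (b - a) / 2))) ^ 2) / \<omega>1 ^ 12"
    by (simp add: curve_discr_def diff_divide_distrib)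
  also have "(60 * (P ^ 4 / 45 * (a^2 + a * b + b^2))) ^ 3 - 27 * (140 * (2 * P ^ 6 / 945 * ((2 * a + b) * (a + 2 * b) * (b - a) / 2))) ^ 2 = 16 * P ^ 12 * (a * b * (a + b)) ^ 2"
    by (simp add: eval_nat_numeral field_simps)
  also have "a * b * (a + b) = (theta2 \<tau> * theta3 \<tau> * theta4 \<tau>) ^ 4"
    unfolding c[symmetric] by (simp add: a_def b_def c_def power_mult_distrib)
  also have "\<dots> = 16 * dedekind_eta \<tau> ^ 12"
    unfolding theta_product_eta[OF \<tau>(1)] by (simp add: power_mult_distrib flip: power_mult)
  also have "16 * P ^ 12 * (16 * dedekind_eta \<tau> ^ 12) ^ 2 / \<omega>1 ^ 12 = (2 * P * dedekind_eta \<tau> ^ 2 / \<omega>1) ^ 12"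
    by (simp add: power_mult_distrib power_divide flip: power_mult)
  finally show ?thesis by (simp add: P_def)
qed

section \<open>The modular lambda function on the fundamental domain\<close>

lemma
  fixes x :: complex and e :: "nat \<Rightarrow> nat"
  assumes r: "norm x < 1" and e: "\<And>n. e n \<ge> n"
  shows summable_sparse_powers: "summable (\<lambda>n. norm (x ^ e n))"
    and norm_sparse_powers_le: "norm (\<Sum>n. x ^ e n) \<le> 1 / (1 - norm x)"
proof -
  have le: "norm (norm (x ^ e n)) \<le> norm x ^ n" for n
    using power_decreasing[OF e[of n], of "norm x"] r by (simp add: norm_power)
  show s: "summable (\<lambda>n. norm (x ^ e n))"
    by (rule summable_comparison_test'[OF summable_geometric[of "norm x"], of 0]) (use r le in auto)
  have "norm (\<Sum>n. x ^ e n) \<le> (\<Sum>n. norm (x ^ e n))" by (rule summable_norm[OF s])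
  also have "\<dots> \<le> (\<Sum>n. norm x ^ n)"
    using le s r by (intro suminf_le summable_geometric) auto
  also have "\<dots> = 1 / (1 - norm x)" using r by (intro suminf_geometric) simp
  finally show "norm (\<Sum>n. x ^ e n) \<le> 1 / (1 - norm x)" .
qed

lemma norm_sparse_powers_Suc_le:
  fixes x :: complex
  assumes r: "norm x < 1" and e: "\<And>n. e n \<ge> Suc n"
  shows "norm (\<Sum>n. x ^ e n) \<le> norm x / (1 - norm x)"
proof -
  have "x ^ e n = x * x ^ (e n - 1)" for n using e[of n] by (cases "e n") auto
  then have "(\<Sum>n. x ^ e n) = (\<Sum>n. x * x ^ (e n - 1))" by (rule suminf_cong)
  also have "\<dots> = x * (\<Sum>n. x ^ (e n - 1))"
  proof (rule suminf_mult, rule summable_norm_cancel, rule summable_sparse_powers[OF r])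
    show "n \<le> e n - 1" for n using e[of n] by linarith
  qed
  finally have "norm (\<Sum>n. x ^ e n) = norm x * norm (\<Sum>n. x ^ (e n - 1))" by (simp add: norm_mult)
  also have "\<dots> \<le> norm x * (1 / (1 - norm x))"
  proof (intro mult_left_mono norm_sparse_powers_le r)
    show "n \<le> e n - 1" for n using e[of n] by linarith
  qed auto
  finally show ?thesis by simp
qed

lemma theta3_series:
  assumes "Im \<tau> > 0"
  shows "theta3 \<tau> = 1 + 2 * (\<Sum>n. exp (pi * \<i> * \<tau>) ^ (Suc n ^ 2))"
proof -
  define x where "x = exp (pi * \<i> * \<tau>)"
  have r: "norm x < 1" using assms by (simp add: x_def norm_exp_eq_Re)
  have t: "exp (pi * \<i> * (of_int n) ^ 2 * \<tau>) = x ^ nat (n^2)" for n :: int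
  proof -
    have "pi * \<i> * (of_int n) ^ 2 * \<tau> = of_nat (nat (n^2)) * (pi * \<i> * \<tau>)" by simp
    then show ?thesis unfolding x_def by (simp only: exp_of_nat_mult)
  qed
  have n1: "nat ((int n)^2) = n^2" for n by (simp flip: of_nat_power)
  have n2: "nat ((- int n - 1)^2) = Suc n ^ 2" for n
  proof -
    have "(- int n - 1)^2 = int (Suc n) ^ 2" by (simp add: power2_eq_square algebra_simps)
    then show ?thesis by (simp only: n1)
  qed
  have s0: "summable (\<lambda>n. norm (x ^ (n^2)))" by (rule summable_sparse_powers[OF r]) (simp add: power2_eq_square)
  have s1: "summable (\<lambda>n. norm (x ^ (Suc n ^ 2)))" by (rule summable_sparse_powers[OF r]) (simp add: power2_eq_square)
  have h0: "((\<lambda>n. x ^ (n^2)) has_sum (\<Sum>n. x ^ (n^2))) UNIV"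
    by (rule norm_summable_imp_has_sum[OF s0]) (simp add: summable_sums summable_norm_cancel[OF s0])
  have h1: "((\<lambda>n. x ^ (Suc n ^ 2)) has_sum (\<Sum>n. x ^ (Suc n ^ 2))) UNIV"
    by (rule norm_summable_imp_has_sum[OF s1]) (simp only: summable_sums summable_norm_cancel[OF s1])
  have "theta3 \<tau> = (\<Sum>\<^sub>\<infinity>n\<in>(UNIV::int set). x ^ nat (n^2))" by (simp only: theta3_def t)
  also have "\<dots> = (\<Sum>\<^sub>\<infinity>n. x ^ (n^2)) + (\<Sum>\<^sub>\<infinity>n. x ^ (Suc n ^ 2))"
    using infsum_int[of "\<lambda>n. x ^ nat (n^2)"] h0 h1 unfolding n1 n2 by (simp only: has_sum_imp_summable)
  also have "(\<Sum>\<^sub>\<infinity>n. x ^ (n^2)) = 1 + (\<Sum>n. x ^ (Suc n ^ 2))"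
    using infsumI[OF h0] suminf_split_head[OF summable_norm_cancel[OF s0]] by simp
  also have "(\<Sum>\<^sub>\<infinity>n. x ^ (Suc n ^ 2)) = (\<Sum>n. x ^ (Suc n ^ 2))" by (rule infsumI[OF h1])
  finally show ?thesis by (simp add: x_def)
qed

lemma theta2_series:
  assumes "Im \<tau> > 0"
  shows "theta2 \<tau> = 2 * exp (pi * \<i> * \<tau> / 4) * (1 + (\<Sum>n. exp (pi * \<i> * \<tau>) ^ (Suc n * Suc (Suc n))))"
proof -
  define x r where "x = exp (pi * \<i> * \<tau>)" and "r = exp (pi * \<i> * \<tau> / 4)"
  have nx: "norm x < 1" using assms by (simp add: x_def norm_exp_eq_Re)
  have t: "exp (pi * \<i> * (of_int n + 1/2) ^ 2 * \<tau>) = r * x ^ m" if "int m = n * (n + 1)" for n :: int and m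
  proof -
    have "complex_of_int (n * (n + 1)) = of_nat m" by (metis that of_int_of_nat_eq)
    moreover have "pi * \<i> * (of_int n + 1/2) ^ 2 * \<tau> = pi * \<i> * \<tau> / 4 + complex_of_int (n * (n + 1)) * (pi * \<i> * \<tau>)"
      by (simp add: power2_eq_square field_simps)
    ultimately show ?thesis unfolding x_def r_def by (simp only: exp_add exp_of_nat_mult)
  qed
  have t1: "exp (pi * \<i> * (of_int (int n) + 1/2) ^ 2 * \<tau>) = r * x ^ (n * Suc n)" for n by (rule t) (simp add: algebra_simps)
  have t2: "exp (pi * \<i> * (of_int (- int n - 1) + 1/2) ^ 2 * \<tau>) = r * x ^ (n * Suc n)" for n by (rule t) (simp add: algebra_simps)
  have s0: "summable (\<lambda>n. norm (x ^ (n * Suc n)))" by (rule summable_sparse_powers[OF nx]) simp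
  have h0: "((\<lambda>n. x ^ (n * Suc n)) has_sum (\<Sum>n. x ^ (n * Suc n))) UNIV"
    by (rule norm_summable_imp_has_sum[OF s0]) (simp only: summable_sums summable_norm_cancel[OF s0])
  have h1: "((\<lambda>n. r * x ^ (n * Suc n)) has_sum (r * (\<Sum>n. x ^ (n * Suc n)))) UNIV"
    by (rule has_sum_cmult_right[OF h0])
  have "theta2 \<tau> = (\<Sum>\<^sub>\<infinity>n. r * x ^ (n * Suc n)) + (\<Sum>\<^sub>\<infinity>n. r * x ^ (n * Suc n))"
    unfolding theta2_def using infsum_int[of "\<lambda>n. exp (pi * \<i> * (of_int n + 1/2) ^ 2 * \<tau>)"] h1 unfolding t1 t2
    by (simp only: has_sum_imp_summable)
  also have "\<dots> = 2 * r * (\<Sum>n. x ^ (n * Suc n))" using infsumI[OF h1] by simp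
  also have "(\<Sum>n. x ^ (n * Suc n)) = 1 + (\<Sum>n. x ^ (Suc n * Suc (Suc n)))"
    using suminf_split_head[OF summable_norm_cancel[OF s0]] by simp
  finally show ?thesis by (simp add: x_def r_def)
qed

text \<open>High up crude bounds suffice: pi > 3 and quadratic Taylor bounds for exp make the nome
  at most 1/15 and its fourth root at most 4/11, so |theta2| \<le> 2 (4/11) (15/14) \<le> 6/7 \<le>
  |theta3|.\<close>

lemma norm_theta2_le_theta3_high:
  assumes "Im s \<ge> 3/2"
  shows "cmod (theta2 s) \<le> cmod (theta3 s)"
proof -
  define x where "x = exp (pi * \<i> * s)"
  have im: "Im s > 0" using assms by simp
  have "exp (9/2 :: real) \<ge> 15"
    using exp_lower_Taylor_quadratic[of "9/2::real"] by (simp add: power2_eq_square)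
  moreover have "pi * Im s \<ge> 3 * (3/2)" using assms pi_gt3 by (intro mult_mono) auto
  moreover from this have "exp (9/2 :: real) \<le> exp (pi * Im s)" by simp
  ultimately have "exp (pi * Im s) \<ge> 15" by linarith
  then have x: "norm x \<le> 1/15" by (simp add: x_def norm_exp_eq_Re exp_minus field_simps)
  have "exp (9/8 :: real) \<ge> 11/4"
    using exp_lower_Taylor_quadratic[of "9/8::real"] by (simp add: power2_eq_square)
  moreover have "pi * Im s / 4 \<ge> 9/8" using \<open>pi * Im s \<ge> 3 * (3/2)\<close> by simp
  moreover from this have "exp (9/8 :: real) \<le> exp (pi * Im s / 4)" by simp
  ultimately have "exp (pi * Im s / 4) \<ge> 11/4" by linarith
  then have r: "norm (exp (pi * \<i> * s / 4)) \<le> 4/11" by (simp add: norm_exp_eq_Re exp_minus field_simps)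
  have xx: "norm x / (1 - norm x) \<le> 1/14" using x by (simp add: divide_le_eq)
  have a: "norm (\<Sum>n. x ^ (Suc n ^ 2)) \<le> 1/14"
    by (rule order_trans[OF norm_sparse_powers_Suc_le xx]) (use x in \<open>auto simp: power2_eq_square\<close>)
  have b: "norm (\<Sum>n. x ^ (Suc n * Suc (Suc n))) \<le> 1/14"
    by (rule order_trans[OF norm_sparse_powers_Suc_le xx]) (use x in auto)
  have "cmod (theta2 s) = 2 * norm (exp (pi * \<i> * s / 4)) * norm (1 + (\<Sum>n. x ^ (Suc n * Suc (Suc n))))"
    unfolding theta2_series[OF im] x_def[symmetric] by (simp only: norm_mult norm_numeral)
  also have "\<dots> \<le> 2 * (4/11) * (1 + 1/14)"
    using r b norm_triangle_ineq[of 1 "\<Sum>n. x ^ (Suc n * Suc (Suc n))"] by (intro mult_mono) auto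
  also have "\<dots> \<le> 1 - 2 * (1/14)" by simp
  also have "\<dots> \<le> cmod (theta3 s)"
    unfolding theta3_series[OF im] x_def[symmetric]
    using a norm_diff_ineq[of 1 "2 * (\<Sum>n. x ^ (Suc n ^ 2))"] by (simp only: norm_mult norm_numeral norm_one)
  finally show ?thesis .
qed

text \<open>The factor |Im p|, instead of |p|, is the point: it lets the imaginary part of a whole
  power series in p be small when Im p is.\<close>

lemma abs_Im_power_le: "\<bar>Im (p ^ Suc k)\<bar> \<le> real (Suc k) * cmod p ^ k * \<bar>Im p\<bar>"
proof (induction k)
  case (Suc k)
  have "\<bar>Im (p ^ Suc (Suc k))\<bar> = \<bar>Re p * Im (p ^ Suc k) + Im p * Re (p ^ Suc k)\<bar>" by simp
  also have "\<dots> \<le> \<bar>Re p\<bar> * \<bar>Im (p ^ Suc k)\<bar> + \<bar>Im p\<bar> * \<bar>Re (p ^ Suc k)\<bar>"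
    by (metis abs_mult abs_triangle_ineq)
  also have "\<dots> \<le> cmod p * (real (Suc k) * cmod p ^ k * \<bar>Im p\<bar>) + \<bar>Im p\<bar> * cmod p ^ Suc k"
    using abs_Re_le_cmod[of p] abs_Re_le_cmod[of "p ^ Suc k"] Suc
    by (intro add_mono mult_mono) (auto simp: norm_power norm_mult)
  also have "\<dots> = real (Suc (Suc k)) * cmod p ^ Suc k * \<bar>Im p\<bar>" by (simp add: algebra_simps)
  finally show ?case .
qed simp

text \<open>On the lines \<open>Re w = \<plusminus>1/2\<close> both sides are equal, so absolute values of the terms do not suffice:
  the imaginary parts of the series in \<open>q\<^sup>4\<close> have to be compared with \<open>Re q\<close>.\<close>
lemma norm_theta4_le_theta3:
  assumes re: "\<bar>Re w\<bar> \<le> 1/2" and im: "Im w \<ge> 2/5"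
  shows "cmod (theta4 w) \<le> cmod (theta3 w)"
proof -
  define q p where "q = exp (pi * \<i> * w)" and "p = exp (pi * \<i> * (4 * w))"
  define \<rho> where "\<rho> = cmod p"
  have im0: "Im w > 0" "Im (4 * w) > 0" using im by auto
  have q0: "cmod q > 0" by (simp add: q_def)
  have pq: "p = q ^ 4" unfolding p_def q_def using exp_of_nat_mult[of 4 "pi * \<i> * w"] by (simp add: mult_ac)
  have c: "Re q \<ge> 0"
  proof -
    have "\<bar>pi * Re w\<bar> \<le> pi / 2" using re by (simp add: abs_mult)
    then have "- (pi / 2) \<le> pi * Re w" "pi * Re w \<le> pi / 2" unfolding abs_le_iff by linarith+
    then have "cos (pi * Re w) \<ge> 0" by (rule cos_ge_zero)
    then show ?thesis by (simp add: q_def Re_exp)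
  qed
  have rho: "\<rho> \<le> 1/64"
  proof -
    \<comment> \<open>The quadratic Taylor bound at 24/5 would give only about 17, so it is applied
      at 6/5 and raised to the fourth power.\<close>
    have "exp (6/5 :: real) \<ge> 73/25"
      using exp_lower_Taylor_quadratic[of "6/5::real"] by (simp add: power2_eq_square)
    then have "exp (6/5 :: real) ^ 4 \<ge> (73/25) ^ 4" by (intro power_mono) auto
    then have "exp (24/5 :: real) \<ge> 64" using exp_of_nat_mult[of 4 "6/5::real"] by (simp add: power4_eq_xxxx)
    moreover have "pi * (4 * Im w) \<ge> 3 * (4 * (2/5))" using im pi_gt3 by (intro mult_mono) auto
    moreover from this have "exp (24/5 :: real) \<le> exp (pi * (4 * Im w))" by simp
    ultimately have "exp (pi * (4 * Im w)) \<ge> 64" by linarith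
    then show ?thesis by (simp add: \<rho>_def p_def norm_exp_eq_Re exp_minus field_simps)
  qed
  have rho0: "\<rho> \<ge> 0" by (simp add: \<rho>_def)
  \<comment> \<open>The imaginary part of q^4 contains the factor 4 Re q. Measured against |q|, this
    factor bounds all imaginary parts below, so they vanish together with Re q.\<close>
  define C where "C = 4 * Re q / cmod q"
  have C: "C \<ge> 0" using c by (simp add: C_def)
  have Imp: "\<bar>Im p\<bar> \<le> C * \<rho>"
  proof -
    have "Im p = 4 * Re q * (Im q * ((Re q)\<^sup>2 - (Im q)\<^sup>2))"
      unfolding pq by (simp add: power4_eq_xxxx power2_eq_square algebra_simps)
    then have "\<bar>Im p\<bar> = 4 * Re q * (\<bar>Im q\<bar> * \<bar>(Re q)\<^sup>2 - (Im q)\<^sup>2\<bar>)" using c by (simp add: abs_mult)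
    also have "\<dots> \<le> 4 * Re q * (cmod q * (cmod q)\<^sup>2)"
      using c abs_Im_le_cmod[of q] by (intro mult_left_mono mult_mono) (auto simp: cmod_power2 abs_le_iff)
    also have "\<dots> = C * \<rho>"
    proof -
      have "\<rho> = cmod q ^ 4" by (simp add: \<rho>_def pq norm_power)
      then show ?thesis using q0 by (simp add: C_def power4_eq_xxxx power2_eq_square)
    qed
    finally show ?thesis .
  qed
  have pk: "\<bar>Im (p ^ Suc k)\<bar> \<le> C * (2 * \<rho>) ^ Suc k" for k
  proof -
    \<comment> \<open>The linear factor is absorbed into the geometric ratio, which becomes 2 \<rho>
      \<le> 1/32.\<close>
    have "real (Suc k) \<le> 2 ^ Suc k" using of_nat_mono[OF less_imp_le[OF less_exp[of "Suc k"]], where 'a = real] by simp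
    then have "real (Suc k) * \<rho> ^ k * (C * \<rho>) \<le> 2 ^ Suc k * \<rho> ^ k * (C * \<rho>)"
      using rho0 C by (intro mult_right_mono mult_nonneg_nonneg) auto
    moreover have "real (Suc k) * \<rho> ^ k * \<bar>Im p\<bar> \<le> real (Suc k) * \<rho> ^ k * (C * \<rho>)"
      using Imp rho0 by (intro mult_left_mono) auto
    moreover have "2 ^ Suc k * \<rho> ^ k * (C * \<rho>) = C * (2 * \<rho>) ^ Suc k" by (simp add: power_mult_distrib)
    ultimately show ?thesis using abs_Im_power_le[of p k] unfolding \<rho>_def by linarith
  qed
  have series: "norm (\<Sum>n. p ^ e n) \<le> 1/63" "\<bar>Im (\<Sum>n. p ^ e n)\<bar> \<le> C * (1/31)" if e: "\<And>n. e n \<ge> Suc n" for e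
  proof -
    have "\<rho> / (1 - \<rho>) \<le> 1/63" using rho by (simp add: divide_le_eq)
    then show "norm (\<Sum>n. p ^ e n) \<le> 1/63"
      by (rule order_trans[rotated]) (unfold \<rho>_def, rule norm_sparse_powers_Suc_le, use e rho in \<open>auto simp: \<rho>_def\<close>)
    have sp: "summable (\<lambda>n. norm (p ^ e n))"
      by (rule summable_sparse_powers) (use e rho in \<open>auto simp: \<rho>_def intro: Suc_leD\<close>)
    have sg: "(\<lambda>n. C * (2 * \<rho> * (2 * \<rho>) ^ n)) sums (C * (2 * \<rho> * (1 / (1 - 2 * \<rho>))))"
      by (intro sums_mult geometric_sums) (use rho rho0 in auto)
    have le: "\<bar>Im (p ^ e n)\<bar> \<le> C * (2 * \<rho> * (2 * \<rho>) ^ n)" for n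
    proof -
      obtain k where k: "e n = Suc k" using e[of n] by (cases "e n") auto
      have "(2 * \<rho>) ^ e n \<le> (2 * \<rho>) ^ Suc n" using e rho rho0 by (intro power_decreasing) auto
      then have "C * (2 * \<rho>) ^ Suc k \<le> C * (2 * \<rho>) ^ Suc n" using C k by (intro mult_left_mono) auto
      from order_trans[OF pk[of k] this] show ?thesis unfolding k by (simp only: power_Suc)
    qed
    have si: "summable (\<lambda>n. \<bar>Im (p ^ e n)\<bar>)"
      by (rule summable_comparison_test'[OF sums_summable[OF sg], of 0]) (use le in auto)
    have "Im (\<Sum>n. p ^ e n) = (\<Sum>n. Im (p ^ e n))" by (rule Im_suminf[OF summable_norm_cancel[OF sp]])
    also have "\<bar>\<dots>\<bar> \<le> (\<Sum>n. \<bar>Im (p ^ e n)\<bar>)" by (rule summable_rabs[OF si])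
    also have "\<dots> \<le> (\<Sum>n. C * (2 * \<rho> * (2 * \<rho>) ^ n))" by (rule suminf_le[OF le si sums_summable[OF sg]])
    also have "\<dots> = C * (2 * \<rho> / (1 - 2 * \<rho>))" using sums_unique[OF sg] by simp
    also have "\<dots> \<le> C * (1/31)" using rho C by (intro mult_left_mono) (auto simp: divide_le_eq)
    finally show "\<bar>Im (\<Sum>n. p ^ e n)\<bar> \<le> C * (1/31)" .
  qed
  define a b where "a = (\<Sum>n. p ^ (Suc n ^ 2))" and "b = (\<Sum>n. p ^ (Suc n * Suc (Suc n)))"
  have ab: "norm a \<le> 1/63" "norm b \<le> 1/63" "\<bar>Im a\<bar> \<le> C * (1/31)" "\<bar>Im b\<bar> \<le> C * (1/31)"
    unfolding a_def b_def by (rule series; simp add: power2_eq_square)+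
  define A B where "A = 1 + 2 * a" and "B = 1 + b"
  have th3: "theta3 (4 * w) = A" unfolding theta3_series[OF im0(2)] p_def[symmetric] a_def A_def ..
  have th2: "theta2 (4 * w) = 2 * (q * B)"
  proof -
    have "exp (pi * \<i> * (4 * w) / 4) = q" by (simp add: q_def mult_ac)
    then show ?thesis unfolding theta2_series[OF im0(2)] p_def[symmetric] b_def B_def by (simp only: mult.assoc)
  qed
  define h where "h = B * cnj A"
  have C4: "C \<le> 4" using c complex_Re_le_cmod[of q] q0 by (simp add: C_def divide_le_eq)
  have reA: "\<bar>Re A - 1\<bar> \<le> 2/63" using ab(1) abs_Re_le_cmod[of a] by (simp add: A_def)
  have reB: "\<bar>Re B - 1\<bar> \<le> 1/63" using ab(2) abs_Re_le_cmod[of b] by (simp add: B_def)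
  have rA: "61/63 \<le> Re A" "\<bar>Re A\<bar> \<le> 65/63" using reA unfolding abs_le_iff by linarith+
  have rB: "62/63 \<le> Re B" "\<bar>Re B\<bar> \<le> 64/63" using reB unfolding abs_le_iff by linarith+
  have imA: "\<bar>Im A\<bar> \<le> C * (2/31)" using ab(3) by (simp add: A_def)
  have imB: "\<bar>Im B\<bar> \<le> C * (1/31)" using ab(4) by (simp add: B_def)
  \<comment> \<open>The target 1/8 is matched to the bound 1/2 for Re h: |q| C / 8 = Re q / 2 \<le>
    Re q Re h.\<close>
  have Imh: "\<bar>Im h\<bar> \<le> C * (1/8)"
  proof -
    have "\<bar>Im h\<bar> = \<bar>Im B * Re A - Re B * Im A\<bar>" by (simp add: h_def algebra_simps)
    also have "\<dots> \<le> \<bar>Im B\<bar> * \<bar>Re A\<bar> + \<bar>Re B\<bar> * \<bar>Im A\<bar>" by (metis abs_mult abs_triangle_ineq4)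
    also have "\<dots> \<le> (C * (1/31)) * (65/63) + (64/63) * (C * (2/31))"
      using imA imB rA rB C by (intro add_mono mult_mono) auto
    also have "\<dots> \<le> C * (1/8)" using C by simp
    finally show ?thesis .
  qed
  have Reh: "Re h \<ge> 1/2"
  proof -
    have "(61/63) * (62/63) \<le> Re A * Re B" using rA rB by (intro mult_mono) auto
    moreover have "\<bar>Im B * Im A\<bar> \<le> (4 * (1/31)) * (4 * (2/31))"
      unfolding abs_mult using imA imB C4 C by (intro mult_mono) auto
    moreover have "Re h = Re A * Re B + Im B * Im A" by (simp add: h_def algebra_simps)
    ultimately show ?thesis by (simp add: abs_le_iff)
  qed
  have "Re (theta2 (4 * w) * cnj (theta3 (4 * w))) = 2 * (Re q * Re h - Im q * Im h)"
    unfolding th2 th3 h_def by (simp add: algebra_simps)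
  moreover have "Im q * Im h \<le> Re q * Re h"
  proof -
    have "Im q * Im h \<le> \<bar>Im q\<bar> * \<bar>Im h\<bar>" by (metis abs_ge_self abs_mult)
    also have "\<dots> \<le> cmod q * (C * (1/8))" using abs_Im_le_cmod Imh by (intro mult_mono) auto
    also have "\<dots> = Re q * (1/2)" using q0 by (simp add: C_def)
    also have "\<dots> \<le> Re q * Re h" using Reh c by (intro mult_left_mono) auto
    finally show ?thesis .
  qed
  ultimately have nn: "Re (theta2 (4 * w) * cnj (theta3 (4 * w))) \<ge> 0" by simp
  \<comment> \<open>With theta3 and theta4 at w as sum and difference of theta3 and theta2 at 4 w,
    the difference of squared moduli is the cross term.\<close>
  have "(cmod (theta3 w))\<^sup>2 - (cmod (theta4 w))\<^sup>2 = 4 * Re (theta2 (4 * w) * cnj (theta3 (4 * w)))"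
    unfolding theta3_split[OF im0(1)] theta4_split[OF im0(1)] cmod_power2
    by (simp add: power2_eq_square algebra_simps)
  then have "(cmod (theta4 w))\<^sup>2 \<le> (cmod (theta3 w))\<^sup>2" using nn by linarith
  then show ?thesis by (rule power2_le_imp_le) simp
qed

text \<open>The region in which the doubling iteration runs: it is stable under doubling and
  contains the double of the fundamental domain.\<close>

definition odd_disc_complement :: "complex set" where
  "odd_disc_complement = {s. Im s > 0 \<and> (\<forall>n::int. odd n \<longrightarrow> cmod (s - of_int n) \<ge> 1)}"

lemma theta_norm_inversion:
  assumes "Im s > 0"
  shows "cmod (theta2 s) \<le> cmod (theta3 s) \<longleftrightarrow> cmod (theta4 (-1 / s)) \<le> cmod (theta3 (-1 / s))"
proof -
  have s: "cmod s > 0" using assms by auto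
  have "cmod (theta4 (-1 / s)) ^ 2 = cmod s * cmod (theta2 s) ^ 2"
    using arg_cong[OF theta4_inversion[OF assms], of cmod] by (simp only: norm_mult norm_power norm_minus_cancel norm_ii mult_1_left)
  moreover have "cmod (theta3 (-1 / s)) ^ 2 = cmod s * cmod (theta3 s) ^ 2"
    using arg_cong[OF theta3_inversion[OF assms], of cmod] by (simp only: norm_mult norm_power norm_minus_cancel norm_ii mult_1_left)
  ultimately have "cmod (theta4 (-1 / s)) ^ 2 \<le> cmod (theta3 (-1 / s)) ^ 2 \<longleftrightarrow> cmod (theta2 s) ^ 2 \<le> cmod (theta3 s) ^ 2"
    using s by (simp only: mult_le_cancel_left_pos)
  then show ?thesis by (simp only: power_mono_iff[OF norm_ge_zero norm_ge_zero pos2])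
qed

text \<open>Below height 3/2 the inversion turns the two disc conditions into |Re w| \<le> 1/2 and
  brings the point to height at least 2/5, where \<open>norm_theta4_le_theta3\<close>
  applies.\<close>

lemma norm_theta2_le_theta3_strip:
  assumes im: "Im s > 0" and re: "\<bar>Re s\<bar> \<le> 1" and d: "cmod (s - 1) \<ge> 1" "cmod (s + 1) \<ge> 1"
  shows "cmod (theta2 s) \<le> cmod (theta3 s)"
proof (cases "Im s \<ge> 3/2")
  case True
  then show ?thesis by (rule norm_theta2_le_theta3_high)
next
  case False
  define u v N where "u = \<bar>Re s\<bar>" and "v = Im s" and "N = u\<^sup>2 + v\<^sup>2"
  have uv: "0 \<le> u" "u \<le> 1" "0 < v" "v < 3/2" using im re False by (auto simp: u_def v_def)
  have N: "(cmod s)\<^sup>2 = N" by (simp add: N_def u_def v_def cmod_power2)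
  have Npos: "N > 0" using uv by (simp add: N_def add_nonneg_pos)
  have "(cmod (s - 1))\<^sup>2 \<ge> 1" "(cmod (s + 1))\<^sup>2 \<ge> 1" using d by (simp_all add: one_le_power)
  then have 2: "2 * u \<le> N"
    unfolding cmod_power2 N_def u_def v_def by (simp add: power2_eq_square algebra_simps abs_if)
  \<comment> \<open>This says Im(-1/s) = v/N \<ge> 2/5. For v \<le> 1 the disc conditions give u
    \<le> v^2, so N \<le> 2 v; for 1 < v < 3/2 the sign of (v - 1) (v - 3/2) bounds v^2
    linearly.\<close>
  have Nv: "2 * N \<le> 5 * v"
  proof (cases "v \<le> 1")
    case True
    have "v\<^sup>2 \<ge> u * (2 - u)" using 2 by (simp add: N_def power2_eq_square algebra_simps)
    moreover have "u * (2 - u) \<ge> u * 1" using uv by (intro mult_left_mono) auto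
    ultimately have "u \<le> v\<^sup>2" by simp
    moreover have "v\<^sup>2 \<le> v" using True uv by (simp add: power2_eq_square mult_left_le_one_le)
    moreover have "u\<^sup>2 \<le> u" using uv by (simp add: power2_eq_square mult_left_le_one_le)
    ultimately show ?thesis using uv by (simp add: N_def)
  next
    case False
    have "(v - 1) * (v - 3/2) \<le> 0" using False uv by (intro mult_nonneg_nonpos) auto
    then have "2 * v\<^sup>2 \<le> 5 * v - 3" by (simp add: power2_eq_square field_simps)
    moreover have "u\<^sup>2 \<le> 1" using uv by (simp add: power_le_one)
    moreover have "2 * (Y + X) \<le> 5 * v" if "2 * X \<le> 5 * v - 3" "Y \<le> 1" for X Y :: real using that by simp
    ultimately show ?thesis unfolding N_def by blast
  qed
  have "Im (-1 / s) \<ge> 2/5" unfolding Im_neg_inverse N using Nv Npos by (simp add: v_def le_divide_eq)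
  moreover have "\<bar>Re (-1 / s)\<bar> \<le> 1/2"
  proof -
    have "\<bar>Re (-1 / s)\<bar> = u / N" using N Npos by (simp add: Re_divide cmod_power2 u_def abs_divide)
    then show ?thesis using 2 Npos by (simp add: divide_le_eq)
  qed
  ultimately show ?thesis unfolding theta_norm_inversion[OF im] by (intro norm_theta4_le_theta3)
qed

text \<open>An even translation into |Re s| \<le> 1 permutes the excluded discs, multiplies theta2
  by a number of modulus 1 and fixes theta3.\<close>

theorem norm_theta2_le_theta3:
  assumes s: "s \<in> odd_disc_complement"
  shows "cmod (theta2 s) \<le> cmod (theta3 s)"
proof -
  define m where "m = - round (Re s / 2)"
  define s' where "s' = s + of_int (2 * m)"
  have "\<bar>of_int (round (Re s / 2)) - Re s / 2\<bar> \<le> 1/2" by (rule of_int_round_abs_le)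
  moreover have "Re s' = Re s - 2 * of_int (round (Re s / 2))" by (simp add: s'_def m_def)
  ultimately have re: "\<bar>Re s'\<bar> \<le> 1" unfolding abs_le_iff by linarith
  have "odd (1 - 2 * m)" "odd (-1 - 2 * m)" by simp_all
  then have "cmod (s - of_int (1 - 2 * m)) \<ge> 1" "cmod (s - of_int (-1 - 2 * m)) \<ge> 1"
    using s unfolding odd_disc_complement_def by blast+
  then have d: "cmod (s' - 1) \<ge> 1" "cmod (s' + 1) \<ge> 1" by (simp_all add: s'_def algebra_simps)
  have "cmod (theta2 s') \<le> cmod (theta3 s')"
    using s by (intro norm_theta2_le_theta3_strip re d) (simp add: s'_def odd_disc_complement_def)
  moreover have "cmod (theta2 s') = cmod (theta2 s)" unfolding s'_def
    by (rule periodic_shift_int[where f = "\<lambda>t. cmod (theta2 t)"]) (simp add: theta2_add_1 norm_mult norm_exp_eq_Re)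
  moreover have "cmod (theta3 s') = cmod (theta3 s)"
    using periodic_shift_int[where f = "\<lambda>t. cmod (theta3 (2 * t))", of "s / 2" m]
    by (simp add: s'_def distrib_left)
  ultimately show ?thesis by simp
qed

text \<open>One of (n - 1)/2 and (n + 1)/2 is an odd integer m, and the unit disc about n lies in
  the disc of radius 2 about 2 m.\<close>

lemma odd_disc_complement_double:
  assumes s: "s \<in> odd_disc_complement"
  shows "2 * s \<in> odd_disc_complement"
proof -
  have "cmod (2 * s - of_int n) \<ge> 1" if n: "odd n" for n :: int
  proof -
    obtain k where k: "n = 2 * k + 1" using n by (auto elim: oddE)
    obtain m where m: "odd m" "n = 2 * m - 1 \<or> n = 2 * m + 1"
      using k by (cases "odd k") (auto intro: that[of k] that[of "k + 1"])
    have "cmod (s - of_int m) \<ge> 1" using s m by (auto simp: odd_disc_complement_def)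
    then have "2 \<le> cmod (2 * (s - of_int m))" by (simp only: norm_mult norm_numeral)
    also have "2 * (s - of_int m) = (2 * s - of_int n) + of_int (n - 2 * m)" by simp
    also have "cmod \<dots> \<le> cmod (2 * s - of_int n) + cmod (of_int (n - 2 * m))" by (rule norm_triangle_ineq)
    also have "cmod (of_int (n - 2 * m)) = 1" using m(2) by auto
    finally show ?thesis by simp
  qed
  then show ?thesis using s by (auto simp: odd_disc_complement_def)
qed

lemma double_Gamma2_domain:
  assumes "t \<in> Gamma2_fundamental_domain"
  shows "2 * t \<in> odd_disc_complement"
proof -
  have t: "Im t > 0" "\<bar>Re t\<bar> \<le> 1" "cmod (t - 1/2) \<ge> 1/2" "cmod (t + 1/2) \<ge> 1/2"
    using assms by (auto simp: Gamma2_fundamental_domain_def)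
  have "cmod (2 * t - of_int n) \<ge> 1" if n: "odd n" for n :: int
  proof -
    have "n = 1 \<or> n = -1 \<or> \<bar>n\<bar> \<ge> 3" using n by presburger
    then consider "n = 1" | "n = -1" | "\<bar>n\<bar> \<ge> 3" by blast
    then show ?thesis
    proof cases
      case 1
      have "2 * t - of_int n = 2 * (t - 1/2)" by (simp add: 1)
      then show ?thesis using t(3) by (simp only: norm_mult norm_numeral)
    next
      case 2
      have "2 * t - of_int n = 2 * (t + 1/2)" by (simp add: 2)
      then show ?thesis using t(4) by (simp only: norm_mult norm_numeral)
    next
      case 3
      then have "\<bar>real_of_int n\<bar> \<ge> 3" by linarith
      then have "1 \<le> \<bar>Re (2 * t - of_int n)\<bar>" using t(2) by simp
      then show ?thesis using abs_Re_le_cmod order_trans by blast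
    qed
  qed
  then show ?thesis using t(1) by (auto simp: odd_disc_complement_def)
qed

section \<open>Doubling the argument of \<lambda>\<close>

lemma modular_lambda_complement:
  assumes "Im \<tau> > 0"
  shows "1 - modular_lambda \<tau> = theta4 \<tau> ^ 4 / theta3 \<tau> ^ 4"
proof -
  have "theta4 \<tau> ^ 4 = theta3 \<tau> ^ 4 - theta2 \<tau> ^ 4" using jacobi_quartic[OF assms] by simp
  then show ?thesis using theta3_nonzero[OF assms] by (simp add: modular_lambda_def diff_divide_distrib)
qed

text \<open>Landen's transformation with x = (theta4 / theta3)^2, where 1 + x and 1 - x are given by
  the duplication formulas. That x is the principal root needs both hypotheses: the inequality at 2
  \<tau> gives Re x \<ge> 0, and |\<lambda>| < 1 excludes Re x = 0.\<close>

lemma hyp_lambda_double: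
  assumes \<tau>: "Im \<tau> > 0" and lam: "cmod (modular_lambda \<tau>) < 1"
    and le: "cmod (theta2 (2 * \<tau>)) \<le> cmod (theta3 (2 * \<tau>))"
  shows "cmod (modular_lambda (2 * \<tau>)) < 1"
    and "hyp_2F1 (1/2) (1/2) 1 (modular_lambda \<tau>) / theta3 \<tau> ^ 2 =
         hyp_2F1 (1/2) (1/2) 1 (modular_lambda (2 * \<tau>)) / theta3 (2 * \<tau>) ^ 2"
proof -
  define X where "X = theta4 \<tau> ^ 2 / theta3 \<tau> ^ 2"
  define t where "t = (1 - X) / (1 + X)"
  have nz: "theta3 \<tau> \<noteq> 0" "theta3 (2 * \<tau>) \<noteq> 0" using theta3_nonzero \<tau> by auto
  have p: "1 + X = 2 * theta3 (2 * \<tau>) ^ 2 / theta3 \<tau> ^ 2"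
  proof -
    have "1 + X = (theta3 \<tau> ^ 2 + theta4 \<tau> ^ 2) / theta3 \<tau> ^ 2" using nz by (simp add: X_def add_divide_distrib)
    then show ?thesis by (simp add: theta3_sq[OF \<tau>] theta4_sq[OF \<tau>])
  qed
  have m: "1 - X = 2 * theta2 (2 * \<tau>) ^ 2 / theta3 \<tau> ^ 2"
  proof -
    have "1 - X = (theta3 \<tau> ^ 2 - theta4 \<tau> ^ 2) / theta3 \<tau> ^ 2" using nz by (simp add: X_def diff_divide_distrib)
    then show ?thesis by (simp add: theta3_sq[OF \<tau>] theta4_sq[OF \<tau>])
  qed
  have t: "t = theta2 (2 * \<tau>) ^ 2 / theta3 (2 * \<tau>) ^ 2" using nz by (simp add: t_def p m)
  have X2: "X ^ 2 = 1 - modular_lambda \<tau>"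
    unfolding modular_lambda_complement[OF \<tau>] X_def by (simp add: power_divide flip: power_mult)
  have t2: "t ^ 2 = modular_lambda (2 * \<tau>)"
    unfolding t modular_lambda_def by (simp add: power_divide flip: power_mult)
  have "cmod (theta2 (2 * \<tau>)) ^ 2 \<le> cmod (theta3 (2 * \<tau>)) ^ 2" using le by (intro power_mono) auto
  then have "cmod (1 - X) \<le> cmod (1 + X)"
    unfolding p m by (simp add: norm_mult norm_divide norm_power divide_right_mono)
  then have "(cmod (1 - X))\<^sup>2 \<le> (cmod (1 + X))\<^sup>2" by (intro power_mono) auto
  then have "Re X \<ge> 0" unfolding cmod_power2 by (simp add: power2_eq_square algebra_simps)
  moreover have "Re X \<noteq> 0"
  proof
    assume "Re X = 0"
    then have "Re (X ^ 2) \<le> 0" by (simp add: power2_eq_square)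
    then have "Re (modular_lambda \<tau>) \<ge> 1" unfolding X2 by simp
    then show False using lam complex_Re_le_cmod[of "modular_lambda \<tau>"] by linarith
  qed
  ultimately have ReX: "Re X > 0" by simp
  have Xc: "csqrt (1 - modular_lambda \<tau>) = X"
    by (rule csqrt_unique[OF X2]) (use ReX in simp)
  have "(cmod (1 - X))\<^sup>2 < (cmod (1 + X))\<^sup>2"
    using ReX unfolding cmod_power2 by (simp add: power2_eq_square algebra_simps)
  then have "cmod (1 - X) < cmod (1 + X)" by (rule power_less_imp_less_base) simp
  then have "cmod t < 1" by (auto simp: t_def norm_divide divide_less_eq)
  then show "cmod (modular_lambda (2 * \<tau>)) < 1" by (simp add: t2[symmetric] norm_power power_less_one_iff)
  have "hyp_2F1 (1/2) (1/2) 1 (modular_lambda \<tau>) = 2 / (1 + X) * hyp_2F1 (1/2) (1/2) 1 (modular_lambda (2 * \<tau>))"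
    using landen_transformation[OF lam] unfolding Xc t_def[symmetric] t2 .
  also have "2 / (1 + X) = theta3 \<tau> ^ 2 / theta3 (2 * \<tau>) ^ 2" using nz by (simp add: p)
  finally show "hyp_2F1 (1/2) (1/2) 1 (modular_lambda \<tau>) / theta3 \<tau> ^ 2 =
         hyp_2F1 (1/2) (1/2) 1 (modular_lambda (2 * \<tau>)) / theta3 (2 * \<tau>) ^ 2"
    using nz by simp
qed

theorem hyp_lambda_eq_theta3_sq:
  assumes \<tau>: "\<tau> \<in> Gamma2_fundamental_domain" and lam: "cmod (modular_lambda \<tau>) < 1"
  shows "hyp_2F1 (1/2) (1/2) 1 (modular_lambda \<tau>) = theta3 \<tau> ^ 2"
proof -
  let ?F = "hyp_2F1 (1/2) (1/2) 1"
  have im: "Im \<tau> > 0" using \<tau> by (simp add: Gamma2_fundamental_domain_def)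
  define s where "s = (\<lambda>n. 2 ^ n * \<tau>)"
  have sS: "s (Suc n) = 2 * s n" for n by (simp add: s_def)
  have sim: "Im (s n) = 2 ^ n * Im \<tau>" for n by (induction n) (simp_all add: sS, simp add: s_def)
  have im_s: "Im (s n) > 0" for n using im by (simp add: sim)
  \<comment> \<open>The index starts at 1: \<tau> itself lies in the fundamental domain, and its
    double in the stable set. Since \<open>hyp_lambda_double\<close> asks for the inequality at 2
    s(n) = s(n + 1), this is enough.\<close>
  have dom: "s (Suc n) \<in> odd_disc_complement" for n
  proof (induction n)
    case 0
    show ?case using double_Gamma2_domain[OF \<tau>] by (simp add: s_def)
  next
    case (Suc n)
    then show ?case unfolding sS[of "Suc n"] by (rule odd_disc_complement_double)
  qed
  have le: "cmod (theta2 (2 * s n)) \<le> cmod (theta3 (2 * s n))" for n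
    using norm_theta2_le_theta3[OF dom[of n]] by (simp only: sS)
  have lt: "cmod (modular_lambda (s n)) < 1" for n
  proof (induction n)
    case 0
    show ?case using lam by (simp add: s_def)
  next
    case (Suc n)
    show ?case unfolding sS by (rule hyp_lambda_double(1)[OF im_s Suc le])
  qed
  have const: "?F (modular_lambda (s n)) / theta3 (s n) ^ 2 = ?F (modular_lambda \<tau>) / theta3 \<tau> ^ 2" for n
  proof (induction n)
    case 0
    show ?case by (simp add: s_def)
  next
    case (Suc n)
    then show ?case unfolding sS using hyp_lambda_double(2)[OF im_s lt le, of n] by simp
  qed
  have "filterlim (\<lambda>n. Im (s n)) at_top sequentially"
    unfolding sim using im by real_asymp
  then have fs: "filterlim s (filtercomap Im at_top) sequentially"
    by (simp add: filterlim_filtercomap_iff o_def)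
  have l3: "(\<lambda>n. theta3 (s n)) \<longlonglongrightarrow> 1" by (rule filterlim_compose[OF tendsto_theta3 fs])
  have l2: "(\<lambda>n. theta2 (s n)) \<longlonglongrightarrow> 0" by (rule filterlim_compose[OF tendsto_theta2 fs])
  have "(\<lambda>n. modular_lambda (s n)) \<longlonglongrightarrow> 0 ^ 4 / 1 ^ 4"
    unfolding modular_lambda_def by (intro tendsto_intros l2 l3) auto
  moreover have "isCont ?F 0"
    using holomorphic_on_imp_continuous_on[OF holomorphic_hyp_2F1_half] by (simp add: continuous_on_eq_continuous_at)
  ultimately have "(\<lambda>n. ?F (modular_lambda (s n))) \<longlonglongrightarrow> ?F 0"
    using isCont_tendsto_compose by fastforce
  then have "(\<lambda>n. ?F (modular_lambda (s n)) / theta3 (s n) ^ 2) \<longlonglongrightarrow> ?F 0 / 1 ^ 2"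
    by (intro tendsto_intros l3) auto
  then have "?F (modular_lambda \<tau>) / theta3 \<tau> ^ 2 = 1"
    unfolding const hyp_2F1_half_0 by (simp add: tendsto_const_iff)
  then show ?thesis using theta3_nonzero[OF im] by simp
qed

section \<open>Identification of the two root branches\<close>

lemma root_branch_unique:
  assumes rb: "root_branch n f r g" and n: "n > 0"
    and cont: "continuous_on upper_half_plane h" and nz: "\<And>t. Im t > 0 \<Longrightarrow> h t \<noteq> 0"
    and pow: "\<And>t. Im t > 0 \<Longrightarrow> h t ^ n = f t"
    and lim: "((\<lambda>t. h t / exp (2 * pi * \<i> * r * t)) \<longlongrightarrow> of_real c) (filtercomap Im at_top)" and c: "c > 0"
    and t: "Im t > 0"
  shows "g t = h t"
proof -
  have g: "g holomorphic_on upper_half_plane" "\<And>t. Im t > 0 \<Longrightarrow> g t ^ n = f t"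
    using rb by (auto simp: root_branch_def)
  obtain d :: real where d: "d > 0" "((\<lambda>t. g t / exp (2 * pi * \<i> * r * t)) \<longlongrightarrow> of_real d) (filtercomap Im at_top)"
    using rb by (auto simp: root_branch_def)
  \<comment> \<open>The quotient is continuous on a connected set with values among the n-th roots
    of unity, hence constant; the two positive leading coefficients make the constant a positive
    real, so it is 1.\<close>
  define u where "u = (\<lambda>t. g t / h t)"
  have un: "u t ^ n = 1" if "Im t > 0" for t
    using g(2)[OF that] pow[OF that] nz[OF that] by (metis power_divide power_not_zero divide_self u_def)
  have "continuous_on upper_half_plane u"
    unfolding u_def using nz by (intro continuous_intros holomorphic_on_imp_continuous_on[OF g(1)] cont) auto
  moreover have "finite (u ` upper_half_plane)"
    by (rule finite_subset[OF _ finite_roots_unity[of n]]) (use un n in auto)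
  ultimately have "u constant_on upper_half_plane"
    using continuous_finite_range_constant[OF connected_upper_half_plane] by blast
  then obtain z where z: "\<And>t. Im t > 0 \<Longrightarrow> u t = z" by (auto simp: constant_on_def)
  have zn: "z ^ n = 1" using un[OF t] z[OF t] by simp
  have "\<forall>\<^sub>F t in filtercomap Im at_top. g t / exp (2 * pi * \<i> * r * t) = z * (h t / exp (2 * pi * \<i> * r * t))"
    using eventually_Im_ge[of 1]
  proof eventually_elim
    case (elim t)
    then have "g t = z * h t" using z[of t] nz[of t] by (simp add: u_def field_simps)
    then show ?case by simp
  qed
  from Lim_transform_eventually[OF d(2) this]
  have "((\<lambda>t. z * (h t / exp (2 * pi * \<i> * r * t))) \<longlongrightarrow> of_real d) (filtercomap Im at_top)" .
  moreover have "((\<lambda>t. z * (h t / exp (2 * pi * \<i> * r * t))) \<longlongrightarrow> z * of_real c) (filtercomap Im at_top)"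
    by (intro tendsto_mult tendsto_const lim)
  ultimately have "of_real d = z * of_real c" using tendsto_unique filtercomap_Im_neq_bot by blast
  then have zr: "z = of_real (d / c)" using c by (simp add: field_simps)
  then have "complex_of_real ((d / c) ^ n) = of_real 1" using zn by simp
  then have "(d / c) ^ n = 1" by (simp only: of_real_eq_iff)
  then have "d / c = 1" using power_eq_1_iff[of "d / c" n] n d c by (simp add: power_eq_1_iff)
  then have "z = 1" using zr by simp
  then show ?thesis using z[OF t] nz[OF t] by (simp add: u_def)
qed

lemma sqrt_branch_theta:
  assumes rb: "root_branch 2 (\<lambda>t. 1 - modular_lambda t) 0 g" and t: "Im t > 0"
  shows "g t = theta4 t ^ 2 / theta3 t ^ 2"
proof (rule root_branch_unique[OF rb, where h = "\<lambda>t. theta4 t ^ 2 / theta3 t ^ 2" and c = 1])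
  show "continuous_on upper_half_plane (\<lambda>t. theta4 t ^ 2 / theta3 t ^ 2)"
    using theta3_nonzero
    by (intro continuous_intros holomorphic_on_imp_continuous_on holomorphic_theta3 holomorphic_theta4) auto
  show "(theta4 t ^ 2 / theta3 t ^ 2) ^ 2 = 1 - modular_lambda t" if "Im t > 0" for t
    unfolding modular_lambda_complement[OF that] by (simp add: power_divide flip: power_mult)
  have "((\<lambda>t. theta4 t ^ 2 / theta3 t ^ 2) \<longlongrightarrow> 1 ^ 2 / 1 ^ 2) (filtercomap Im at_top)"
    by (intro tendsto_intros tendsto_theta3 tendsto_theta4) auto
  then show "((\<lambda>t. theta4 t ^ 2 / theta3 t ^ 2 / exp (2 * pi * \<i> * of_real 0 * t)) \<longlongrightarrow> of_real 1) (filtercomap Im at_top)"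
    by simp
qed (use theta3_nonzero theta4_nonzero t in auto)

text \<open>\<lambda> (1 - \<lambda>) = (theta2 theta3 theta4)^4 / theta3^12 = 16 eta^12 /
  theta3^12, and 2^(2/3) is the positive sixth root of 16.\<close>

lemma sixth_branch_theta:
  assumes rb: "root_branch 6 (\<lambda>t. modular_lambda t * (1 - modular_lambda t)) (1/12) g" and t: "Im t > 0"
  shows "g t = of_real (2 powr (2/3)) * dedekind_eta t ^ 2 / theta3 t ^ 2"
proof (rule root_branch_unique[OF rb, where h = "\<lambda>t. of_real (2 powr (2/3)) * dedekind_eta t ^ 2 / theta3 t ^ 2" and c = "2 powr (2/3)"])
  show "continuous_on upper_half_plane (\<lambda>t. of_real (2 powr (2/3)) * dedekind_eta t ^ 2 / theta3 t ^ 2)"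
    using theta3_nonzero
    by (intro continuous_intros holomorphic_on_imp_continuous_on[OF holomorphic_theta3] continuous_on_dedekind_eta) auto
  show "(of_real (2 powr (2/3)) * dedekind_eta t ^ 2 / theta3 t ^ 2) ^ 6 = modular_lambda t * (1 - modular_lambda t)" if t: "Im t > 0" for t
  proof -
    have "(2 powr (2/3)) ^ 6 = (16::real)"
      using powr_realpow[of "2 powr (2/3)" 6] by (simp add: powr_powr flip: powr_realpow)
    then have "complex_of_real (2 powr (2/3)) ^ 6 = 16" by (metis of_real_numeral of_real_power)
    then have "(of_real (2 powr (2/3)) * dedekind_eta t ^ 2 / theta3 t ^ 2) ^ 6 = (2 * dedekind_eta t ^ 3) ^ 4 / theta3 t ^ 12"
      by (simp add: power_mult_distrib power_divide flip: power_mult)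
    also have "\<dots> = (theta2 t ^ 4 * theta4 t ^ 4) * theta3 t ^ 4 / theta3 t ^ 12"
      unfolding theta_product_eta[OF t, symmetric] by (simp add: power_mult_distrib)
    also have "\<dots> = theta2 t ^ 4 / theta3 t ^ 4 * (theta4 t ^ 4 / theta3 t ^ 4)"
      using theta3_nonzero[OF t] by (simp add: field_simps flip: power_add)
    finally show ?thesis unfolding modular_lambda_complement[OF t] by (simp add: modular_lambda_def)
  qed
  have "((\<lambda>t. of_real (2 powr (2/3)) * (dedekind_eta t / exp (pi * \<i> * t / 12)) ^ 2 / theta3 t ^ 2) \<longlongrightarrow>
      of_real (2 powr (2/3)) * 1 ^ 2 / 1 ^ 2) (filtercomap Im at_top)"
    by (intro tendsto_intros tendsto_theta3 tendsto_dedekind_eta_scaled) auto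
  moreover have "of_real (2 powr (2/3)) * (dedekind_eta t / exp (pi * \<i> * t / 12)) ^ 2 / theta3 t ^ 2 =
      of_real (2 powr (2/3)) * dedekind_eta t ^ 2 / theta3 t ^ 2 / exp (2 * pi * \<i> * of_real (1/12) * t)" for t
  proof -
    have "exp (pi * \<i> * t / 12) ^ 2 = exp (2 * pi * \<i> * of_real (1/12) * t)"
      using exp_of_nat_mult[of 2 "pi * \<i> * t / 12"] by (simp add: mult_ac)
    then show ?thesis by (simp add: power_divide)
  qed
  ultimately show "((\<lambda>t. of_real (2 powr (2/3)) * dedekind_eta t ^ 2 / theta3 t ^ 2 / exp (2 * pi * \<i> * of_real (1/12) * t)) \<longlongrightarrow>
      of_real (2 powr (2/3))) (filtercomap Im at_top)"
    by simp
qed (use theta3_nonzero dedekind_eta_nonzero t in auto)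

text \<open>The disc conditions say |Re z| \<le> |z|^2, and inversion exchanges this inequality with
  |Re z| \<le> 1.\<close>

lemma Gamma2_domain_neg_inverse:
  assumes "\<sigma> \<in> Gamma2_fundamental_domain"
  shows "-1 / \<sigma> \<in> Gamma2_fundamental_domain"
proof -
  define N where "N = (cmod \<sigma>)\<^sup>2"
  have s: "Im \<sigma> > 0" "\<bar>Re \<sigma>\<bar> \<le> 1" "cmod (\<sigma> - 1/2) \<ge> 1/2" "cmod (\<sigma> + 1/2) \<ge> 1/2"
    using assms by (auto simp: Gamma2_fundamental_domain_def)
  have s0: "\<sigma> \<noteq> 0" using s by auto
  have N: "N > 0" using s0 by (simp add: N_def)
  have N2: "N = (Re \<sigma>)\<^sup>2 + (Im \<sigma>)\<^sup>2" by (simp add: N_def cmod_power2)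
  have half: "cmod (z - of_real c) \<ge> 1/2 \<longleftrightarrow> 2 * c * Re z \<le> (cmod z)\<^sup>2" if "c\<^sup>2 = 1/4" for z c
  proof -
    have "cmod (z - of_real c) \<ge> 1/2 \<longleftrightarrow> (cmod (z - of_real c))\<^sup>2 \<ge> (1/2)\<^sup>2"
      by (simp only: power_mono_iff[OF _ norm_ge_zero pos2] zero_le_divide_1_iff zero_le_numeral)
    also have "\<dots> \<longleftrightarrow> 2 * c * Re z \<le> (cmod z)\<^sup>2"
    proof -
      have "(cmod (z - of_real c))\<^sup>2 = (cmod z)\<^sup>2 - 2 * c * Re z + c\<^sup>2"
        unfolding cmod_power2 by (simp add: power2_eq_square algebra_simps)
      then show ?thesis using that by (simp add: power_divide)
    qed
    finally show ?thesis .
  qed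
  have h1: "cmod (z - 1/2) \<ge> 1/2 \<longleftrightarrow> Re z \<le> (cmod z)\<^sup>2" for z using half[of "1/2" z] by (simp add: power2_eq_square)
  have h2: "cmod (z + 1/2) \<ge> 1/2 \<longleftrightarrow> - Re z \<le> (cmod z)\<^sup>2" for z using half[of "-1/2" z] by (simp add: power2_eq_square)
  have re: "Re (-1 / \<sigma>) = - Re \<sigma> / N" using N2 by (simp add: Re_divide)
  have n2: "(cmod (-1 / \<sigma>))\<^sup>2 = 1 / N" by (simp add: norm_divide power_divide N_def)
  have "\<bar>Re \<sigma>\<bar> \<le> N" using s(3,4) unfolding h1 h2 N_def by (simp add: abs_le_iff)
  then have "\<bar>Re (-1 / \<sigma>)\<bar> \<le> 1" unfolding re using N by (simp add: abs_divide divide_le_eq)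
  moreover have "cmod (-1 / \<sigma> - 1/2) \<ge> 1/2" unfolding h1 n2 re using s(2) N by (intro divide_right_mono) auto
  moreover have "cmod (-1 / \<sigma> + 1/2) \<ge> 1/2" unfolding h2 n2 re using s(2) N divide_right_mono[of "Re \<sigma>" 1 N] by simp
  ultimately show ?thesis using Im_neg_inverse_pos[OF s(1)] by (simp add: Gamma2_fundamental_domain_def)
qed

text \<open>The equation \<omega>1 \<delta> = 2 pi eta^2 singles out one of the twelve roots of the
  discriminant and thereby forces the witness; \<open>curve_discr_eta\<close> says that it is such a
  root.\<close>

theorem theorem3:
  fixes g2 g3 \<omega>1 \<omega>2 \<tau> :: complex and sqrt_br sixth_br :: "complex \<Rightarrow> complex"
  assumes "curve_discr g2 g3 \<noteq> 0"
    and "is_period_lattice g2 g3 (lattice_of \<omega>1 \<omega>2)"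
    and "\<tau> = \<omega>2 / \<omega>1" and "Im \<tau> > 0"
    and "root_branch 2 (\<lambda>t. 1 - modular_lambda t) 0 sqrt_br"
    and "root_branch 6 (\<lambda>t. modular_lambda t * (1 - modular_lambda t)) (1 / 12) sixth_br"
    and "\<tau> \<in> Gamma2_domain_cusp1" and "cmod (1 / (1 - modular_lambda \<tau>)) < 1"
  shows "\<exists>\<delta>. \<delta> ^ 12 = curve_discr g2 g3 \<and> \<omega>1 * \<delta> = 2 * pi * dedekind_eta \<tau> ^ 2 \<and>
           \<omega>1 = of_real (2 powr (1 / 3)) * (pi * \<i> / ((\<tau> + 1) * sqrt_br \<tau>)) * sixth_br \<tau> *
                inverse \<delta> * hyp_2F1 (1 / 2) (1 / 2) 1 (1 / (1 - modular_lambda \<tau>))"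
proof (intro exI conjI)
  note \<tau> = \<open>Im \<tau> > 0\<close>
  define \<delta> where "\<delta> = 2 * pi * dedekind_eta \<tau> ^ 2 / \<omega>1"
  have \<omega>: "\<omega>1 \<noteq> 0" using assms by auto
  have \<eta>: "dedekind_eta \<tau> \<noteq> 0" by (rule dedekind_eta_nonzero[OF \<tau>])
  show "(2 * pi * dedekind_eta \<tau> ^ 2 / \<omega>1) ^ 12 = curve_discr g2 g3"
    using curve_discr_eta[OF \<tau> assms(3,2)] by simp
  show "\<omega>1 * (2 * pi * dedekind_eta \<tau> ^ 2 / \<omega>1) = 2 * pi * dedekind_eta \<tau> ^ 2" using \<omega> by simp
  define \<sigma> where "\<sigma> = \<tau> + 1"
  have "Im \<sigma> > 0" using \<tau> by (simp add: \<sigma>_def)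
  moreover from this have "\<sigma> \<noteq> 0" by auto
  moreover have "\<sigma> \<in> Gamma2_fundamental_domain"
    using assms(7) by (simp add: \<sigma>_def Gamma2_domain_cusp1_def)
  ultimately have \<sigma>: "Im \<sigma> > 0" "\<sigma> \<in> Gamma2_fundamental_domain" "\<sigma> \<noteq> 0" by auto
  have th: "theta3 \<sigma> = theta4 \<tau>" "theta4 \<sigma> = theta3 \<tau>" by (simp_all add: \<sigma>_def)
  have nz: "theta3 \<tau> \<noteq> 0" "theta4 \<tau> \<noteq> 0" using theta3_nonzero[OF \<tau>] theta4_nonzero[OF \<tau>] by auto
  \<comment> \<open>At -1/\<sigma>, theta2 and theta3 turn into theta4 and theta3 at \<sigma> =
    \<tau> + 1, that is, into theta3 and theta4 at \<tau>.\<close>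
  have lam: "modular_lambda (-1 / \<sigma>) = 1 / (1 - modular_lambda \<tau>)"
    unfolding modular_lambda_complement[OF \<tau>] modular_lambda_def[of "-1 / \<sigma>"]
      theta2_inversion_pow4[OF \<sigma>(1)] theta3_inversion_pow4[OF \<sigma>(1)] th using \<sigma>(3) nz by simp
  have F: "hyp_2F1 (1/2) (1/2) 1 (1 / (1 - modular_lambda \<tau>)) = - \<i> * \<sigma> * theta4 \<tau> ^ 2"
    using hyp_lambda_eq_theta3_sq[OF Gamma2_domain_neg_inverse[OF \<sigma>(2)]] assms(8)
    unfolding lam theta3_inversion[OF \<sigma>(1)] th by simp
  have pw: "complex_of_real (2 powr (1/3)) * of_real (2 powr (2/3)) = 2"
    by (simp flip: of_real_mult powr_add)
  \<comment> \<open>The factor \<i> meets the -\<i> of the inversion, \<sigma> and the theta squares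
    cancel, and the two powers of 2 multiply to the 2 in \<delta>.\<close>
  have "of_real (2 powr (1/3)) * (pi * \<i> / (\<sigma> * (theta4 \<tau> ^ 2 / theta3 \<tau> ^ 2))) *
      (of_real (2 powr (2/3)) * dedekind_eta \<tau> ^ 2 / theta3 \<tau> ^ 2) *
      inverse (2 * pi * dedekind_eta \<tau> ^ 2 / \<omega>1) * (- \<i> * \<sigma> * theta4 \<tau> ^ 2) =
      (of_real (2 powr (1/3)) * of_real (2 powr (2/3))) / 2 * \<omega>1"
    using \<sigma>(3) nz \<eta> \<omega> by (simp add: field_simps)
  also have "\<dots> = \<omega>1" unfolding pw by simp
  finally show "\<omega>1 = of_real (2 powr (1 / 3)) * (pi * \<i> / ((\<tau> + 1) * sqrt_br \<tau>)) * sixth_br \<tau> *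
      inverse (2 * pi * dedekind_eta \<tau> ^ 2 / \<omega>1) * hyp_2F1 (1 / 2) (1 / 2) 1 (1 / (1 - modular_lambda \<tau>))"
    unfolding F sqrt_branch_theta[OF assms(5) \<tau>] sixth_branch_theta[OF assms(6) \<tau>] \<sigma>_def by simp
qed

end
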